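(* For each $n\in\mathbb{N}$ let $G=G_n$ be a simple graph on $[n]$ and let $d=d_n$ be a positive integer. Write $N=\mathsf{num}_G(C_4)+\mathsf{num}_G(P_2)+\mathsf{num}_G(E)$. Suppose that, as $n\to\infty$, \[ d^2\ll N,\qquad \mathsf{num}_G(K_{1,4})+\mathsf{num}_G(K_{2,4})+\mathsf{num}_G(C_4^{2,e})+\mathsf{num}_G(C_4^{2,v})\ll N^2 . \] Then $\mathsf{TV}(\kappa_4(W(G,d)),\kappa_4(M(G)))\to 1$ as $n\to\infty$. In particular, $\mathsf{TV}(W(G,d),M(G))\to 1$.
   Context: Masked Wishart law: for a graph $G$ on $[n]$ with adjacency matrix $A_G$, $W(G,d)$ is the law of $A_G\odot \bigl(d^{-1/2}(X^\top X-dI_n)\bigr)$, where $X\in\mathbb{R}^{d\times n}$ has i.i.d. standard Gaussian entries and $\odot$ is the entrywise (Schur) product. Masked GOE law: $M(G)$ is the law of $A_G\odot M$, where $M$ is an $n\times n$ GOE matrix, i.e. a symmetric matrix with standard Gaussian off-diagonal entries, $\mathcal N(0,2)$ diagonal entries, and mutually independent entries on or above the diagonal. $\mathsf{TV}$ is total variation distance. Statistic: let $C_4(G)=\{(i,j,k,\ell):(i,j),(j,k),(k,\ell),(\ell,i)\in E(G),\ i<\min(j,k,\ell),\ j<\ell\}$ (with $i,j,k,\ell$ distinct, so each 4-cycle is listed exactly once) and $P_2(G)=\{(i,j,k):(i,j),(j,k)\in E(G),\ i<k\}$ (each 2-path listed exactly once); $E(G)$ is the edge set, each edge listed once. Define $\kappa_4:\mathbb{R}^{n\times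 n}\to\mathbb{R}$ by \[ \kappa_4(M)=\sum_{(i,j,k,\ell)\in C_4(G)}M_{i,j}M_{j,k}M_{k,\ell}M_{\ell,i}+\sum_{(i,j,k)\in P_2(G)}(M_{i,j}^2-1)(M_{j,k}^2-1)+\sum_{(i,j)\in E(G)}(M_{i,j}^4-6M_{i,j}^2+3). \] For a law $\mu$ on $\mathbb{R}^{n\times n}$, $\kappa_4(\mu)$ denotes the law of $\kappa_4(M)$ for $M\sim\mu$. Subgraph counts: for a fixed graph $H$, $\mathsf{num}_G(H)$ is the number of (not necessarily induced) subgraphs of $G$ isomorphic to $H$. $E$ is a single edge on two vertices; $P_2$ is the path with 2 edges; $C_4$ is the 4-cycle; $K_{r,s}$ is the complete bipartite graph; $C_4^{2,e}$ is the graph on 6 vertices and 7 edges formed by two 4-cycles sharing exactly one edge (and its two endpoints); $C_4^{2,v}$ is the graph on 7 vertices and 8 edges formed by two 4-cycles sharing exactly one vertex. Asymptotics: $f(n)\ll g(n)$ means $\lim_{n\to\infty} g(n)/f(n)=\infty$ (with $g/0=+\infty$ for $g>0$). *)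

theory Defs
  imports "HOL-Probability.Probability"
begin

text \<open>Finite simple graphs: a vertex set together with a set of two-element edges.\<close>

type_synonym 'a ugraph = "'a set \<times> 'a set set"

definition simple_graph :: "'a ugraph \<Rightarrow> bool" where
  "simple_graph G \<longleftrightarrow> finite (fst G) \<and> (\<forall>e\<in>snd G. e \<subseteq> fst G \<and> card e = 2)"

definition simple_graph_on :: "nat \<Rightarrow> nat ugraph \<Rightarrow> bool" where
  "simple_graph_on n G \<longleftrightarrow> simple_graph G \<and> fst G = {1..n}"

definition subgraph_of :: "'a ugraph \<Rightarrow> 'a ugraph \<Rightarrow> bool" where
  "subgraph_of H G \<longleftrightarrow> simple_graph H \<and> fst H \<subseteq> fst G \<and> snd H \<subseteq> snd G"

definition graph_iso :: "'a ugraph \<Rightarrow> 'b ugraph \<Rightarrow> bool" where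
  "graph_iso G H \<longleftrightarrow> (\<exists>f. bij_betw f (fst G) (fst H) \<and>
     (\<forall>u\<in>fst G. \<forall>v\<in>fst G. {u, v} \<in> snd G \<longleftrightarrow> {f u, f v} \<in> snd H))"

definition num_sub :: "'a ugraph \<Rightarrow> 'b ugraph \<Rightarrow> nat" where
  "num_sub G H = card {S. subgraph_of S G \<and> graph_iso S H}"

definition single_edge :: "nat ugraph" where
  "single_edge = ({1..2}, {{1, 2}})"

definition path2 :: "nat ugraph" where
  "path2 = ({1..3}, {{1, 2}, {2, 3}})"

definition cycle4 :: "nat ugraph" where
  "cycle4 = ({1..4}, {{1, 2}, {2, 3}, {3, 4}, {4, 1}})"

definition complete_bipartite :: "nat \<Rightarrow> nat \<Rightarrow> nat ugraph" where
  "complete_bipartite r s = ({1..r+s}, {{i, j} | i j. i \<in> {1..r} \<and> j \<in> {r+1..r+s}})"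

text \<open>Two 4-cycles sharing exactly the edge \<open>{1, 2}\<close>.\<close>

definition cycle4_2e :: "nat ugraph" where
  "cycle4_2e = ({1..6}, {{1, 2}, {2, 3}, {3, 4}, {4, 1}, {2, 5}, {5, 6}, {6, 1}})"

text \<open>Two 4-cycles sharing exactly the vertex 1.\<close>

definition cycle4_2v :: "nat ugraph" where
  "cycle4_2v = ({1..7}, {{1, 2}, {2, 3}, {3, 4}, {4, 1}, {1, 5}, {5, 6}, {6, 7}, {7, 1}})"

text \<open>A real \<open>n \<times> n\<close> matrix is an extensional function on \<open>{1..n} \<times> {1..n}\<close>.\<close>

type_synonym rmat = "nat \<times> nat \<Rightarrow> real"

definition mat_space :: "nat \<Rightarrow> rmat measure" where
  "mat_space n = PiM ({1..n} \<times> {1..n}) (\<lambda>_. borel)"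

definition adj :: "nat ugraph \<Rightarrow> rmat" where
  "adj G = (\<lambda>(i, j). if {i, j} \<in> snd G then 1 else 0)"

definition schur :: "nat \<Rightarrow> rmat \<Rightarrow> rmat \<Rightarrow> rmat" where
  "schur n A M = (\<lambda>p\<in>{1..n} \<times> {1..n}. A p * M p)"

definition gaussian_matrix :: "nat \<Rightarrow> nat \<Rightarrow> rmat measure" where
  "gaussian_matrix d n = PiM ({1..d} \<times> {1..n}) (\<lambda>_. density lborel std_normal_density)"

text \<open>The matrix \<open>d\<^sup>-\<^sup>1\<^sup>/\<^sup>2 (X\<^sup>T X - d I)\<close> for a \<open>d \<times> n\<close> matrix \<open>X\<close>.\<close>

definition wishart_transform :: "nat \<Rightarrow> nat \<Rightarrow> rmat \<Rightarrow> rmat" where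
  "wishart_transform n d X = (\<lambda>(i, j)\<in>{1..n} \<times> {1..n}.
     ((\<Sum>k=1..d. X (k, i) * X (k, j)) - (if i = j then real d else 0)) / sqrt (real d))"

definition masked_wishart :: "nat \<Rightarrow> nat ugraph \<Rightarrow> nat \<Rightarrow> rmat measure" where
  "masked_wishart n G d =
     distr (gaussian_matrix d n) (mat_space n) (\<lambda>X. schur n (adj G) (wishart_transform n d X))"

text \<open>The entries on or above the diagonal are independent and the rest follows by symmetry.
  The second argument of \<^const>\<open>normal_density\<close> is the standard deviation, so the
  diagonal entries have variance 2.\<close>

definition goe :: "nat \<Rightarrow> rmat measure" where
  "goe n = distr
     (PiM {(i, j). 1 \<le> i \<and> i \<le> j \<and> j \<le> n}
        (\<lambda>(i, j). density lborel (normal_density 0 (if i = j then sqrt 2 else 1))))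
     (mat_space n)
     (\<lambda>Y. \<lambda>(i, j)\<in>{1..n} \<times> {1..n}. Y (min i j, max i j))"

definition masked_goe :: "nat \<Rightarrow> nat ugraph \<Rightarrow> rmat measure" where
  "masked_goe n G = distr (goe n) (mat_space n) (schur n (adj G))"

definition C4_set :: "nat ugraph \<Rightarrow> (nat \<times> nat \<times> nat \<times> nat) set" where
  "C4_set G = {(i, j, k, l). distinct [i, j, k, l] \<and>
     {i, j} \<in> snd G \<and> {j, k} \<in> snd G \<and> {k, l} \<in> snd G \<and> {l, i} \<in> snd G \<and>
     i < Min {j, k, l} \<and> j < l}"

definition P2_set :: "nat ugraph \<Rightarrow> (nat \<times> nat \<times> nat) set" where
  "P2_set G = {(i, j, k). {i, j} \<in> snd G \<and> {j, k} \<in> snd G \<and> i < k}"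

text \<open>Each edge is listed once, from its smaller to its larger endpoint. The orientation is
  immaterial for symmetric matrices.\<close>

definition edge_pairs :: "nat ugraph \<Rightarrow> (nat \<times> nat) set" where
  "edge_pairs G = {(i, j). {i, j} \<in> snd G \<and> i < j}"

definition kappa4 :: "nat ugraph \<Rightarrow> rmat \<Rightarrow> real" where
  "kappa4 G M =
     (\<Sum>(i, j, k, l)\<in>C4_set G. M (i, j) * M (j, k) * M (k, l) * M (l, i)) +
     (\<Sum>(i, j, k)\<in>P2_set G. (M (i, j) ^ 2 - 1) * (M (j, k) ^ 2 - 1)) +
     (\<Sum>(i, j)\<in>edge_pairs G. M (i, j) ^ 4 - 6 * M (i, j) ^ 2 + 3)"

definition kappa4_law :: "nat ugraph \<Rightarrow> rmat measure \<Rightarrow> real measure" where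
  "kappa4_law G \<mu> = distr \<mu> borel (kappa4 G)"

text \<open>Total variation distance of two probability measures on the same measurable space,
  normalised to take values in \<open>[0, 1]\<close>.\<close>

definition tv_dist :: "'a measure \<Rightarrow> 'a measure \<Rightarrow> real" where
  "tv_dist \<mu> \<nu> = (SUP A\<in>sets \<mu>. \<bar>measure \<mu> A - measure \<nu> A\<bar>)"

text \<open>For nonnegative sequences. In \<^typ>\<open>ereal\<close>, \<open>x / 0 = \<infinity>\<close> for \<open>x > 0\<close>
  (and \<open>0 / 0 = 0\<close>).\<close>

definition much_less :: "(nat \<Rightarrow> real) \<Rightarrow> (nat \<Rightarrow> real) \<Rightarrow> bool"  (infix \<open>\<lless>\<close> 50) where
  "f \<lless> g \<longleftrightarrow> ((\<lambda>n. ereal (g n) / ereal (f n)) \<longlonglongrightarrow> \<infinity>)"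

end

theory Submission
  imports Defs
begin

text \<open>
The statistic separates the two laws by Chebyshev's inequality. Let \<open>N\<close> be the number of
summands of \<open>\<kappa>\<^sub>4\<close>, up to constants, and let \<open>c\<close> be the sum of the four subgraph counts that are
assumed to be small.

Under the masked GOE law each summand has mean 0, and two summands of the same kind on
different vertex sets are uncorrelated, because one of them has an edge variable that the other
lacks and that averages to 0. So the mean is 0 and the variance is \<open>O(N)\<close>; the three kinds of
summands may be treated separately, because the variance of a sum of three variables is at most
three times the sum of their variances. Under the masked Wishart law a 4-cycle, a 2-path and an
edge contribute means \<open>1/d\<close>, \<open>2/d\<close> and \<open>6/d\<close>, so the mean is at least \<open>N/d\<close>. It remains to see
that both variances are of smaller order than \<open>(N/d)\<^sup>2\<close>. For the GOE law this is \<open>d\<^sup>2 \<lless> N\<close>.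

For the Wishart law write \<open>x\<^sub>v\<close> for the column of the vertex \<open>v\<close>. The columns are
independent, so two summands with common vertex set \<open>J\<close> are conditionally independent given \<open>(x\<^sub>v)\<close>
for \<open>v \<in> J\<close>. Hence the mean of their product is the mean of \<open>h h'\<close>, where \<open>h\<close> and \<open>h'\<close> are the two
conditional expectations. These are explicit: with \<open>w\<^sub>i\<^sub>j = \<langle>x\<^sub>i, x\<^sub>j\<rangle> / \<surd>d\<close> and \<open>s\<^sub>i = |x\<^sub>i|\<^sup>2 / d\<close>,
averaging out one vertex after another sends

\<^item> a cycle to \<open>w\<^sub>i\<^sub>j w\<^sub>j\<^sub>k w\<^sub>k\<^sub>i / \<surd>d\<close>, then \<open>w\<^sub>i\<^sub>j\<^sup>2 / d\<close>, then \<open>s\<^sub>i / d\<close>, then \<open>1 / d\<close>;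
\<^item> a 2-path with center \<open>j\<close> to \<open>(s\<^sub>j - 1) (w\<^sub>j\<^sub>k\<^sup>2 - 1)\<close> or \<open>(s\<^sub>i - 1) (s\<^sub>k - 1) + 2 w\<^sub>i\<^sub>k\<^sup>2 / d\<close>, then
  \<open>(s\<^sub>j - 1)\<^sup>2\<close> or \<open>2 s\<^sub>k / d\<close>, then \<open>2 / d\<close>;
\<^item> an edge to \<open>3 (s\<^sub>i - 1)\<^sup>2\<close>, then \<open>6 / d\<close>.

Their second moments are \<open>O(1)\<close> if all vertices are kept, \<open>O(1/d)\<close> if one vertex is
averaged out and at least two are kept, and \<open>O(1/d\<^sup>2)\<close> otherwise (\<open>reduces_cycle\<close>, \<open>reduces_path\<close>,
\<open>reduces_edge\<close>). The means are nonnegative, so every covariance is bounded in terms of the number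
of common vertices alone; disjoint summands are independent.

What is left is to count pairs of summands by their number of common vertices
(\<open>meets_cycle_bound\<close>, \<open>meets_path_bound\<close>, \<open>meets_edge_bound\<close>). Pairs on the same vertices number
\<open>O(N)\<close>. Two 4-cycles that share three vertices are counted by the sum of the cubes of the
codegrees, and two 2-paths that share two vertices by the sum of the cubes of the degrees. Since
\<open>d y\<^sup>3 \<le> y\<^sup>4 + d\<^sup>2 y\<^sup>2\<close>, these are controlled by the fourth moments of the degrees and codegrees,
which are \<open>O(N + c)\<close> because of \<open>K\<^sub>1\<^sub>,\<^sub>4\<close> and \<open>K\<^sub>2\<^sub>,\<^sub>4\<close>, and by the second moments, which are \<open>O(N)\<close>.
Two 2-paths that share one vertex are counted by the fourth moment of the degrees. The other
configurations of two 4-cycles are the glued pairs counted in \<open>c\<close>, copies of \<open>K\<^sub>2\<^sub>,\<^sub>4\<close>, and one mixed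
case that is reduced to these by \<open>a b \<le> a\<^sup>2 + b\<^sup>2\<close>. Altogether the Wishart variance is
\<open>O((d\<^sup>2 N + c) / d\<^sup>2)\<close>, and the total variation distance of the two laws of \<open>\<kappa>\<^sub>4\<close> falls short of 1 by
\<open>O(d\<^sup>2 / N + c / N\<^sup>2)\<close> (\<open>tv_bounds\<close>). The laws of the matrices are at least as far apart as those of
\<open>\<kappa>\<^sub>4\<close>.
\<close>

section \<open>Copies of a fixed graph\<close>

text \<open>Counting up to a constant factor: if the entries of each list in \<open>Q\<close> lie among the \<open>m\<close>
entries of some list in \<open>R\<close>, then at most \<open>m\<^sup>r\<close> lists of \<open>Q\<close> belong to the same list of \<open>R\<close>. All
configurations of vertices below are lists, and this is how one family of configurations is
bounded by another without keeping track of automorphisms or of the order of the vertices.\<close>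

lemma card_list_le:
  fixes Q R :: "'a list set"
  assumes "finite R"
    and "\<And>q. q \<in> Q \<Longrightarrow> length q = r \<and> (\<exists>\<rho>\<in>R. length \<rho> = m \<and> set q \<subseteq> set \<rho>)"
  shows "card Q \<le> m ^ r * card R"
proof -
  let ?R = "{\<rho>\<in>R. length \<rho> = m}"
  let ?F = "\<lambda>\<rho>. {q. set q \<subseteq> set \<rho> \<and> length q = r}"
  have "card Q \<le> card (\<Union>\<rho>\<in>?R. ?F \<rho>)"
    using assms by (intro card_mono finite_UN_I) (auto simp: finite_lists_length_eq)
  also have "\<dots> \<le> (\<Sum>\<rho>\<in>?R. card (?F \<rho>))"
    using assms(1) by (intro card_UN_le) auto
  also have "\<dots> \<le> (\<Sum>\<rho>\<in>?R. m ^ r)"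
    by (intro sum_mono) (auto simp: card_lists_length_eq card_length power_mono)
  also have "\<dots> \<le> m ^ r * card R"
    using assms(1) by (auto intro!: mult_right_mono card_mono)
  finally show ?thesis .
qed

definition emb :: "'b ugraph \<Rightarrow> 'a ugraph \<Rightarrow> ('b \<Rightarrow> 'a) \<Rightarrow> bool" where
  "emb H G f \<longleftrightarrow> inj_on f (fst H) \<and> f ` fst H \<subseteq> fst G \<and> (\<forall>e\<in>snd H. f ` e \<in> snd G)"

definition img :: "('b \<Rightarrow> 'a) \<Rightarrow> 'b ugraph \<Rightarrow> 'a ugraph" where
  "img f H = (f ` fst H, (`) f ` snd H)"

text \<open>The isomorphism of a copy with \<open>H\<close> is read backwards as an embedding of \<open>H\<close> into \<open>G\<close>.
Distinct embeddings may have the same image, so this describes a set and not a bijection.\<close>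

lemma copies_eq_img_emb:
  assumes H: "simple_graph H" and G: "simple_graph G"
  shows "{S. subgraph_of S G \<and> graph_iso S H} = {img f H | f. emb H G f}"
proof (intro equalityI subsetI)
  fix S assume "S \<in> {S. subgraph_of S G \<and> graph_iso S H}"
  then obtain h where S: "simple_graph S" "fst S \<subseteq> fst G" "snd S \<subseteq> snd G"
    and h: "bij_betw h (fst S) (fst H)"
    and e: "\<And>u v. u \<in> fst S \<Longrightarrow> v \<in> fst S \<Longrightarrow> {u, v} \<in> snd S \<longleftrightarrow> {h u, h v} \<in> snd H"
    by (auto simp: subgraph_of_def graph_iso_def)
  define f where "f = inv_into (fst S) h"
  have f: "bij_betw f (fst H) (fst S)"
    unfolding f_def using h by (rule bij_betw_inv_into)
  have hf: "h (f x) = x" if "x \<in> fst H" for x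
    using that h unfolding f_def by (meson bij_betw_inv_into_right)
  have fh: "f (h x) = x" if "x \<in> fst S" for x
    using that h unfolding f_def by (meson bij_betw_inv_into_left)
  have fS: "f x \<in> fst S" if "x \<in> fst H" for x
    using that f by (meson bij_betwE)
  have hH: "h x \<in> fst H" if "x \<in> fst S" for x
    using that h by (meson bij_betwE)
  have 1: "f ` e \<in> snd S" if "e \<in> snd H" for e
  proof -
    obtain a b where "e = {a, b}" "a \<in> fst H" "b \<in> fst H"
      using \<open>e \<in> snd H\<close> H unfolding simple_graph_def card_2_iff by (metis insert_subset)
    then show ?thesis using that e[of "f a" "f b"] by (auto simp: hf fS)
  qed
  have 2: "\<exists>e'\<in>snd H. e = f ` e'" if "e \<in> snd S" for e
  proof -
    obtain a b where ab: "e = {a, b}" "a \<in> fst S" "b \<in> fst S"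
      using \<open>e \<in> snd S\<close> S(1) unfolding simple_graph_def card_2_iff by (metis insert_subset)
    then have "{h a, h b} \<in> snd H" using that e by auto
    then show ?thesis using ab by (intro bexI[of _ "{h a, h b}"]) (auto simp: fh)
  qed
  have "S = img f H"
    unfolding img_def using f 1 2 by (auto simp: prod_eq_iff bij_betw_def image_iff)
  moreover have "emb H G f"
    unfolding emb_def using f 1 S by (auto simp: bij_betw_def)
  ultimately show "S \<in> {img f H | f. emb H G f}" by blast
next
  fix S assume "S \<in> {img f H | f. emb H G f}"
  then obtain f where S: "S = img f H" and inj: "inj_on f (fst H)"
    and V: "f ` fst H \<subseteq> fst G" and E: "\<And>e. e \<in> snd H \<Longrightarrow> f ` e \<in> snd G"
    by (auto simp: emb_def)
  have sub: "e \<subseteq> fst H" "card e = 2" if "e \<in> snd H" for e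
    using that H by (auto simp: simple_graph_def)
  have "simple_graph S"
    using H inj sub by (auto simp: S img_def simple_graph_def card_image inj_on_subset)
  then have 1: "subgraph_of S G"
    using V E by (auto simp: subgraph_of_def S img_def)
  have inv: "inv_into (fst H) f (f x) = x" if "x \<in> fst H" for x
    using that inj by simp
  have mem: "{f a, f b} \<in> (`) f ` snd H \<longleftrightarrow> {a, b} \<in> snd H" if "a \<in> fst H" "b \<in> fst H" for a b
  proof
    assume "{f a, f b} \<in> (`) f ` snd H"
    then obtain e where e: "e \<in> snd H" "f ` {a, b} = f ` e" by auto
    then have "{a, b} = e" using inj_on_image_eq_iff[OF inj, of "{a, b}" e] sub(1) that by auto
    then show "{a, b} \<in> snd H" using e by simp
  next
    assume "{a, b} \<in> snd H"
    then show "{f a, f b} \<in> (`) f ` snd H" by (metis image_empty image_insert imageI)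
  qed
  have "graph_iso S H"
    unfolding graph_iso_def S img_def fst_conv snd_conv
    using inj by (intro exI[of _ "inv_into (fst H) f"]) (auto simp: inv mem bij_betw_inv_into inj_on_imp_bij_betw)
  with 1 show "S \<in> {S. subgraph_of S G \<and> graph_iso S H}" by simp
qed

lemma finite_copies:
  assumes "simple_graph G"
  shows "finite {S. subgraph_of S G \<and> graph_iso S H}"
proof (rule finite_subset)
  show "{S. subgraph_of S G \<and> graph_iso S H} \<subseteq> Pow (fst G) \<times> Pow (Pow (fst G))"
    using assms by (auto simp: subgraph_of_def simple_graph_def) blast
  show "finite (Pow (fst G) \<times> Pow (Pow (fst G)))"
    using assms by (auto simp: simple_graph_def)
qed

text \<open>The counting principle \<open>card_list_le\<close> with the copies of \<open>H\<close> in the role of \<open>R\<close>: a copy has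
\<open>m\<close> vertices, so it contains at most \<open>m\<^sup>r\<close> lists of length \<open>r\<close>.\<close>

lemma card_list_le_num_sub:
  fixes H :: "nat ugraph"
  assumes H: "simple_graph H" "fst H = {1..m}" and G: "simple_graph G"
    and Q: "\<And>q. q \<in> Q \<Longrightarrow> length q = r \<and> (\<exists>f. emb H G f \<and> set q \<subseteq> f ` {1..m})"
  shows "card Q \<le> m ^ r * num_sub G H"
proof -
  let ?S = "{S. subgraph_of S G \<and> graph_iso S H}"
  have fin: "finite ?S" by (rule finite_copies[OF G])
  let ?F = "\<lambda>S. {q. set q \<subseteq> fst S \<and> length q = r}"
  have S: "finite (fst S) \<and> card (fst S) = m" if "S \<in> ?S" for S
    using that unfolding copies_eq_img_emb[OF H(1) G]
    by (auto simp: img_def H emb_def card_image)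
  have "Q \<subseteq> (\<Union>S\<in>?S. ?F S)"
  proof
    fix q assume "q \<in> Q"
    with Q obtain f where "emb H G f" "length q = r" "set q \<subseteq> f ` {1..m}" by blast
    then show "q \<in> (\<Union>S\<in>?S. ?F S)"
      unfolding copies_eq_img_emb[OF H(1) G]
      by (intro UN_I[of "img f H"]) (auto simp: img_def H)
  qed
  then have "card Q \<le> card (\<Union>S\<in>?S. ?F S)"
    using fin S by (intro card_mono finite_UN_I) (auto simp: finite_lists_length_eq)
  also have "\<dots> \<le> (\<Sum>S\<in>?S. card (?F S))"
    using fin by (intro card_UN_le) auto
  also have "\<dots> \<le> (\<Sum>S\<in>?S. m ^ r)"
    using S by (intro sum_mono) (auto simp: card_lists_length_eq)
  also have "\<dots> = m ^ r * num_sub G H"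
    by (simp add: num_sub_def)
  finally show ?thesis .
qed

text \<open>Fourth powers against ordered quadruples of distinct elements. For \<open>card A = 4\<close> the ratio
is \<open>256 / 24 < 11\<close>, and it decreases to 1; the linear term covers the sets with at most three
elements.\<close>

lemma card_4th_power_le:
  assumes "finite A"
  shows "card A ^ 4 \<le> 11 * card {xs. length xs = 4 \<and> distinct xs \<and> set xs \<subseteq> A} + 27 * card A"
proof (cases "4 \<le> card A")
  case True
  then obtain e where e: "card A = e + 4" using le_Suc_ex by (metis add.commute)
  have "{Suc e..e + 4} = {e+1, e+2, e+3, e+4}" by auto
  then have "card {xs. length xs = 4 \<and> distinct xs \<and> set xs \<subseteq> A} = (e+1)*(e+2)*(e+3)*(e+4)"
    using card_lists_distinct_length_eq[OF assms True] by (simp add: e algebra_simps)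
  moreover have "(e+4)^4 \<le> 11 * ((e+1)*(e+2)*(e+3)*(e+4))"
    by (simp add: power4_eq_xxxx algebra_simps)
  ultimately show ?thesis by (simp add: e)
next
  case False
  then have "card A = 0 \<or> card A = 1 \<or> card A = 2 \<or> card A = 3" by linarith
  then show ?thesis by auto
qed

lemma mult_le_add_squares: "a * b \<le> a^2 + b^2" for a b :: nat
proof -
  have "a * b \<le> max a b * max a b" by (intro mult_le_mono) auto
  also have "\<dots> \<le> a^2 + b^2" by (simp add: max_def power2_eq_square)
  finally show ?thesis .
qed

lemma square_mult_le_add_cubes: "a^2 * b \<le> a^3 + b^3" for a b :: nat
proof -
  have "a^2 * b \<le> max a b ^ 2 * max a b" by (intro mult_le_mono power_mono) auto
  also have "\<dots> \<le> a^3 + b^3" by (simp add: max_def power2_eq_square power3_eq_cube)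
  finally show ?thesis .
qed

text \<open>Upper bounds for the size of a family of configurations that is given by a parametrization;
\<open>sum_card_le_card\<close> is the lower bound for an injective parametrization.\<close>

lemma card_image_Sigma_le:
  assumes "finite A" "\<And>x. x \<in> A \<Longrightarrow> finite (B x)" "Q \<subseteq> f ` (Sigma A B)"
  shows "finite Q" "card Q \<le> (\<Sum>x\<in>A. card (B x))"
proof -
  have fin: "finite (Sigma A B)" using assms by auto
  then show "finite Q" using assms(3) finite_surj by blast
  have "card Q \<le> card (Sigma A B)" using surj_card_le[OF fin assms(3)] .
  then show "card Q \<le> (\<Sum>x\<in>A. card (B x))" using assms by simp
qed

text \<open>The combinatorial part fixes one graph; all constants in it are absolute, which is what
makes the bounds uniform along a sequence of graphs.\<close>

locale vertex_graph =
  fixes n :: nat and G :: "nat ugraph"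
  assumes sgo: "simple_graph_on n G"
begin

definition V :: "nat set" where "V = {1..n}"

lemma finite_V [simp]: "finite V" by (simp add: V_def)

lemma sg: "simple_graph G" and fst_G: "fst G = V"
  using sgo unfolding simple_graph_on_def V_def by simp_all

lemma edge_neq: assumes "{a, b} \<in> snd G" shows "a \<noteq> b"
proof
  assume "a = b"
  moreover have "card {a, b} = 2" using sg assms unfolding simple_graph_def by blast
  ultimately show False by simp
qed

lemma edge_V: assumes "{a, b} \<in> snd G" shows "a \<in> V" "b \<in> V"
proof -
  have "\<forall>e\<in>snd G. e \<subseteq> fst G" using sg by (simp add: simple_graph_def)
  from bspec[OF this assms] have "{a, b} \<subseteq> fst G" .
  then show "a \<in> V" "b \<in> V" by (simp_all add: fst_G)
qed

definition nbrs :: "nat \<Rightarrow> nat set" where "nbrs v = {u. {v, u} \<in> snd G}"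
definition deg :: "nat \<Rightarrow> nat" where "deg v = card (nbrs v)"
definition conbrs :: "nat \<Rightarrow> nat \<Rightarrow> nat set" where "conbrs u v = nbrs u \<inter> nbrs v"
definition codeg :: "nat \<Rightarrow> nat \<Rightarrow> nat" where "codeg u v = card (conbrs u v)"
definition vpairs :: "(nat \<times> nat) set" where "vpairs = {(u, v). u \<in> V \<and> v \<in> V \<and> u \<noteq> v}"
definition cyc :: "nat \<Rightarrow> nat \<Rightarrow> nat \<Rightarrow> nat \<Rightarrow> bool" where
  "cyc a b c e \<longleftrightarrow> distinct [a, b, c, e] \<and>
     {a, b} \<in> snd G \<and> {b, c} \<in> snd G \<and> {c, e} \<in> snd G \<and> {e, a} \<in> snd G"

lemma nbrs_sub: "nbrs v \<subseteq> V" using edge_V(2) by (auto simp: nbrs_def)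
lemma finite_nbrs [simp]: "finite (nbrs v)" by (rule finite_subset[OF nbrs_sub]) simp
lemma finite_conbrs [simp]: "finite (conbrs u v)" by (simp add: conbrs_def)
lemma nbrs_sym: "u \<in> nbrs v \<longleftrightarrow> v \<in> nbrs u"
  unfolding nbrs_def mem_Collect_eq by (subst insert_commute) (rule refl)
lemma nbrs_edge: "{u, v} \<in> snd G \<longleftrightarrow> v \<in> nbrs u" by (simp add: nbrs_def)
lemma nbrs_irrefl [simp]: "v \<notin> nbrs v" using edge_neq[of v v] by (auto simp: nbrs_def)
lemma nbrs_V: assumes "u \<in> nbrs v" shows "u \<in> V" "v \<in> V"
  using edge_V[of v u] assms by (simp_all add: nbrs_def)
lemma conbrs_sym: "conbrs u v = conbrs v u" by (auto simp: conbrs_def)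
lemma finite_vpairs [simp]: "finite vpairs"
  by (rule finite_subset[of _ "V \<times> V"]) (auto simp: vpairs_def)

lemma cyc_rotate: "cyc a b c e \<longleftrightarrow> cyc b c e a" by (auto simp: cyc_def)
lemma cyc_reflect: "cyc a b c e \<longleftrightarrow> cyc a e c b"
  unfolding cyc_def nbrs_edge using nbrs_sym[of b a] nbrs_sym[of c b] nbrs_sym[of e c] nbrs_sym[of a e] by auto

text \<open>A 4-cycle consists of two opposite vertices and two of their common neighbours. This is
what ties 4-cycles to codegrees.\<close>

lemma cyc_conbrs: "cyc a b c e \<longleftrightarrow> a \<noteq> c \<and> b \<noteq> e \<and> b \<in> conbrs a c \<and> e \<in> conbrs a c"
proof -
  have "a \<noteq> b" "b \<noteq> c" "c \<noteq> e" "e \<noteq> a" if "b \<in> nbrs a" "b \<in> nbrs c" "e \<in> nbrs a" "e \<in> nbrs c"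
    using that by auto
  moreover have "b \<in> nbrs c \<longleftrightarrow> c \<in> nbrs b" "e \<in> nbrs c \<longleftrightarrow> c \<in> nbrs e" "e \<in> nbrs a \<longleftrightarrow> a \<in> nbrs e"
    by (rule nbrs_sym)+
  ultimately show ?thesis
    unfolding cyc_def conbrs_def nbrs_edge by auto
qed
lemma cyc_V: "cyc a b c e \<Longrightarrow> {a, b, c, e} \<subseteq> V"
  using edge_V[of a b] edge_V[of c e] by (simp add: cyc_def)

lemma cyc_start:
  assumes "cyc a b c e" "v \<in> {a, b, c, e}"
  shows "\<exists>x y z. cyc v x y z \<and> {v, x, y, z} = {a, b, c, e}"
proof -
  have "v = a \<or> v = b \<or> v = c \<or> v = e" using assms(2) by simp
  moreover have "cyc b c e a" "cyc c e a b" "cyc e a b c" using assms(1) cyc_rotate by blast+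
  moreover have "{b, c, e, a} = {a, b, c, e}" "{c, e, a, b} = {a, b, c, e}" "{e, a, b, c} = {a, b, c, e}"
    by auto
  ultimately show ?thesis using assms(1) by metis
qed

lemma cyc_pair:
  assumes "cyc a b c e" "u \<in> {a, b, c, e}" "v \<in> {a, b, c, e}" "u \<noteq> v"
  shows "(\<exists>x y. cyc u v x y \<and> {u, v, x, y} = {a, b, c, e}) \<or>
         (\<exists>p q. cyc u p v q \<and> {u, p, v, q} = {a, b, c, e})"
proof -
  obtain x y z where 1: "cyc u x y z" "{u, x, y, z} = {a, b, c, e}"
    using cyc_start[OF assms(1,2)] by blast
  have "v \<in> {u, x, y, z}" unfolding 1(2) by (rule assms(3))
  then have "v = x \<or> v = y \<or> v = z" using assms(4) by simp
  then show ?thesis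
  proof (elim disjE)
    assume "v = z"
    then have "cyc u v y x" "{u, v, y, x} = {a, b, c, e}"
      using 1 cyc_reflect by auto
    then show ?thesis by blast
  qed (use 1 in blast)+
qed

definition num_terms :: nat where "num_terms = num_sub G cycle4 + num_sub G path2 + num_sub G single_edge"

text \<open>The total number of copies of the four graphs that are assumed to be rare.\<close>

definition num_bad :: nat where
  "num_bad = num_sub G (complete_bipartite 1 4) + num_sub G (complete_bipartite 2 4)
             + num_sub G cycle4_2e + num_sub G cycle4_2v"

lemma emb_nthI:
  assumes "fst H = {1..m}" "length xs = m" "distinct xs" "set xs \<subseteq> V"
    and "\<And>e. e \<in> snd H \<Longrightarrow> (\<lambda>i. xs ! (i - 1)) ` e \<in> snd G"
  shows "emb H G (\<lambda>i. xs ! (i - 1))" "set xs = (\<lambda>i. xs ! (i - 1)) ` {1..m}"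
proof -
  have im: "(\<lambda>i. xs ! (i - 1)) ` {1..m} = set xs"
  proof -
    have "{1..m} = Suc ` {..<m}" by (simp add: image_Suc_lessThan)
    then show ?thesis using assms(2) by (auto simp: set_conv_nth image_image)
  qed
  then show "set xs = (\<lambda>i. xs ! (i - 1)) ` {1..m}" ..
  have "inj_on (\<lambda>i. xs ! (i - 1)) {1..m}"
    using assms(2,3) by (intro inj_onI) (auto simp: nth_eq_iff_index_eq)
  then show "emb H G (\<lambda>i. xs ! (i - 1))"
    using assms im by (auto simp: emb_def fst_G)
qed

text \<open>The same counting principle with the embedding written as the list of the images of
\<open>1, \<dots>, m\<close>.\<close>

lemma card_list_le_num_sub_nth:
  assumes H: "simple_graph H" "fst H = {1..m}"
    and Q: "\<And>q. q \<in> Q \<Longrightarrow> length q = r \<and> (\<exists>xs. length xs = m \<and> distinct xs \<and> set q \<subseteq> set xs \<and>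
              set xs \<subseteq> V \<and> (\<forall>e\<in>snd H. (\<lambda>i. xs ! (i - 1)) ` e \<in> snd G))"
  shows "card Q \<le> m ^ r * num_sub G H"
proof (rule card_list_le_num_sub[OF H sg])
  fix q assume "q \<in> Q"
  from Q[OF this] obtain xs where xs: "length q = r" "length xs = m" "distinct xs" "set q \<subseteq> set xs"
     "set xs \<subseteq> V" "\<And>e. e\<in>snd H \<Longrightarrow> (\<lambda>i. xs ! (i - 1)) ` e \<in> snd G" by blast
  show "length q = r \<and> (\<exists>f. emb H G f \<and> set q \<subseteq> f ` {1..m})"
    using emb_nthI[OF H(2) xs(2,3,5,6)] xs(1,4) by auto
qed

lemma simple_single_edge: "simple_graph single_edge" by (simp add: simple_graph_def single_edge_def)
lemma simple_path2: "simple_graph path2" by (simp add: simple_graph_def path2_def)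
lemma simple_cycle4: "simple_graph cycle4" by (simp add: simple_graph_def cycle4_def)
lemma simple_cycle4_2e: "simple_graph cycle4_2e" by (simp add: simple_graph_def cycle4_2e_def)
lemma simple_cycle4_2v: "simple_graph cycle4_2v" by (simp add: simple_graph_def cycle4_2v_def)
lemma simple_bipartite: "simple_graph (complete_bipartite r s)"
  by (auto simp: simple_graph_def complete_bipartite_def)

lemma edges_le_num_sub:
  "card {[u, v] | u v. v \<in> nbrs u} \<le> 4 * num_sub G single_edge"
proof -
  have "card {[u, v] | u v. v \<in> nbrs u} \<le> 2 ^ 2 * num_sub G single_edge"
  proof (rule card_list_le_num_sub_nth[OF simple_single_edge])
    fix q assume "q \<in> {[u, v] | u v. v \<in> nbrs u}"
    then obtain u v where q: "q = [u, v]" "v \<in> nbrs u" by blast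
    then have "u \<noteq> v" by auto
    with q show "length q = 2 \<and> (\<exists>xs. length xs = 2 \<and> distinct xs \<and> set q \<subseteq> set xs \<and>
      set xs \<subseteq> V \<and> (\<forall>e\<in>snd single_edge. (\<lambda>i. xs ! (i - 1)) ` e \<in> snd G))"
      using nbrs_V[of v u] by (intro conjI exI[of _ "[u, v]"]) (auto simp: single_edge_def nbrs_edge)
  qed (simp add: single_edge_def)
  then show ?thesis by simp
qed

lemma paths_le_num_sub:
  "card {[u, v, w] | u v w. u \<in> nbrs v \<and> w \<in> nbrs v \<and> u \<noteq> w} \<le> 27 * num_sub G path2"
proof -
  have "card {[u, v, w] | u v w. u \<in> nbrs v \<and> w \<in> nbrs v \<and> u \<noteq> w} \<le> 3 ^ 3 * num_sub G path2"
  proof (rule card_list_le_num_sub_nth[OF simple_path2])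
    fix q assume "q \<in> {[u, v, w] | u v w. u \<in> nbrs v \<and> w \<in> nbrs v \<and> u \<noteq> w}"
    then obtain u v w where q: "q = [u, v, w]" "u \<in> nbrs v" "w \<in> nbrs v" "u \<noteq> w" by blast
    then have "u \<noteq> v" "v \<noteq> w" by auto
    with q show "length q = 3 \<and> (\<exists>xs. length xs = 3 \<and> distinct xs \<and> set q \<subseteq> set xs \<and>
      set xs \<subseteq> V \<and> (\<forall>e\<in>snd path2. (\<lambda>i. xs ! (i - 1)) ` e \<in> snd G))"
      using nbrs_V[of u v] nbrs_V[of w v]
      by (intro conjI exI[of _ "[u, v, w]"]) (auto simp: path2_def nbrs_edge nbrs_sym)
  qed (simp add: path2_def)
  then show ?thesis by simp
qed

lemma cycles_le_num_sub:
  "card {[a, b, c, e] | a b c e. cyc a b c e} \<le> 256 * num_sub G cycle4"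
proof -
  have "card {[a, b, c, e] | a b c e. cyc a b c e} \<le> 4 ^ 4 * num_sub G cycle4"
  proof (rule card_list_le_num_sub_nth[where m = 4, OF simple_cycle4])
    fix q assume "q \<in> {[a, b, c, e] | a b c e. cyc a b c e}"
    then have "\<exists>a b c e. q = [a, b, c, e] \<and> cyc a b c e" by (rule CollectD)
    then obtain a b c e where q: "q = [a, b, c, e]" and cy: "cyc a b c e" by metis
    have "distinct [a, b, c, e]" "set [a, b, c, e] \<subseteq> V"
      using cy cyc_V[OF cy] by (simp_all add: cyc_def)
    moreover have "\<forall>e'\<in>snd cycle4. (\<lambda>i. [a, b, c, e] ! (i - 1)) ` e' \<in> snd G"
      using cy by (simp add: cycle4_def cyc_def)
    ultimately show "length q = 4 \<and> (\<exists>xs. length xs = 4 \<and> distinct xs \<and> set q \<subseteq> set xs \<and>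
      set xs \<subseteq> V \<and> (\<forall>e\<in>snd cycle4. (\<lambda>i. xs ! (i - 1)) ` e \<in> snd G))"
      unfolding q by (intro conjI exI[of _ "[a, b, c, e]"]) simp_all
  qed (simp add: cycle4_def)
  then show ?thesis by simp
qed

end

section \<open>Power sums of degrees and codegrees\<close>

lemma card_square_le: "finite A \<Longrightarrow> card A ^ 2 \<le> card {(p, q). p \<in> A \<and> q \<in> A \<and> p \<noteq> q} + card A"
proof -
  assume fin: "finite A"
  have eq: "A \<times> A = {(p, q). p \<in> A \<and> q \<in> A \<and> p \<noteq> q} \<union> (\<lambda>p. (p, p)) ` A" by auto
  have "card (A \<times> A) \<le> card {(p, q). p \<in> A \<and> q \<in> A \<and> p \<noteq> q} + card ((\<lambda>p. (p, p)) ` A)"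
    unfolding eq by (rule card_Un_le)
  also have "card ((\<lambda>p. (p, p)) ` A) \<le> card A" using fin by (rule card_image_le)
  finally show ?thesis by (simp add: card_cartesian_product power2_eq_square)
qed

text \<open>This inequality replaces a Cauchy--Schwarz estimate of the third moment by the second and
the fourth. With \<open>D\<close> the dimension of the Wishart matrix, the factors \<open>D\<close> and \<open>D\<^sup>2\<close> are exactly
those with which the third and second moments enter the variance.\<close>

lemma scaled_cube_le: "D * x ^ 3 \<le> x ^ 4 + D ^ 2 * x ^ 2" for x D :: nat
proof -
  have "x ^ 2 * (D * x) \<le> x ^ 2 * (D ^ 2 + x ^ 2)"
    using mult_le_add_squares by (intro mult_left_mono) auto
  then show ?thesis by (simp add: algebra_simps power2_eq_square power3_eq_cube power4_eq_xxxx)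
qed

lemma sum_card_le_card:
  assumes "finite A" "\<And>x. x \<in> A \<Longrightarrow> finite (B x)" "finite Q"
    and "inj_on (\<lambda>(x, y). f x y) (Sigma A B)" "\<And>x y. x \<in> A \<Longrightarrow> y \<in> B x \<Longrightarrow> f x y \<in> Q"
  shows "(\<Sum>x\<in>A. card (B x)) \<le> card Q"
proof -
  have "(\<Sum>x\<in>A. card (B x)) = card (Sigma A B)" using assms by simp
  also have "\<dots> = card ((\<lambda>(x, y). f x y) ` Sigma A B)" using assms(4) by (simp add: card_image)
  also have "\<dots> \<le> card Q" using assms by (intro card_mono) auto
  finally show ?thesis .
qed

context vertex_graph
begin

definition deg_sum :: "nat \<Rightarrow> nat" where "deg_sum k = (\<Sum>v\<in>V. deg v ^ k)"
definition codeg_sum :: "nat \<Rightarrow> nat" where "codeg_sum k = (\<Sum>(u, v)\<in>vpairs. codeg u v ^ k)"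

lemma finite_lists_V: assumes "\<And>q. q \<in> Q \<Longrightarrow> set q \<subseteq> V \<and> length q = r" shows "finite Q"
  using assms by (intro finite_subset[OF _ finite_lists_length_eq[of V r]]) auto

lemma deg_sum_1: "deg_sum 1 \<le> 4 * num_terms"
proof -
  have "deg_sum 1 = (\<Sum>v\<in>V. card (nbrs v))" by (simp add: deg_sum_def deg_def)
  also have "\<dots> \<le> card {[u, v] | u v. v \<in> nbrs u}"
    by (rule sum_card_le_card[where f = "\<lambda>u v. [u, v]"])
       (auto intro!: inj_onI finite_lists_V[where r = 2] simp: nbrs_V dest: nbrs_V)
  also have "\<dots> \<le> 4 * num_terms" using edges_le_num_sub by (simp add: num_terms_def)
  finally show ?thesis .
qed

text \<open>A pair of distinct neighbours of \<open>v\<close> is a 2-path with center \<open>v\<close>; equal pairs are edges.\<close>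

lemma deg_sum_2: "deg_sum 2 \<le> 31 * num_terms"
proof -
  let ?B = "\<lambda>v. {(p, q). p \<in> nbrs v \<and> q \<in> nbrs v \<and> p \<noteq> q}"
  have fin: "finite (?B v)" for v
    by (rule finite_subset[of _ "nbrs v \<times> nbrs v"]) auto
  have "deg_sum 2 \<le> (\<Sum>v\<in>V. card (?B v) + card (nbrs v))"
    unfolding deg_sum_def deg_def by (intro sum_mono card_square_le) simp
  also have "\<dots> = (\<Sum>v\<in>V. card (?B v)) + deg_sum 1"
    by (simp add: deg_sum_def deg_def sum.distrib)
  also have "(\<Sum>v\<in>V. card (?B v)) \<le> card {[u, v, w] | u v w. u \<in> nbrs v \<and> w \<in> nbrs v \<and> u \<noteq> w}"
    by (rule sum_card_le_card[where f = "\<lambda>v (u, w). [u, v, w]", OF _ fin])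
       (auto intro!: inj_onI finite_lists_V[where r = 3] dest: nbrs_V)
  also have "\<dots> \<le> 27 * num_terms" using paths_le_num_sub by (simp add: num_terms_def)
  finally show ?thesis using deg_sum_1 by simp
qed

lemma codeg_sum_1: "codeg_sum 1 \<le> 27 * num_terms"
proof -
  have "codeg_sum 1 = (\<Sum>(u, v)\<in>vpairs. card (conbrs u v))" by (simp add: codeg_sum_def codeg_def)
  also have "\<dots> = (\<Sum>p\<in>vpairs. card (conbrs (fst p) (snd p)))" by (simp add: case_prod_beta)
  also have "\<dots> \<le> card {[u, v, w] | u v w. u \<in> nbrs v \<and> w \<in> nbrs v \<and> u \<noteq> w}"
    by (rule sum_card_le_card[where f = "\<lambda>p w. [fst p, w, snd p]", OF finite_vpairs])
       (auto intro!: inj_onI finite_lists_V[where r = 3] simp: conbrs_def vpairs_def nbrs_sym prod_eq_iff dest: nbrs_V)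
  also have "\<dots> \<le> 27 * num_terms" using paths_le_num_sub by (simp add: num_terms_def)
  finally show ?thesis .
qed

text \<open>A pair of distinct common neighbours of two vertices completes them to a 4-cycle; equal
pairs are 2-paths.\<close>

lemma codeg_sum_2: "codeg_sum 2 \<le> 283 * num_terms"
proof -
  let ?B = "\<lambda>r. {(p, q). p \<in> conbrs (fst r) (snd r) \<and> q \<in> conbrs (fst r) (snd r) \<and> p \<noteq> q}"
  have fin: "finite (?B r)" for r
    by (rule finite_subset[of _ "conbrs (fst r) (snd r) \<times> conbrs (fst r) (snd r)"]) auto
  have "codeg_sum 2 = (\<Sum>r\<in>vpairs. card (conbrs (fst r) (snd r)) ^ 2)" by (simp add: codeg_sum_def codeg_def case_prod_beta)
  also have "\<dots> \<le> (\<Sum>r\<in>vpairs. card (?B r) + card (conbrs (fst r) (snd r)))"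
    by (intro sum_mono card_square_le) simp
  also have "\<dots> = (\<Sum>r\<in>vpairs. card (?B r)) + codeg_sum 1"
    by (simp add: codeg_sum_def codeg_def sum.distrib case_prod_beta)
  also have "(\<Sum>r\<in>vpairs. card (?B r)) \<le> card {[a, b, c, e] | a b c e. cyc a b c e}"
  proof (rule sum_card_le_card[where f = "\<lambda>r (p, q). [fst r, p, snd r, q]", OF finite_vpairs fin])
    show "finite {[a, b, c, e] | a b c e. cyc a b c e}"
      by (rule finite_lists_V[where r = 4]) (use cyc_V in auto)
  qed (auto intro!: inj_onI simp: vpairs_def cyc_conbrs prod_eq_iff)
  also have "\<dots> \<le> 256 * num_terms" using cycles_le_num_sub by (simp add: num_terms_def)
  finally show ?thesis using codeg_sum_1 by simp
qed

definition quadruples :: "nat set \<Rightarrow> nat list set" where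
  "quadruples A = {xs. length xs = 4 \<and> distinct xs \<and> set xs \<subseteq> A}"

lemma finite_quadruples: "finite A \<Longrightarrow> finite (quadruples A)"
  by (rule finite_subset[OF _ finite_lists_length_eq[of A 4]]) (auto simp: quadruples_def)

lemma length_4E:
  assumes "length xs = 4" obtains a b c e where "xs = [a, b, c, e]"
  using assms by (auto simp: length_Suc_conv numeral_eq_Suc)

lemma K14_edges:
  assumes "e \<in> snd (complete_bipartite 1 4)" shows "e \<in> {{1,2},{1,3},{1,4},{1,5}}"
proof -
  obtain i j :: nat where "e = {i, j}" "i \<in> {1..1}" "j \<in> {1 + 1..1 + 4}"
    using assms by (auto simp: complete_bipartite_def)
  moreover from this have "j = 2 \<or> j = 3 \<or> j = 4 \<or> j = 5" by auto
  ultimately show ?thesis by auto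
qed

lemma K24_edges:
  assumes "e \<in> snd (complete_bipartite 2 4)"
  shows "e \<in> {{1,3},{1,4},{1,5},{1,6},{2,3},{2,4},{2,5},{2,6}}"
proof -
  obtain i j :: nat where "e = {i, j}" "i \<in> {1..2}" "j \<in> {2 + 1..2 + 4}"
    using assms by (auto simp: complete_bipartite_def)
  moreover from this have "j = 3 \<or> j = 4 \<or> j = 5 \<or> j = 6" "i = 1 \<or> i = 2" by auto
  ultimately show ?thesis by (elim disjE) simp_all
qed

text \<open>Four distinct neighbours of \<open>v\<close> span a copy of \<open>K\<^sub>1\<^sub>,\<^sub>4\<close>.\<close>

lemma deg_sum_4: "deg_sum 4 \<le> 11 * 5 ^ 5 * num_sub G (complete_bipartite 1 4) + 108 * num_terms"
proof -
  let ?Q = "{v # xs | v xs. v \<in> V \<and> xs \<in> quadruples (nbrs v)}"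
  have "deg_sum 4 \<le> (\<Sum>v\<in>V. 11 * card (quadruples (nbrs v)) + 27 * card (nbrs v))"
    unfolding deg_sum_def deg_def quadruples_def by (intro sum_mono card_4th_power_le) simp
  also have "\<dots> = 11 * (\<Sum>v\<in>V. card (quadruples (nbrs v))) + 27 * deg_sum 1"
    by (simp add: deg_sum_def deg_def sum.distrib sum_distrib_left)
  also have "(\<Sum>v\<in>V. card (quadruples (nbrs v))) \<le> card ?Q"
  proof (rule sum_card_le_card[where f = "\<lambda>v xs. v # xs"])
    show "finite ?Q"
      by (rule finite_lists_V[where r = 5]) (use nbrs_sub in \<open>fastforce simp: quadruples_def\<close>)
  qed (auto intro!: inj_onI finite_quadruples)
  also have "card ?Q \<le> 5 ^ 5 * num_sub G (complete_bipartite 1 4)"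
  proof (rule card_list_le_num_sub_nth[OF simple_bipartite])
    fix q assume "q \<in> ?Q"
    then obtain v xs where q: "q = v # xs" "v \<in> V" "xs \<in> quadruples (nbrs v)" by auto
    from q(3) have len: "length xs = 4" by (simp add: quadruples_def)
    obtain a b c f where xs: "xs = [a, b, c, f]" using length_4E[OF len] .
    have m: "a \<in> nbrs v" "b \<in> nbrs v" "c \<in> nbrs v" "f \<in> nbrs v" and dis: "distinct [a, b, c, f]"
      using q(3) by (auto simp: xs quadruples_def)
    then have "distinct q" "set q \<subseteq> V" using q(2) nbrs_sub[of v] by (auto simp: q(1) xs)
    moreover have "(\<lambda>i. q ! (i - 1)) ` e \<in> snd G" if "e \<in> snd (complete_bipartite 1 4)" for e
      using K14_edges[OF that] m by (auto simp: q(1) xs nbrs_edge)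
    ultimately show "length q = 5 \<and> (\<exists>xs. length xs = 5 \<and> distinct xs \<and> set q \<subseteq> set xs \<and>
      set xs \<subseteq> V \<and> (\<forall>e\<in>snd (complete_bipartite 1 4). (\<lambda>i. xs ! (i - 1)) ` e \<in> snd G))"
      using len by (intro conjI exI[of _ q]) (auto simp: q(1))
  qed (simp add: complete_bipartite_def)
  finally show ?thesis using deg_sum_1 by simp
qed

text \<open>Four distinct common neighbours of two vertices span a copy of \<open>K\<^sub>2\<^sub>,\<^sub>4\<close>.\<close>

lemma codeg_sum_4: "codeg_sum 4 \<le> 11 * 6 ^ 6 * num_sub G (complete_bipartite 2 4) + 729 * num_terms"
proof -
  let ?conbrs = "\<lambda>r. conbrs (fst r) (snd r)"
  let ?Q = "{u # v # xs | u v xs. u \<in> V \<and> v \<in> V \<and> u \<noteq> v \<and> xs \<in> quadruples (conbrs u v)}"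
  have "codeg_sum 4 = (\<Sum>r\<in>vpairs. card (?conbrs r) ^ 4)" by (simp add: codeg_sum_def codeg_def case_prod_beta)
  also have "\<dots> \<le> (\<Sum>r\<in>vpairs. 11 * card (quadruples (?conbrs r)) + 27 * card (?conbrs r))"
    unfolding quadruples_def by (intro sum_mono card_4th_power_le) simp
  also have "\<dots> = 11 * (\<Sum>r\<in>vpairs. card (quadruples (?conbrs r))) + 27 * codeg_sum 1"
    by (simp add: codeg_sum_def codeg_def sum.distrib sum_distrib_left case_prod_beta)
  also have "(\<Sum>r\<in>vpairs. card (quadruples (?conbrs r))) \<le> card ?Q"
  proof (rule sum_card_le_card[where f = "\<lambda>r xs. fst r # snd r # xs", OF finite_vpairs])
    show "finite ?Q"
      by (rule finite_lists_V[where r = 6]) (use nbrs_sub in \<open>fastforce simp: quadruples_def conbrs_def\<close>)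
  qed (auto intro!: inj_onI finite_quadruples simp: vpairs_def prod_eq_iff)
  also have "card ?Q \<le> 6 ^ 6 * num_sub G (complete_bipartite 2 4)"
  proof (rule card_list_le_num_sub_nth[OF simple_bipartite])
    fix q assume "q \<in> ?Q"
    then obtain u v xs where q: "q = u # v # xs" "u \<in> V" "v \<in> V" "u \<noteq> v" "xs \<in> quadruples (conbrs u v)" by auto
    from q(5) have len: "length xs = 4" by (simp add: quadruples_def)
    obtain a b c f where xs: "xs = [a, b, c, f]" using length_4E[OF len] .
    have m: "a \<in> nbrs u" "b \<in> nbrs u" "c \<in> nbrs u" "f \<in> nbrs u" "a \<in> nbrs v" "b \<in> nbrs v" "c \<in> nbrs v" "f \<in> nbrs v"
      and dis: "distinct [a, b, c, f]"
      using q(5) by (auto simp: xs quadruples_def conbrs_def)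
    then have "distinct q" "set q \<subseteq> V" using q(2-4) nbrs_sub[of v] by (auto simp: q(1) xs)
    moreover have "(\<lambda>i. q ! (i - 1)) ` e \<in> snd G" if "e \<in> snd (complete_bipartite 2 4)" for e
      using K24_edges[OF that] m by (auto simp: q(1) xs nbrs_edge)
    ultimately show "length q = 6 \<and> (\<exists>xs. length xs = 6 \<and> distinct xs \<and> set q \<subseteq> set xs \<and>
      set xs \<subseteq> V \<and> (\<forall>e\<in>snd (complete_bipartite 2 4). (\<lambda>i. xs ! (i - 1)) ` e \<in> snd G))"
      using len by (intro conjI exI[of _ q]) (auto simp: q(1))
  qed (simp add: complete_bipartite_def)
  finally show ?thesis using codeg_sum_1 by simp
qed

lemma D_deg_sum_3: "D * deg_sum 3 \<le> deg_sum 4 + D ^ 2 * deg_sum 2"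
  unfolding deg_sum_def sum_distrib_left sum.distrib[symmetric] using scaled_cube_le by (intro sum_mono) auto

lemma D_codeg_sum_3: "D * codeg_sum 3 \<le> codeg_sum 4 + D ^ 2 * codeg_sum 2"
  unfolding codeg_sum_def sum_distrib_left sum.distrib[symmetric] using scaled_cube_le by (intro sum_mono) auto

section \<open>Pairs of edges and pairs of 2-paths with common vertices\<close>

text \<open>The three kinds of summands, in all orderings that keep their shape. Allowing every
ordering costs only constant factors and gives symmetric sets, so that a list may be rotated or
reversed to start at a common vertex.\<close>

definition edge_lists :: "nat list set" where "edge_lists = {[u, v] | u v. v \<in> nbrs u}"
definition path_lists :: "nat list set" where "path_lists = {[u, v, w] | u v w. u \<in> nbrs v \<and> w \<in> nbrs v \<and> u \<noteq> w}"
definition cycle_lists :: "nat list set" where "cycle_lists = {[a, b, c, e] | a b c e. cyc a b c e}"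

definition pairs :: "nat list set \<Rightarrow> nat \<Rightarrow> nat list set" where
  "pairs L s = {x @ y | x y. x \<in> L \<and> y \<in> L \<and> card (set x \<inter> set y) = s}"

lemma edge_lists_props: "x \<in> edge_lists \<Longrightarrow> length x = 2 \<and> distinct x \<and> set x \<subseteq> V"
  by (auto simp: edge_lists_def dest: nbrs_V)
lemma path_lists_props: "x \<in> path_lists \<Longrightarrow> length x = 3 \<and> distinct x \<and> set x \<subseteq> V"
  by (auto simp: path_lists_def dest: nbrs_V)
lemma cycle_lists_props: "x \<in> cycle_lists \<Longrightarrow> length x = 4 \<and> distinct x \<and> set x \<subseteq> V"
  unfolding cycle_lists_def using cyc_V by (auto simp: cyc_def)

lemma finite_edge_lists [simp]: "finite edge_lists" using edge_lists_props by (intro finite_lists_V[where r = 2]) auto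
lemma finite_path_lists [simp]: "finite path_lists" using path_lists_props by (intro finite_lists_V[where r = 3]) auto
lemma finite_cycle_lists [simp]: "finite cycle_lists" using cycle_lists_props by (intro finite_lists_V[where r = 4]) auto

lemma card_edge_lists: "card edge_lists \<le> 4 * num_terms" and card_path_lists: "card path_lists \<le> 27 * num_terms" and card_cycle_lists: "card cycle_lists \<le> 256 * num_terms"
  using edges_le_num_sub paths_le_num_sub cycles_le_num_sub by (auto simp: edge_lists_def path_lists_def cycle_lists_def num_terms_def)

lemma finite_pairs: assumes "finite L" shows "finite (pairs L s)"
proof -
  have "pairs L s \<subseteq> (\<lambda>(x, y). x @ y) ` (L \<times> L)" by (auto simp: pairs_def)
  then show ?thesis using assms by (auto intro: finite_subset)
qed

text \<open>The second list is one of the \<open>m\<^sup>m\<close> lists over the vertices of the first.\<close>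

lemma pairs_same_vertices:
  assumes "finite L" "\<And>x. x \<in> L \<Longrightarrow> length x = m \<and> distinct x"
  shows "card (pairs L m) \<le> m ^ (2 * m) * card L"
proof (rule card_list_le[OF assms(1)])
  fix q assume "q \<in> pairs L m"
  then obtain x y where q: "q = x @ y" "x \<in> L" "y \<in> L" "card (set x \<inter> set y) = m"
    by (auto simp: pairs_def)
  have "card (set x) = m" "card (set y) = m" using assms(2) q by (auto simp: distinct_card)
  then have "set x \<inter> set y = set x" "set x \<inter> set y = set y"
    using q(4) by (intro card_subset_eq; simp)+
  then have "set y = set x" by blast
  then show "length q = 2 * m \<and> (\<exists>\<rho>\<in>L. length \<rho> = m \<and> set q \<subseteq> set \<rho>)"
    using q assms(2) by (intro conjI bexI[of _ x]) auto
qed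

lemma pairs_edge_1: "card (pairs edge_lists 1) \<le> 81 * deg_sum 2"
proof -
  let ?R = "(\<lambda>(v, a, b). [v, a, b]) ` (SIGMA v:V. nbrs v \<times> nbrs v)"
  have R: "finite ?R" "card ?R \<le> (\<Sum>v\<in>V. card (nbrs v \<times> nbrs v))"
    by (rule card_image_Sigma_le[OF _ _ subset_refl]; simp)+
  have RI: "[v, a, b] \<in> ?R" if "a \<in> nbrs v" "b \<in> nbrs v" for v a b
    using that by (intro image_eqI[of _ _ "(v, a, b)"]) (auto dest: nbrs_V)
  have "card (pairs edge_lists 1) \<le> 3 ^ 4 * card ?R"
  proof (rule card_list_le[OF R(1)])
    fix q assume "q \<in> pairs edge_lists 1"
    then obtain a b c e where q: "q = [a, b, c, e]" "b \<in> nbrs a" "e \<in> nbrs c"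
      and "card ({a, b} \<inter> {c, e}) = 1"
      by (auto simp: pairs_def edge_lists_def)
    then have "{a, b} \<inter> {c, e} \<noteq> {}" by (metis card.empty zero_neq_one)
    then have "c = a \<or> c = b \<or> e = a \<or> e = b" by auto
    then show "length q = 4 \<and> (\<exists>\<rho>\<in>?R. length \<rho> = 3 \<and> set q \<subseteq> set \<rho>)"
    proof (elim disjE)
      assume "c = a" then show ?thesis using q by (intro conjI bexI[OF _ RI[of b a e]]) auto
    next
      assume "c = b" then show ?thesis using q nbrs_sym[of b a]
        by (intro conjI bexI[OF _ RI[of a b e]]) auto
    next
      assume "e = a" then show ?thesis using q nbrs_sym[of e c]
        by (intro conjI bexI[OF _ RI[of b a c]]) auto
    next
      assume "e = b" then show ?thesis using q nbrs_sym[of e c] nbrs_sym[of b a]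
        by (intro conjI bexI[OF _ RI[of a b c]]) auto
    qed
  qed
  also have "card ?R \<le> deg_sum 2" using R(2) by (simp add: deg_sum_def deg_def card_cartesian_product power2_eq_square)
  finally show ?thesis by simp
qed

lemma sum_adjacent_swap: "(\<Sum>a\<in>V. \<Sum>b\<in>nbrs a. f a b) = (\<Sum>b\<in>V. \<Sum>a\<in>nbrs b. f a b)"
  for f :: "nat \<Rightarrow> nat \<Rightarrow> nat"
proof -
  have "(\<Sum>a\<in>V. \<Sum>b\<in>nbrs a. f a b) = (\<Sum>a\<in>V. \<Sum>b | b \<in> V \<and> b \<in> nbrs a. f a b)"
    by (intro sum.cong refl arg_cong2[where f = sum]) (auto dest: nbrs_V)
  also have "\<dots> = (\<Sum>b\<in>V. \<Sum>a | a \<in> V \<and> b \<in> nbrs a. f a b)"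
    by (rule sum.swap_restrict) auto
  also have "\<dots> = (\<Sum>b\<in>V. \<Sum>a\<in>nbrs b. f a b)"
    by (intro sum.cong refl arg_cong2[where f = sum]) (auto dest: nbrs_V simp: nbrs_sym)
  finally show ?thesis .
qed

lemma sum_adjacent_powers: "(\<Sum>a\<in>V. \<Sum>b\<in>nbrs a. deg a ^ k + deg b ^ k) = 2 * deg_sum (Suc k)"
proof -
  have "(\<Sum>a\<in>V. \<Sum>b\<in>nbrs a. deg b ^ k) = (\<Sum>a\<in>V. \<Sum>b\<in>nbrs a. deg a ^ k)"
    by (rule sum_adjacent_swap)
  then show ?thesis
    by (simp add: sum.distrib deg_sum_def deg_def mult.commute)
qed

text \<open>Stars and paths with three edges. Bounding a path by its middle edge gives
\<open>deg a * deg b \<le> (deg a)\<^sup>2 + (deg b)\<^sup>2\<close>, summed over adjacent vertices.\<close>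

definition R_star3 where
  "R_star3 = (\<lambda>(v, a, b, c). [v, a, b, c]) ` (SIGMA v:V. nbrs v \<times> nbrs v \<times> nbrs v)"

lemma R_star3I: "a \<in> nbrs v \<Longrightarrow> b \<in> nbrs v \<Longrightarrow> c \<in> nbrs v \<Longrightarrow> [v, a, b, c] \<in> R_star3"
  unfolding R_star3_def by (intro image_eqI[of _ _ "(v, a, b, c)"]) (auto dest: nbrs_V)

definition R_path3 where
  "R_path3 = (\<lambda>((a, b), x, y). [a, b, x, y]) ` (SIGMA (a, b):Sigma V nbrs. nbrs a \<times> nbrs b)"

lemma R_path3I: "b \<in> nbrs a \<Longrightarrow> x \<in> nbrs a \<Longrightarrow> y \<in> nbrs b \<Longrightarrow> [a, b, x, y] \<in> R_path3"
  unfolding R_path3_def by (intro image_eqI[of _ _ "((a, b), x, y)"]) (auto dest: nbrs_V)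

lemma R_star3: "finite R_star3" "card R_star3 \<le> deg_sum 3"
proof -
  have R: "finite R_star3" "card R_star3 \<le> (\<Sum>v\<in>V. card (nbrs v \<times> nbrs v \<times> nbrs v))"
    unfolding R_star3_def
    by (rule card_image_Sigma_le[OF _ _ subset_refl]; auto)+
  then show "finite R_star3" "card R_star3 \<le> deg_sum 3"
    by (simp_all add: deg_sum_def deg_def card_cartesian_product power3_eq_cube mult.assoc)
qed

lemma R_path3: "finite R_path3" "card R_path3 \<le> 2 * deg_sum 3"
proof -
  have R: "finite R_path3" "card R_path3 \<le> (\<Sum>p\<in>Sigma V nbrs. card (case p of (a, b) \<Rightarrow> nbrs a \<times> nbrs b))"
    unfolding R_path3_def
    by (rule card_image_Sigma_le[OF _ _ subset_refl]; auto)+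
  note R(2)
  also have "(\<Sum>p\<in>Sigma V nbrs. card (case p of (a, b) \<Rightarrow> nbrs a \<times> nbrs b)) = (\<Sum>a\<in>V. \<Sum>b\<in>nbrs a. deg a * deg b)"
    by (subst sum.Sigma) (auto simp: deg_def card_cartesian_product case_prod_beta)
  also have "\<dots> \<le> (\<Sum>a\<in>V. \<Sum>b\<in>nbrs a. deg a ^ 2 + deg b ^ 2)"
    by (intro sum_mono mult_le_add_squares)
  also have "\<dots> = 2 * deg_sum 3" unfolding sum_adjacent_powers by (simp add: numeral_eq_Suc)
  finally show "finite R_path3" "card R_path3 \<le> 2 * deg_sum 3" using R(1) by simp_all
qed

text \<open>Two 2-paths with two common vertices form a connected graph on four vertices. The vertex
\<open>z\<close> of the second path that is not on the first is adjacent to a vertex of the first; if this is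
the center, the four vertices carry a star, otherwise a path of length three.\<close>

lemma pairs_path_2: "card (pairs path_lists 2) \<le> 4 ^ 6 * (3 * deg_sum 3)"
proof -
  have "card (pairs path_lists 2) \<le> 4 ^ 6 * card (R_star3 \<union> R_path3)"
  proof (rule card_list_le)
    show "finite (R_star3 \<union> R_path3)" using R_star3 R_path3 by simp
    fix q assume "q \<in> pairs path_lists 2"
    then obtain i j k i' j' k' where q: "q = [i, j, k, i', j', k']"
      and p: "i \<in> nbrs j" "k \<in> nbrs j" and p': "i' \<in> nbrs j'" "k' \<in> nbrs j'" "i' \<noteq> k'"
      and c: "card ({i, j, k} \<inter> {i', j', k'}) = 2"
      by (auto simp: pairs_def path_lists_def)
    let ?I = "{i, j, k} \<inter> {i', j', k'}"
    have "i' \<noteq> j'" "k' \<noteq> j'" using p' by auto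
    then have card3: "card {i', j', k'} = 3" using p'(3) by simp
    have "card ({i', j', k'} - ?I) = 1"
      using c card3 by (subst card_Diff_subset) auto
    then obtain z where z: "{i', j', k'} - ?I = {z}" by (auto simp: card_1_singleton_iff)
    then have z1: "{i', j', k'} \<subseteq> {i, j, k, z}" and z2: "z \<in> {i', j', k'}" by blast+
    obtain w where w: "w \<in> {i', j', k'}" "z \<in> nbrs w"
    proof -
      have "z = i' \<or> z = j' \<or> z = k'" using z2 by blast
      then show ?thesis
      proof (elim disjE)
        assume "z = j'" then show ?thesis using p' by (intro that[of i']) (auto simp: nbrs_sym)
      qed (use p' in \<open>auto intro!: that[of j']\<close>)
    qed
    then have "w \<noteq> z" by auto
    then have "w = i \<or> w = j \<or> w = k" using w z1 by blast
    then have "\<exists>\<rho>\<in>R_star3 \<union> R_path3. length \<rho> = 4 \<and> set \<rho> = {i, j, k, z}"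
    proof (elim disjE)
      assume "w = j"
      then show ?thesis using p w
        by (intro bexI[of _ "[j, i, k, z]"]) (auto intro!: R_star3I)
    next
      assume "w = i"
      then show ?thesis using p w nbrs_sym[of i j]
        by (intro bexI[of _ "[i, j, z, k]"]) (auto intro!: R_path3I)
    next
      assume "w = k"
      then show ?thesis using p w nbrs_sym[of k j]
        by (intro bexI[of _ "[k, j, z, i]"]) (auto intro!: R_path3I)
    qed
    then obtain \<rho> where \<rho>: "\<rho> \<in> R_star3 \<union> R_path3" "length \<rho> = 4" "set \<rho> = {i, j, k, z}" by blast
    have "set q \<subseteq> set \<rho>" unfolding \<rho>(3) using z1 by (simp add: q)
    then show "length q = 6 \<and> (\<exists>\<rho>\<in>R_star3 \<union> R_path3. length \<rho> = 4 \<and> set q \<subseteq> set \<rho>)"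
      using \<rho>(1,2) by (intro conjI bexI[of _ \<rho>]) (simp_all add: q)
  qed
  also have "card (R_star3 \<union> R_path3) \<le> 3 * deg_sum 3"
    using card_Un_le[of R_star3 R_path3] R_star3 R_path3 by linarith
  finally show ?thesis by simp
qed

lemma path_start:
  assumes "i \<in> nbrs j" "k \<in> nbrs j" "w \<in> {i, j, k}"
  shows "\<exists>p q. {w, p, q} = {i, j, k} \<and> p \<in> nbrs w \<and> (q \<in> nbrs w \<or> q \<in> nbrs p)"
proof -
  have "w = i \<or> w = j \<or> w = k" using assms by blast
  then show ?thesis
  proof (elim disjE)
    assume "w = i" then show ?thesis using assms nbrs_sym[of i j] by (intro exI[of _ j] exI[of _ k]) auto
  next
    assume "w = j" then show ?thesis using assms by (intro exI[of _ i] exI[of _ k]) auto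
  next
    assume "w = k" then show ?thesis using assms nbrs_sym[of k j] by (intro exI[of _ j] exI[of _ i]) auto
  qed
qed

text \<open>The three trees with four edges. With \<open>v\<close> the vertex where the two 2-paths meet, it is a
star if both have center \<open>v\<close>, a fork if exactly one has, and a path if neither has. All three are
bounded by fourth powers of degrees.\<close>

definition R_star4 where
  "R_star4 = (\<lambda>(v, a, b, c, e). [v, a, b, c, e]) ` (SIGMA v:V. nbrs v \<times> nbrs v \<times> nbrs v \<times> nbrs v)"

lemma R_star4I: "a \<in> nbrs v \<Longrightarrow> b \<in> nbrs v \<Longrightarrow> c \<in> nbrs v \<Longrightarrow> e \<in> nbrs v \<Longrightarrow> [v, a, b, c, e] \<in> R_star4"
  unfolding R_star4_def by (intro image_eqI[of _ _ "(v, a, b, c, e)"]) (auto dest: nbrs_V)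

definition R_fork where
  "R_fork = (\<lambda>((v, z), x, y, w). [v, z, x, y, w]) ` (SIGMA (v, z):Sigma V nbrs. nbrs v \<times> nbrs v \<times> nbrs z)"

lemma R_forkI: "z \<in> nbrs v \<Longrightarrow> x \<in> nbrs v \<Longrightarrow> y \<in> nbrs v \<Longrightarrow> w \<in> nbrs z \<Longrightarrow> [v, z, x, y, w] \<in> R_fork"
  unfolding R_fork_def by (intro image_eqI[of _ _ "((v, z), x, y, w)"]) (auto dest: nbrs_V)

definition R_path4 where
  "R_path4 = (\<lambda>((v, z, z'), w, w'). [v, z, z', w, w']) ` (SIGMA (v, z, z'):(SIGMA v:V. nbrs v \<times> nbrs v). nbrs z \<times> nbrs z')"

lemma R_path4I: "z \<in> nbrs v \<Longrightarrow> z' \<in> nbrs v \<Longrightarrow> w \<in> nbrs z \<Longrightarrow> w' \<in> nbrs z' \<Longrightarrow> [v, z, z', w, w'] \<in> R_path4"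
  unfolding R_path4_def by (intro image_eqI[of _ _ "((v, z, z'), w, w')"]) (auto dest: nbrs_V)

lemma R_star4: "finite R_star4" "card R_star4 \<le> deg_sum 4"
proof -
  have R: "finite R_star4" "card R_star4 \<le> (\<Sum>v\<in>V. card (nbrs v \<times> nbrs v \<times> nbrs v \<times> nbrs v))"
    unfolding R_star4_def
    by (rule card_image_Sigma_le[OF _ _ subset_refl]; auto)+
  then show "finite R_star4" "card R_star4 \<le> deg_sum 4"
    by (simp_all add: deg_sum_def deg_def card_cartesian_product power4_eq_xxxx mult.assoc)
qed

lemma R_fork: "finite R_fork" "card R_fork \<le> 2 * deg_sum 4"
proof -
  have R: "finite R_fork" "card R_fork \<le> (\<Sum>p\<in>Sigma V nbrs. card (case p of (v, z) \<Rightarrow> nbrs v \<times> nbrs v \<times> nbrs z))"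
    unfolding R_fork_def
    by (rule card_image_Sigma_le[OF _ _ subset_refl]; auto)+
  note R(2)
  also have "(\<Sum>p\<in>Sigma V nbrs. card (case p of (v, z) \<Rightarrow> nbrs v \<times> nbrs v \<times> nbrs z)) = (\<Sum>a\<in>V. \<Sum>b\<in>nbrs a. deg a ^ 2 * deg b)"
    by (subst sum.Sigma) (auto simp: deg_def card_cartesian_product case_prod_beta power2_eq_square mult.assoc)
  also have "\<dots> \<le> (\<Sum>a\<in>V. \<Sum>b\<in>nbrs a. deg a ^ 3 + deg b ^ 3)"
    by (intro sum_mono square_mult_le_add_cubes)
  also have "\<dots> = 2 * deg_sum 4" unfolding sum_adjacent_powers by (simp add: numeral_eq_Suc)
  finally show "finite R_fork" "card R_fork \<le> 2 * deg_sum 4" using R(1) by simp_all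
qed

lemma R_path4: "finite R_path4" "card R_path4 \<le> 4 * deg_sum 4"
proof -
  let ?S = "SIGMA v:V. nbrs v \<times> nbrs v"
  have R: "finite R_path4" "card R_path4 \<le> (\<Sum>p\<in>?S. card (case p of (v, z, z') \<Rightarrow> nbrs z \<times> nbrs z'))"
    unfolding R_path4_def
    by (rule card_image_Sigma_le[OF _ _ subset_refl]; auto)+
  note R(2)
  also have "(\<Sum>p\<in>?S. card (case p of (v, z, z') \<Rightarrow> nbrs z \<times> nbrs z'))
      = (\<Sum>v\<in>V. \<Sum>z\<in>nbrs v. \<Sum>z'\<in>nbrs v. deg z * deg z')"
    by (simp add: sum.Sigma sum.cartesian_product case_prod_beta deg_def card_cartesian_product)
  also have "\<dots> \<le> (\<Sum>v\<in>V. \<Sum>z\<in>nbrs v. \<Sum>z'\<in>nbrs v. deg z ^ 2 + deg z' ^ 2)"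
    by (intro sum_mono mult_le_add_squares)
  also have "\<dots> = (\<Sum>v\<in>V. \<Sum>z\<in>nbrs v. 2 * (deg z ^ 2 * deg v))"
    by (simp add: sum.distrib sum_distrib_left deg_def mult.commute flip: mult_2)
  also have "\<dots> \<le> (\<Sum>v\<in>V. \<Sum>z\<in>nbrs v. 2 * (deg v ^ 3 + deg z ^ 3))"
  proof (intro sum_mono mult_left_mono)
    fix v z show "deg z ^ 2 * deg v \<le> deg v ^ 3 + deg z ^ 3"
      using square_mult_le_add_cubes[of "deg z" "deg v"] by linarith
  qed simp
  also have "\<dots> = 2 * (2 * deg_sum 4)"
    unfolding sum_distrib_left[symmetric] sum_adjacent_powers by (simp add: numeral_eq_Suc)
  finally show "finite R_path4" "card R_path4 \<le> 4 * deg_sum 4" using R(1) by simp_all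
qed

lemma pairs_path_1: "card (pairs path_lists 1) \<le> 5 ^ 6 * (7 * deg_sum 4)"
proof -
  let ?R = "R_star4 \<union> R_fork \<union> R_path4"
  have "card (pairs path_lists 1) \<le> 5 ^ 6 * card ?R"
  proof (rule card_list_le)
    show "finite ?R" using R_star4 R_fork R_path4 by simp
    fix q assume "q \<in> pairs path_lists 1"
    then obtain i j k i' j' k' where q: "q = [i, j, k, i', j', k']"
      and p: "i \<in> nbrs j" "k \<in> nbrs j" and p': "i' \<in> nbrs j'" "k' \<in> nbrs j'"
      and c: "card ({i, j, k} \<inter> {i', j', k'}) = 1"
      by (auto simp: pairs_def path_lists_def)
    obtain v where "{i, j, k} \<inter> {i', j', k'} = {v}" using c by (auto simp: card_1_singleton_iff)
    then have v: "v \<in> {i, j, k}" "v \<in> {i', j', k'}" by blast+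
    obtain a b where 1: "{v, a, b} = {i, j, k}" "a \<in> nbrs v" "b \<in> nbrs v \<or> b \<in> nbrs a"
      using path_start[OF p v(1)] by blast
    obtain a' b' where 2: "{v, a', b'} = {i', j', k'}" "a' \<in> nbrs v" "b' \<in> nbrs v \<or> b' \<in> nbrs a'"
      using path_start[OF p' v(2)] by blast
    have "\<exists>\<rho>\<in>?R. length \<rho> = 5 \<and> set \<rho> = {v, a, b, a', b'}"
    proof (cases "b \<in> nbrs v"; cases "b' \<in> nbrs v")
      assume "b \<in> nbrs v" "b' \<in> nbrs v"
      then show ?thesis using 1 2 by (intro bexI[of _ "[v, a, b, a', b']"]) (auto intro!: R_star4I)
    next
      assume "b \<in> nbrs v" "b' \<notin> nbrs v"
      then show ?thesis using 1 2 by (intro bexI[of _ "[v, a', a, b, b']"]) (auto intro!: R_forkI)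
    next
      assume "b \<notin> nbrs v" "b' \<in> nbrs v"
      then show ?thesis using 1 2 by (intro bexI[of _ "[v, a, a', b', b]"]) (auto intro!: R_forkI)
    next
      assume "b \<notin> nbrs v" "b' \<notin> nbrs v"
      then show ?thesis using 1 2 by (intro bexI[of _ "[v, a, a', b, b']"]) (auto intro!: R_path4I)
    qed
    then obtain \<rho> where \<rho>: "\<rho> \<in> ?R" "length \<rho> = 5" "set \<rho> = {v, a, b, a', b'}" by blast
    have "set q = {i, j, k} \<union> {i', j', k'}" by (auto simp: q)
    also have "\<dots> = set \<rho>" unfolding 1(1)[symmetric] 2(1)[symmetric] \<rho>(3) by auto
    finally show "length q = 6 \<and> (\<exists>\<rho>\<in>?R. length \<rho> = 5 \<and> set q \<subseteq> set \<rho>)"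
      using \<rho>(1,2) by (intro conjI bexI[of _ \<rho>]) (simp_all add: q)
  qed
  also have "card ?R \<le> 7 * deg_sum 4"
    using card_Un_le[of "R_star4 \<union> R_fork" R_path4] card_Un_le[of R_star4 R_fork] R_star4 R_fork R_path4
    by linarith
  finally show ?thesis by simp
qed

section \<open>Pairs of 4-cycles with common vertices\<close>

lemma pairs_cycleE:
  assumes "q \<in> pairs cycle_lists s"
  obtains a b c e a' b' c' e' where "q = [a, b, c, e, a', b', c', e']" "cyc a b c e" "cyc a' b' c' e'"
    "card ({a, b, c, e} \<inter> {a', b', c', e'}) = s"
  using assms by (auto simp: pairs_def cycle_lists_def)

lemma notin_if_Int_eq: "A \<inter> B = C \<Longrightarrow> x \<in> A \<Longrightarrow> x \<notin> C \<Longrightarrow> x \<notin> B"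
  by blast

text \<open>Both cycles are rotated to start at the common vertex; the seven vertices are then distinct
and carry the two 4-cycles with one common vertex.\<close>

lemma pairs_cycle_1: "card (pairs cycle_lists 1) \<le> 7 ^ 8 * num_sub G cycle4_2v"
proof (rule card_list_le_num_sub_nth[OF simple_cycle4_2v])
  fix q assume "q \<in> pairs cycle_lists 1"
  then obtain a b c e a' b' c' e' where q: "q = [a, b, c, e, a', b', c', e']"
    and cy: "cyc a b c e" "cyc a' b' c' e'" and I: "card ({a, b, c, e} \<inter> {a', b', c', e'}) = 1"
    by (rule pairs_cycleE)
  obtain v where v: "{a, b, c, e} \<inter> {a', b', c', e'} = {v}" using I by (auto simp: card_1_singleton_iff)
  then have v1: "v \<in> {a, b, c, e}" "v \<in> {a', b', c', e'}" by blast+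
  obtain x y z where 1: "cyc v x y z" "{v, x, y, z} = {a, b, c, e}" using cyc_start[OF cy(1) v1(1)] by blast
  obtain x' y' z' where 2: "cyc v x' y' z'" "{v, x', y', z'} = {a', b', c', e'}"
    using cyc_start[OF cy(2) v1(2)] by blast
  have v3: "{v, x, y, z} \<inter> {v, x', y', z'} = {v}" using v 1(2) 2(2) by simp
  have d1: "distinct [v, x, y, z]" "distinct [v, x', y', z']" using 1 2 by (simp_all add: cyc_def)
  let ?xs = "[v, x, y, z, x', y', z']"
  have "x \<notin> {v, x', y', z'}" "y \<notin> {v, x', y', z'}" "z \<notin> {v, x', y', z'}"
    using d1 by (intro notin_if_Int_eq[OF v3]; auto)+
  then have "distinct ?xs" using d1 by simp
  moreover have "set q = set ?xs"
  proof -
    have "set q = {a, b, c, e} \<union> {a', b', c', e'}" by (auto simp: q)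
    also have "\<dots> = set ?xs" unfolding 1(2)[symmetric] 2(2)[symmetric] by auto
    finally show ?thesis .
  qed
  moreover have "set ?xs \<subseteq> V" using cyc_V[OF 1(1)] cyc_V[OF 2(1)] by simp
  moreover have "\<forall>e\<in>snd cycle4_2v. (\<lambda>i. ?xs ! (i - 1)) ` e \<in> snd G"
    using 1(1) 2(1) by (simp add: cycle4_2v_def cyc_def)
  ultimately show "length q = 8 \<and> (\<exists>xs. length xs = 7 \<and> distinct xs \<and> set q \<subseteq> set xs \<and>
      set xs \<subseteq> V \<and> (\<forall>e\<in>snd cycle4_2v. (\<lambda>i. xs ! (i - 1)) ` e \<in> snd G))"
    by (intro conjI exI[of _ ?xs]) (simp_all add: q)
qed (simp add: cycle4_2v_def)

text \<open>The two ways in which 4-cycles can share exactly three vertices. In \<open>R_K23\<close> both new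
vertices \<open>x\<close> and \<open>y\<close> and the vertex \<open>m\<close> are common neighbours of \<open>a\<close> and \<open>b\<close>. In \<open>R_fan\<close> the
vertices \<open>a\<close>, \<open>b\<close>, \<open>m\<close> are a triangle and the two new vertices are attached to different sides of
it.\<close>

definition R_K23 where
  "R_K23 = (\<lambda>((a, b), m, x, y). [a, b, m, x, y]) ` (SIGMA (a, b):vpairs. conbrs a b \<times> conbrs a b \<times> conbrs a b)"
definition R_fan where
  "R_fan = (\<lambda>((a, b), m, x, y). [a, b, m, x, y]) ` (SIGMA (a, b):vpairs. SIGMA m:conbrs a b \<inter> {m. a \<in> conbrs m b}. conbrs a b \<times> conbrs m b)"

lemma conbrs_vpairs: "m \<in> conbrs a b \<Longrightarrow> a \<noteq> b \<Longrightarrow> (a, b) \<in> vpairs"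
  by (auto simp: conbrs_def vpairs_def dest: nbrs_V)

lemma R_K23I:
  assumes "a \<noteq> b" "m \<in> conbrs a b" "x \<in> conbrs a b" "y \<in> conbrs a b"
  shows "[a, b, m, x, y] \<in> R_K23"
  unfolding R_K23_def using assms conbrs_vpairs[OF assms(2,1)]
  by (intro image_eqI[of _ _ "((a, b), m, x, y)"]) simp_all

lemma R_fanI:
  assumes "m \<in> conbrs a b" "a \<in> conbrs m b" "x \<in> conbrs a b" "y \<in> conbrs m b"
  shows "[a, b, m, x, y] \<in> R_fan"
proof -
  have "a \<noteq> b" using assms(2) by (auto simp: conbrs_def)
  then have "(a, b) \<in> vpairs" using conbrs_vpairs assms(1) by simp
  then show ?thesis
    unfolding R_fan_def using assms by (intro image_eqI[of _ _ "((a, b), m, x, y)"]) simp_all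
qed

lemma R_K23: "finite R_K23" "card R_K23 \<le> codeg_sum 3"
proof -
  have R: "finite R_K23" "card R_K23 \<le> (\<Sum>p\<in>vpairs. card (case p of (a, b) \<Rightarrow> conbrs a b \<times> conbrs a b \<times> conbrs a b))"
    unfolding R_K23_def by (rule card_image_Sigma_le[OF _ _ subset_refl]; auto)+
  then show "finite R_K23" "card R_K23 \<le> codeg_sum 3"
    by (simp_all add: codeg_sum_def codeg_def card_cartesian_product power3_eq_cube mult.assoc case_prod_beta)
qed

text \<open>For each triangle the summand is a product of the codegrees of two of its sides, at most
the sum of the squares; a side lies in as many triangles as its codegree says.\<close>

lemma R_fan: "finite R_fan" "card R_fan \<le> 2 * codeg_sum 3"
proof -
  let ?B = "\<lambda>a b. conbrs a b \<inter> {m. a \<in> conbrs m b}"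
  have R: "finite R_fan" "card R_fan \<le> (\<Sum>p\<in>vpairs. card (case p of (a, b) \<Rightarrow> SIGMA m:?B a b. conbrs a b \<times> conbrs m b))"
    unfolding R_fan_def by (rule card_image_Sigma_le[OF _ _ subset_refl]; auto)+
  \<comment> \<open>Exchanging \<open>a\<close> and \<open>m\<close> maps triangles to triangles and one of the two sides to the other.\<close>
  have swap: "(\<Sum>p\<in>vpairs. \<Sum>m\<in>?B (fst p) (snd p). codeg m (snd p) ^ 2) = (\<Sum>p\<in>vpairs. \<Sum>m\<in>?B (fst p) (snd p). codeg (fst p) (snd p) ^ 2)"
  proof -
    let ?S = "SIGMA p:vpairs. ?B (fst p) (snd p)"
    have "(\<Sum>p\<in>vpairs. \<Sum>m\<in>?B (fst p) (snd p). codeg m (snd p) ^ 2) = (\<Sum>(p, m)\<in>?S. codeg m (snd p) ^ 2)"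
      by (rule sum.Sigma) auto
    also have "\<dots> = (\<Sum>(p, m)\<in>?S. codeg (fst p) (snd p) ^ 2)"
      by (rule sum.reindex_bij_witness[of _ "\<lambda>((a, b), m). ((m, b), a)" "\<lambda>((a, b), m). ((m, b), a)"])
         (auto simp: vpairs_def conbrs_def dest: nbrs_V)
    also have "\<dots> = (\<Sum>p\<in>vpairs. \<Sum>m\<in>?B (fst p) (snd p). codeg (fst p) (snd p) ^ 2)"
      by (rule sum.Sigma[symmetric]) auto
    finally show ?thesis .
  qed
  note R(2)
  also have "(\<Sum>p\<in>vpairs. card (case p of (a, b) \<Rightarrow> SIGMA m:?B a b. conbrs a b \<times> conbrs m b))
      = (\<Sum>p\<in>vpairs. \<Sum>m\<in>?B (fst p) (snd p). codeg (fst p) (snd p) * codeg m (snd p))"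
    by (intro sum.cong refl) (auto simp: codeg_def card_cartesian_product)
  also have "\<dots> \<le> (\<Sum>p\<in>vpairs. \<Sum>m\<in>?B (fst p) (snd p). codeg (fst p) (snd p) ^ 2 + codeg m (snd p) ^ 2)"
    by (intro sum_mono mult_le_add_squares)
  also have "\<dots> = 2 * (\<Sum>p\<in>vpairs. \<Sum>m\<in>?B (fst p) (snd p). codeg (fst p) (snd p) ^ 2)"
    unfolding sum.distrib swap by simp
  also have "\<dots> = 2 * (\<Sum>p\<in>vpairs. card (?B (fst p) (snd p)) * codeg (fst p) (snd p) ^ 2)"
    by simp
  also have "\<dots> \<le> 2 * (\<Sum>p\<in>vpairs. codeg (fst p) (snd p) * codeg (fst p) (snd p) ^ 2)"
    unfolding codeg_def by (intro mult_left_mono sum_mono mult_right_mono card_mono) auto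
  also have "\<dots> = 2 * codeg_sum 3"
    by (simp add: codeg_sum_def case_prod_beta power2_eq_square power3_eq_cube mult.assoc)
  finally show "finite R_fan" "card R_fan \<le> 2 * codeg_sum 3" using R(1) by simp_all
qed

text \<open>If exactly one vertex \<open>x\<close> of a 4-cycle is missing from \<open>S\<close>, the cycle is the path \<open>u\<close>, \<open>m\<close>,
\<open>v\<close> in \<open>S\<close> closed by \<open>x\<close>.\<close>

lemma cyc_opposite:
  assumes cy: "cyc a b c e" and I: "card (S \<inter> {a, b, c, e}) = 3"
  shows "\<exists>x u m v. x \<notin> S \<and> {x, u, m, v} = {a, b, c, e} \<and> S \<inter> {a, b, c, e} = {u, m, v} \<and>
    u \<noteq> v \<and> u \<noteq> m \<and> m \<noteq> v \<and> x \<in> conbrs u v \<and> m \<in> conbrs u v"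
proof -
  have card4: "card {a, b, c, e} = 4" using cy by (simp add: cyc_def)
  have "card ({a, b, c, e} - (S \<inter> {a, b, c, e})) = 1"
    using I card4 by (subst card_Diff_subset) auto
  then obtain x where x: "{a, b, c, e} - (S \<inter> {a, b, c, e}) = {x}" by (auto simp: card_1_singleton_iff)
  then have x1: "x \<in> {a, b, c, e}" "x \<notin> S" by blast+
  obtain u m v where 1: "cyc x u m v" "{x, u, m, v} = {a, b, c, e}" using cyc_start[OF cy x1(1)] by blast
  then have dis: "distinct [x, u, m, v]" by (simp add: cyc_def)
  have "S \<inter> {a, b, c, e} = {a, b, c, e} - {x}" using x by blast
  also have "\<dots> = {u, m, v}" unfolding 1(2)[symmetric] using dis by auto
  finally have I': "S \<inter> {a, b, c, e} = {u, m, v}" .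
  have "cyc u m v x" using 1(1) cyc_rotate[of x u m v] by simp
  then have conbrs: "x \<in> conbrs u v" "m \<in> conbrs u v" by (simp_all add: cyc_conbrs)
  have ne: "u \<noteq> v" "u \<noteq> m" "m \<noteq> v" using dis by simp_all
  show ?thesis
    by (rule exI[of _ x], rule exI[of _ u], rule exI[of _ m], rule exI[of _ v])
       (intro conjI x1(2) 1(2) I' ne conbrs)
qed

text \<open>Each cycle induces a path on the three common vertices. If the two paths have the same
center, this is the first kind of configuration; otherwise the common vertices are a triangle and
it is the second.\<close>

lemma pairs_cycle_3: "card (pairs cycle_lists 3) \<le> 5 ^ 8 * (3 * codeg_sum 3)"
proof -
  have "card (pairs cycle_lists 3) \<le> 5 ^ 8 * card (R_K23 \<union> R_fan)"
  proof (rule card_list_le)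
    show "finite (R_K23 \<union> R_fan)" using R_K23 R_fan by simp
    fix q assume "q \<in> pairs cycle_lists 3"
    then obtain a b c e a' b' c' e' where q: "q = [a, b, c, e, a', b', c', e']"
      and cy: "cyc a b c e" "cyc a' b' c' e'" and I: "card ({a, b, c, e} \<inter> {a', b', c', e'}) = 3"
      by (rule pairs_cycleE)
    have I': "card ({a', b', c', e'} \<inter> {a, b, c, e}) = 3" using I by (simp only: Int_commute)
    obtain x' u' m' v' where 2: "x' \<notin> {a, b, c, e}" "{x', u', m', v'} = {a', b', c', e'}"
      "{a, b, c, e} \<inter> {a', b', c', e'} = {u', m', v'}" "u' \<noteq> v'" "u' \<noteq> m'" "m' \<noteq> v'" "x' \<in> conbrs u' v'" "m' \<in> conbrs u' v'"
      using cyc_opposite[OF cy(2) I] by blast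
    obtain x u m v where 1: "x \<notin> {a', b', c', e'}" "{x, u, m, v} = {a, b, c, e}"
      "{a', b', c', e'} \<inter> {a, b, c, e} = {u, m, v}" "u \<noteq> v" "u \<noteq> m" "m \<noteq> v" "x \<in> conbrs u v" "m \<in> conbrs u v"
      using cyc_opposite[OF cy(1) I'] by blast
    have eq: "{u', m', v'} = {u, m, v}" using 1(3) 2(3) by (simp only: Int_commute)
    have edges: "m \<in> nbrs u" "m \<in> nbrs v" "u \<in> nbrs m" "v \<in> nbrs m"
      using 1(8) nbrs_sym[of m u] nbrs_sym[of m v] by (simp_all add: conbrs_def)
    have "m' = m \<or> m' = u \<or> m' = v" using eq by blast
    then have "\<exists>\<rho>\<in>R_K23 \<union> R_fan. length \<rho> = 5 \<and> set \<rho> = {u, m, v, x, x'}"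
    proof (elim disjE)
      assume m': "m' = m"
      then have "{u', v'} = {u, v}" using eq 1(4-6) 2(4-6) by auto
      then have "x' \<in> conbrs u v" using 2(7) by (auto simp: doubleton_eq_iff conbrs_sym)
      then show ?thesis using 1 by (intro bexI[OF _ UnI1[OF R_K23I[of u v m x x']]]) auto
    next
      assume m': "m' = u"
      then have "{u', v'} = {m, v}" using eq 1(4-6) 2(4-6) by auto
      then have "x' \<in> conbrs m v" "u \<in> conbrs m v" using 2(7,8) m' by (auto simp: doubleton_eq_iff conbrs_sym)
      then show ?thesis using 1 by (intro bexI[OF _ UnI2[OF R_fanI[of m u v x x']]]) auto
    next
      assume m': "m' = v"
      then have "{u', v'} = {m, u}" using eq 1(4-6) 2(4-6) by auto
      then have "x' \<in> conbrs m u" "v \<in> conbrs m u" using 2(7,8) m' by (auto simp: doubleton_eq_iff conbrs_sym)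
      then show ?thesis using 1 conbrs_sym[of u v]
        by (intro bexI[OF _ UnI2[OF R_fanI[of m v u x x']]]) auto
    qed
    then obtain \<rho> where \<rho>: "\<rho> \<in> R_K23 \<union> R_fan" "length \<rho> = 5" "set \<rho> = {u, m, v, x, x'}" by blast
    have "set q = {a, b, c, e} \<union> {a', b', c', e'}" by (auto simp: q)
    also have "\<dots> = {x, u, m, v} \<union> {x', u', m', v'}" using 1(2) 2(2) by simp
    also have "\<dots> = {x, x'} \<union> {u, m, v} \<union> {u', m', v'}" by blast
    also have "\<dots> = set \<rho>" unfolding eq \<rho>(3) by blast
    finally show "length q = 8 \<and> (\<exists>\<rho>\<in>R_K23 \<union> R_fan. length \<rho> = 5 \<and> set q \<subseteq> set \<rho>)"
      using \<rho>(1,2) by (intro conjI bexI[of _ \<rho>]) (simp_all add: q)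
  qed
  also have "card (R_K23 \<union> R_fan) \<le> 3 * codeg_sum 3"
    using card_Un_le[of R_K23 R_fan] R_K23 R_fan by linarith
  finally show ?thesis by simp
qed

definition edge_glued where
  "edge_glued = {[u, v, x, y, u, v, x', y'] | u v x y x' y'. cyc u v x y \<and> cyc u v x' y'}"

lemma card_pairs_sharing_edge:
  assumes "\<And>q. q \<in> Q \<Longrightarrow> length q = 8 \<and> (\<exists>u v x y x' y'. cyc u v x y \<and> cyc u v x' y' \<and>
     {u, v, x, y} \<inter> {u, v, x', y'} = {u, v} \<and> set q = {u, v, x, y} \<union> {u, v, x', y'})"
  shows "card Q \<le> 6 ^ 8 * num_sub G cycle4_2e"
proof (rule card_list_le_num_sub_nth[OF simple_cycle4_2e])
  fix q assume "q \<in> Q"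
  then obtain u v x y x' y' where len: "length q = 8" and cy: "cyc u v x y" "cyc u v x' y'"
    and I: "{u, v, x, y} \<inter> {u, v, x', y'} = {u, v}" and q: "set q = {u, v, x, y} \<union> {u, v, x', y'}"
    using assms[of q] by blast
  let ?xs = "[u, v, x, y, x', y']"
  have d: "distinct [u, v, x, y]" "distinct [u, v, x', y']" using cy by (simp_all add: cyc_def)
  have "x \<notin> {u, v, x', y'}" "y \<notin> {u, v, x', y'}"
      using d by (intro notin_if_Int_eq[OF I]; auto)+
  then have "distinct ?xs" using d by auto
  moreover have "set ?xs \<subseteq> V" using cyc_V[OF cy(1)] cyc_V[OF cy(2)] by simp
  moreover have "set q \<subseteq> set ?xs" by (simp add: q)
  moreover have "\<forall>e\<in>snd cycle4_2e. (\<lambda>i. ?xs ! (i - 1)) ` e \<in> snd G"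
    using cy by (simp add: cycle4_2e_def cyc_def)
  ultimately show "length q = 8 \<and> (\<exists>xs. length xs = 6 \<and> distinct xs \<and> set q \<subseteq> set xs \<and>
      set xs \<subseteq> V \<and> (\<forall>e\<in>snd cycle4_2e. (\<lambda>i. xs ! (i - 1)) ` e \<in> snd G))"
    using len by (intro conjI exI[of _ ?xs]) simp_all
qed (simp add: cycle4_2e_def)

text \<open>Two 4-cycles through the same edge share two, three or four vertices. The first case
consists of the copies of two 4-cycles with exactly one common edge, and the others have been
counted.\<close>

lemma card_edge_glued:
  "card edge_glued \<le> 6 ^ 8 * num_sub G cycle4_2e + card (pairs cycle_lists 3) + card (pairs cycle_lists 4)"
proof -
  let ?Q = "{[u, v, x, y, u, v, x', y'] | u v x y x' y'. cyc u v x y \<and> cyc u v x' y' \<and>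
     {u, v, x, y} \<inter> {u, v, x', y'} = {u, v}}"
  have sub: "edge_glued \<subseteq> ?Q \<union> pairs cycle_lists 3 \<union> pairs cycle_lists 4"
  proof
    fix q assume "q \<in> edge_glued"
    then obtain u v x y x' y' where q: "q = [u, v, x, y] @ [u, v, x', y']"
      and cy: "cyc u v x y" "cyc u v x' y'"
      by (auto simp: edge_glued_def)
    let ?I = "{u, v, x, y} \<inter> {u, v, x', y'}"
    have uv: "u \<noteq> v" using cy by (simp add: cyc_def)
    have "card ?I \<ge> card {u, v}" by (intro card_mono) auto
    moreover have "card ?I \<le> card {u, v, x, y}" by (intro card_mono) auto
    moreover have "card {u, v, x, y} \<le> 4" by (simp add: card_insert_if)
    ultimately have "card ?I = 2 \<or> card ?I = 3 \<or> card ?I = 4" using uv by auto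
    moreover have "?I = {u, v}" if "card ?I = 2"
      using that uv by (intro card_subset_eq[symmetric]) auto
    moreover have L: "[u, v, x, y] \<in> cycle_lists" "[u, v, x', y'] \<in> cycle_lists" using cy by (auto simp: cycle_lists_def)
    have "q \<in> pairs cycle_lists s" if "card ?I = s" for s
      unfolding pairs_def using L q that
      by (intro CollectI exI[of _ "[u, v, x, y]"] exI[of _ "[u, v, x', y']"]) simp
    moreover have "q \<in> ?Q" if "?I = {u, v}"
      using that cy q by (intro CollectI exI[of _ u] exI[of _ v] exI[of _ x] exI[of _ y] exI[of _ x'] exI[of _ y']) simp
    ultimately show "q \<in> ?Q \<union> pairs cycle_lists 3 \<union> pairs cycle_lists 4" by blast
  qed
  have finQ: "finite ?Q"
  proof (rule finite_lists_V[where r = 8])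
    fix q assume "q \<in> ?Q"
    then obtain u v x y x' y' where "q = [u, v, x, y, u, v, x', y']" "cyc u v x y" "cyc u v x' y'" by blast
    then show "set q \<subseteq> V \<and> length q = 8" using cyc_V[of u v x y] cyc_V[of u v x' y'] by simp
  qed
  have "card edge_glued \<le> card (?Q \<union> pairs cycle_lists 3 \<union> pairs cycle_lists 4)"
    using sub finQ by (intro card_mono) (simp_all add: finite_pairs)
  also have "\<dots> \<le> card ?Q + card (pairs cycle_lists 3) + card (pairs cycle_lists 4)"
    by (meson card_Un_le add_mono le_trans order_refl)
  also have "card ?Q \<le> 6 ^ 8 * num_sub G cycle4_2e"
  proof (rule card_pairs_sharing_edge)
    fix q assume "q \<in> ?Q"
    then obtain u v x y x' y' where q: "q = [u, v, x, y, u, v, x', y']" "cyc u v x y" "cyc u v x' y'"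
     "{u, v, x, y} \<inter> {u, v, x', y'} = {u, v}" by blast
    have "length q = 8" "set q = {u, v, x, y} \<union> {u, v, x', y'}" by (auto simp: q(1))
    with q(2-4) show "length q = 8 \<and> (\<exists>u v x y x' y'. cyc u v x y \<and> cyc u v x' y' \<and>
     {u, v, x, y} \<inter> {u, v, x', y'} = {u, v} \<and> set q = {u, v, x, y} \<union> {u, v, x', y'})"
      by blast
  qed
  finally show ?thesis by simp
qed

definition R_mixed where
  "R_mixed = (\<lambda>((u, v), (x, y), p, r). [u, v, x, y, p, r]) `
     (SIGMA (u, v):vpairs. {(x, y). cyc u v x y} \<times> (conbrs u v \<times> conbrs u v))"

lemma R_mixedI:
  assumes "cyc u v x y" "cyc u p v r" shows "[u, v, x, y, p, r] \<in> R_mixed"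
proof -
  have "(u, v) \<in> vpairs" using cyc_V[OF assms(1)] assms(1) by (simp add: vpairs_def cyc_def)
  moreover have "p \<in> conbrs u v" "r \<in> conbrs u v" using assms(2) by (simp_all add: cyc_conbrs)
  ultimately show ?thesis
    unfolding R_mixed_def using assms(1) by (intro image_eqI[of _ _ "((u, v), (x, y), p, r)"]) simp_all
qed

lemma finite_cyc2: "finite {(x, y). cyc u v x y}"
proof (rule finite_subset)
  show "{(x, y). cyc u v x y} \<subseteq> V \<times> V" using cyc_V[of u v] by auto
qed simp

text \<open>The vertices \<open>u\<close> and \<open>v\<close> are adjacent in one cycle and opposite in the other. The number of
cycles of the first kind times the number of cycles of the second kind is at most the sum of the
squares. The first square counts pairs of cycles through the edge \<open>{u, v}\<close>; the second is at most
the fourth power of the codegree.\<close>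

lemma R_mixed: "finite R_mixed" "card R_mixed \<le> card edge_glued + codeg_sum 4"
proof -
  let ?A = "\<lambda>p. {(x, y). cyc (fst p) (snd p) x y}"
  have R: "finite R_mixed" "card R_mixed \<le> (\<Sum>p\<in>vpairs. card (case p of (u, v) \<Rightarrow> {(x, y). cyc u v x y} \<times> (conbrs u v \<times> conbrs u v)))"
    unfolding R_mixed_def by (rule card_image_Sigma_le[OF _ _ subset_refl]; use finite_cyc2 in auto)+
  show "finite R_mixed" by (rule R(1))
  note R(2)
  also have "(\<Sum>p\<in>vpairs. card (case p of (u, v) \<Rightarrow> {(x, y). cyc u v x y} \<times> (conbrs u v \<times> conbrs u v)))
     = (\<Sum>p\<in>vpairs. card (?A p) * codeg (fst p) (snd p) ^ 2)"
    by (intro sum.cong refl) (auto simp: codeg_def card_cartesian_product power2_eq_square)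
  also have "\<dots> \<le> (\<Sum>p\<in>vpairs. card (?A p) ^ 2 + (codeg (fst p) (snd p) ^ 2) ^ 2)"
    by (intro sum_mono mult_le_add_squares)
  also have "\<dots> = (\<Sum>p\<in>vpairs. card (?A p \<times> ?A p)) + codeg_sum 4"
    by (simp add: sum.distrib codeg_sum_def case_prod_beta card_cartesian_product power2_eq_square power4_eq_xxxx mult.assoc)
  also have "(\<Sum>p\<in>vpairs. card (?A p \<times> ?A p)) \<le> card edge_glued"
  proof (rule sum_card_le_card[where f = "\<lambda>p ((x, y), x', y'). [fst p, snd p, x, y, fst p, snd p, x', y']", OF finite_vpairs])
    show "finite edge_glued"
    proof (rule finite_lists_V[where r = 8])
      fix q assume "q \<in> edge_glued"
      then obtain u v x y x' y' where "q = [u, v, x, y, u, v, x', y']" "cyc u v x y" "cyc u v x' y'"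
        unfolding edge_glued_def by blast
      then show "set q \<subseteq> V \<and> length q = 8" using cyc_V[of u v x y] cyc_V[of u v x' y'] by simp
    qed
    show "finite (?A p \<times> ?A p)" for p using finite_cyc2 by simp
  qed (auto intro!: inj_onI simp: prod_eq_iff edge_glued_def)
  finally show "card R_mixed \<le> card edge_glued + codeg_sum 4" by simp
qed

text \<open>The two common vertices are adjacent in both cycles, opposite in both, or adjacent in one
and opposite in the other. The first case is two 4-cycles with exactly one common edge, the second
is \<open>K\<^sub>2\<^sub>,\<^sub>4\<close>, and the third is the mixed case bounded before.\<close>

lemma pairs_cycle_2:
  "card (pairs cycle_lists 2) \<le> 6 ^ 8 * (num_sub G cycle4_2e + num_sub G (complete_bipartite 2 4) + card edge_glued + codeg_sum 4)"
proof -
  let ?Qe = "{q\<in>pairs cycle_lists 2. \<exists>u v x y x' y'. cyc u v x y \<and> cyc u v x' y' \<and>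
     {u, v, x, y} \<inter> {u, v, x', y'} = {u, v} \<and> set q = {u, v, x, y} \<union> {u, v, x', y'}}"
  let ?Qo = "{q\<in>pairs cycle_lists 2. \<exists>u v p r p' r'. cyc u p v r \<and> cyc u p' v r' \<and>
     {u, p, v, r} \<inter> {u, p', v, r'} = {u, v} \<and> set q = {u, p, v, r} \<union> {u, p', v, r'}}"
  let ?Qm = "{q\<in>pairs cycle_lists 2. \<exists>u v x y p r. cyc u v x y \<and> cyc u p v r \<and> set q = {u, v, x, y} \<union> {u, p, v, r}}"
  have fin: "finite (pairs cycle_lists 2)" by (simp add: finite_pairs)
  have len: "length q = 8" if "q \<in> pairs cycle_lists 2" for q using that by (auto elim!: pairs_cycleE)
  have sub: "pairs cycle_lists 2 \<subseteq> ?Qe \<union> ?Qo \<union> ?Qm"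
  proof
    fix q assume qP: "q \<in> pairs cycle_lists 2"
    then obtain a b c e a' b' c' e' where q: "q = [a, b, c, e, a', b', c', e']"
      and cy: "cyc a b c e" "cyc a' b' c' e'" and I: "card ({a, b, c, e} \<inter> {a', b', c', e'}) = 2"
      by (rule pairs_cycleE)
    obtain u v where uv: "{a, b, c, e} \<inter> {a', b', c', e'} = {u, v}" "u \<noteq> v"
      using I by (auto simp: card_2_iff)
    have mem: "u \<in> {a, b, c, e}" "v \<in> {a, b, c, e}" "u \<in> {a', b', c', e'}" "v \<in> {a', b', c', e'}"
      using uv(1) by blast+
    have sq: "set q = {a, b, c, e} \<union> {a', b', c', e'}" by (auto simp: q)
    note 1 = cyc_pair[OF cy(1) mem(1,2) uv(2)]
    note 2 = cyc_pair[OF cy(2) mem(3,4) uv(2)]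
    consider (adj) x y x' y' where "cyc u v x y" "{u, v, x, y} = {a, b, c, e}" "cyc u v x' y'" "{u, v, x', y'} = {a', b', c', e'}"
      | (opp) p r p' r' where "cyc u p v r" "{u, p, v, r} = {a, b, c, e}" "cyc u p' v r'" "{u, p', v, r'} = {a', b', c', e'}"
      | (m1) x y p r where "cyc u v x y" "{u, v, x, y} = {a, b, c, e}" "cyc u p v r" "{u, p, v, r} = {a', b', c', e'}"
      | (m2) x y p r where "cyc u v x y" "{u, v, x, y} = {a', b', c', e'}" "cyc u p v r" "{u, p, v, r} = {a, b, c, e}"
      using 1 2 by metis
    then show "q \<in> ?Qe \<union> ?Qo \<union> ?Qm"
    proof cases
      case adj
      have "{u, v, x, y} \<inter> {u, v, x', y'} = {u, v}" "set q = {u, v, x, y} \<union> {u, v, x', y'}"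
        unfolding adj(2,4) by (rule uv(1), rule sq)
      then have "q \<in> ?Qe" using qP adj(1,3) by blast
      then show ?thesis by (intro UnI1)
    next
      case opp
      have "{u, p, v, r} \<inter> {u, p', v, r'} = {u, v}" "set q = {u, p, v, r} \<union> {u, p', v, r'}"
        unfolding opp(2,4) by (rule uv(1), rule sq)
      then have "q \<in> ?Qo" using qP opp(1,3) by blast
      then show ?thesis by (intro UnI1 UnI2)
    next
      case m1
      have "set q = {u, v, x, y} \<union> {u, p, v, r}" unfolding m1(2,4) by (rule sq)
      then have "q \<in> ?Qm" using qP m1(1,3) by blast
      then show ?thesis by (intro UnI2)
    next
      case m2
      have "set q = {u, v, x, y} \<union> {u, p, v, r}" unfolding m2(2,4) sq by (rule Un_commute)
      then have "q \<in> ?Qm" using qP m2(1,3) by blast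
      then show ?thesis by (intro UnI2)
    qed
  qed
  have "card (pairs cycle_lists 2) \<le> card (?Qe \<union> ?Qo \<union> ?Qm)"
    using sub fin by (intro card_mono) simp_all
  also have "\<dots> \<le> card ?Qe + card ?Qo + card ?Qm"
    by (meson card_Un_le add_mono le_trans order_refl)
  also have "card ?Qe \<le> 6 ^ 8 * num_sub G cycle4_2e"
    by (rule card_pairs_sharing_edge) (use len in blast)
  also have "card ?Qo \<le> 6 ^ 8 * num_sub G (complete_bipartite 2 4)"
  proof (rule card_list_le_num_sub_nth[OF simple_bipartite])
    fix q assume qQ: "q \<in> ?Qo"
    then obtain u v x y x' y' where cy: "cyc u x v y" "cyc u x' v y'"
      and I: "{u, x, v, y} \<inter> {u, x', v, y'} = {u, v}" and q: "set q = {u, x, v, y} \<union> {u, x', v, y'}"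
      by blast
    let ?xs = "[u, v, x, y, x', y']"
    have d: "distinct [u, x, v, y]" "distinct [u, x', v, y']" using cy by (simp_all add: cyc_def)
    have "x \<notin> {u, x', v, y'}" "y \<notin> {u, x', v, y'}"
      using d by (intro notin_if_Int_eq[OF I]; auto)+
    then have "distinct ?xs" using d by auto
    moreover have "set ?xs \<subseteq> V" using cyc_V[OF cy(1)] cyc_V[OF cy(2)] by simp
    moreover have "set q \<subseteq> set ?xs" by (auto simp: q)
    moreover have "(\<lambda>i. ?xs ! (i - 1)) ` e \<in> snd G" if "e \<in> snd (complete_bipartite 2 4)" for e
    proof -
      have "x \<in> nbrs u" "x \<in> nbrs v" "y \<in> nbrs u" "y \<in> nbrs v" "x' \<in> nbrs u" "x' \<in> nbrs v" "y' \<in> nbrs u" "y' \<in> nbrs v"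
        using cy by (simp_all add: cyc_conbrs conbrs_def)
      then show ?thesis using K24_edges[OF that] by (auto simp: nbrs_edge)
    qed
    ultimately show "length q = 8 \<and> (\<exists>xs. length xs = 6 \<and> distinct xs \<and> set q \<subseteq> set xs \<and>
      set xs \<subseteq> V \<and> (\<forall>e\<in>snd (complete_bipartite 2 4). (\<lambda>i. xs ! (i - 1)) ` e \<in> snd G))"
      using qQ len by (intro conjI exI[of _ ?xs]) simp_all
  qed (simp add: complete_bipartite_def)
  also have "card ?Qm \<le> 6 ^ 8 * card R_mixed"
  proof (rule card_list_le[OF R_mixed(1)])
    fix q assume qQ: "q \<in> ?Qm"
    then obtain u v x y p r where cy: "cyc u v x y" "cyc u p v r" and q: "set q = {u, v, x, y} \<union> {u, p, v, r}"
      by blast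
    show "length q = 8 \<and> (\<exists>\<rho>\<in>R_mixed. length \<rho> = 6 \<and> set q \<subseteq> set \<rho>)"
      using qQ len q by (intro conjI bexI[OF _ R_mixedI[OF cy]]) auto
  qed
  finally show ?thesis using R_mixed(2) by (simp add: algebra_simps)
qed

end

section \<open>The index sets of the statistic\<close>

text \<open>The summands of the statistic as lists of vertices, so that the counts above apply to them.\<close>

fun list2 :: "nat \<times> nat \<Rightarrow> nat list" where "list2 (i, j) = [i, j]"
fun list3 :: "nat \<times> nat \<times> nat \<Rightarrow> nat list" where "list3 (i, j, k) = [i, j, k]"
fun list4 :: "nat \<times> nat \<times> nat \<times> nat \<Rightarrow> nat list" where "list4 (i, j, k, l) = [i, j, k, l]"

definition meets :: "('b \<Rightarrow> 'a list) \<Rightarrow> 'b set \<Rightarrow> nat \<Rightarrow> nat" where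
  "meets l T s = card {(t, t'). t \<in> T \<and> t' \<in> T \<and> card (set (l t) \<inter> set (l t')) = s}"

context vertex_graph
begin

lemma C4_set_cyc: "(i, j, k, l) \<in> C4_set G \<longleftrightarrow> cyc i j k l \<and> i < Min {j, k, l} \<and> j < l"
  by (simp add: C4_set_def cyc_def conj_ac)

lemma P2_set_nbrs: "(i, j, k) \<in> P2_set G \<longleftrightarrow> i \<in> nbrs j \<and> k \<in> nbrs j \<and> i < k"
  by (simp add: P2_set_def nbrs_def insert_commute)

lemma edge_pairs_nbrs: "(i, j) \<in> edge_pairs G \<longleftrightarrow> j \<in> nbrs i \<and> i < j"
  by (simp add: edge_pairs_def nbrs_def)

lemma list4_cycle_lists: "list4 ` C4_set G \<subseteq> cycle_lists"
proof
  fix q assume "q \<in> list4 ` C4_set G"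
  then obtain i j k l where "q = [i, j, k, l]" "(i, j, k, l) \<in> C4_set G" by (auto elim!: list4.elims)
  then show "q \<in> cycle_lists" unfolding cycle_lists_def C4_set_cyc by blast
qed

lemma list3_path_lists: "list3 ` P2_set G \<subseteq> path_lists"
proof
  fix q assume "q \<in> list3 ` P2_set G"
  then obtain i j k where "q = [i, j, k]" "(i, j, k) \<in> P2_set G" by (auto elim!: list3.elims)
  then show "q \<in> path_lists" unfolding path_lists_def P2_set_nbrs by auto
qed

lemma list2_edge_lists: "list2 ` edge_pairs G \<subseteq> edge_lists"
proof
  fix q assume "q \<in> list2 ` edge_pairs G"
  then obtain i j where "q = [i, j]" "(i, j) \<in> edge_pairs G" by (auto elim!: list2.elims)
  then show "q \<in> edge_lists" unfolding edge_lists_def edge_pairs_nbrs by auto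
qed

lemma inj_lists: "inj list2" "inj list3" "inj list4"
  by (auto intro!: injI elim!: list2.elims list3.elims list4.elims)

lemma finite_C4_set: "finite (C4_set G)"
  using list4_cycle_lists by (rule inj_on_finite[OF inj_on_subset[OF inj_lists(3)] _ finite_cycle_lists, OF subset_UNIV])

lemma finite_P2_set: "finite (P2_set G)"
  using list3_path_lists by (rule inj_on_finite[OF inj_on_subset[OF inj_lists(2)] _ finite_path_lists, OF subset_UNIV])

lemma finite_edge_pairs: "finite (edge_pairs G)"
  using list2_edge_lists by (rule inj_on_finite[OF inj_on_subset[OF inj_lists(1)] _ finite_edge_lists, OF subset_UNIV])

lemma meets_le_pairs:
  assumes "inj l" "l ` T \<subseteq> L" "finite L" "\<And>x. x \<in> L \<Longrightarrow> length x = m"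
  shows "meets l T s \<le> card (pairs L s)"
  unfolding meets_def
proof (rule card_inj_on_le[where f = "\<lambda>(t, t'). l t @ l t'"])
  show "inj_on (\<lambda>(t, t'). l t @ l t') {(t, t'). t \<in> T \<and> t' \<in> T \<and> card (set (l t) \<inter> set (l t')) = s}"
  proof (rule inj_onI; clarify)
    fix t t' u u' assume "t \<in> T" "u \<in> T" "l t @ l t' = l u @ l u'"
    moreover from this have "length (l t) = length (l u)" using assms(2,4) by (metis image_subset_iff)
    ultimately show "t = u \<and> t' = u'" using assms(1) by (simp add: inj_eq)
  qed
  show "(\<lambda>(t, t'). l t @ l t') ` {(t, t'). t \<in> T \<and> t' \<in> T \<and> card (set (l t) \<inter> set (l t')) = s} \<subseteq> pairs L s"
    using assms(2) by (auto simp: pairs_def)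
qed (rule finite_pairs[OF assms(3)])

lemmas meets_le =
  meets_le_pairs[OF inj_lists(3) list4_cycle_lists finite_cycle_lists, of 4]
  meets_le_pairs[OF inj_lists(2) list3_path_lists finite_path_lists, of 3]
  meets_le_pairs[OF inj_lists(1) list2_edge_lists finite_edge_lists, of 2]

lemma copies_eq: "simple_graph H \<Longrightarrow> num_sub G H = card {img f H | f. emb H G f}"
  by (simp only: num_sub_def copies_eq_img_emb[OF _ sg])

lemma num_single_edge: "num_sub G single_edge \<le> card (edge_pairs G)"
proof -
  have "{img f single_edge | f. emb single_edge G f} \<subseteq> (\<lambda>(i, j). ({i, j}, {{i, j}})) ` edge_pairs G"
  proof
    fix S assume "S \<in> {img f single_edge | f. emb single_edge G f}"
    then obtain f where f: "emb single_edge G f" and Sf: "S = img f single_edge" by blast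
    from f have "f ` {1, 2} \<in> snd G" by (simp add: emb_def single_edge_def)
    then have e: "f 2 \<in> nbrs (f 1)" by (simp add: nbrs_def)
    have "{1..2} = {1, 2::nat}" by auto
    then have S: "img f single_edge = ({f 1, f 2}, {{f 1, f 2}})"
      by (simp add: img_def single_edge_def)
    have "f 1 \<noteq> f 2" using e nbrs_irrefl by metis
    then consider "f 1 < f 2" | "f 2 < f 1" by linarith
    then show "S \<in> (\<lambda>(i, j). ({i, j}, {{i, j}})) ` edge_pairs G"
    proof cases
      case 1
      then show ?thesis unfolding Sf using S e by (intro image_eqI[of _ _ "(f 1, f 2)"]) (simp_all add: edge_pairs_nbrs)
    next
      case 2
      then show ?thesis unfolding Sf using S e nbrs_sym[of "f 1" "f 2"]
        by (intro image_eqI[of _ _ "(f 2, f 1)"]) (simp_all add: edge_pairs_nbrs insert_commute)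
    qed
  qed
  then show ?thesis
    unfolding copies_eq[OF simple_single_edge]
    using finite_edge_pairs by (meson card_image_le card_mono finite_imageI le_trans)
qed

lemma num_path2: "num_sub G path2 \<le> card (P2_set G)"
proof -
  let ?g = "\<lambda>(i::nat, j::nat, k::nat). ({i, j, k}, {{i, j}, {j, k}})"
  have "{img f path2 | f. emb path2 G f} \<subseteq> ?g ` P2_set G"
  proof
    fix S assume "S \<in> {img f path2 | f. emb path2 G f}"
    then obtain f where f: "emb path2 G f" and Sf: "S = img f path2" by blast
    from f have "f ` {1, 2} \<in> snd G" "f ` {2, 3} \<in> snd G" by (simp_all add: emb_def path2_def)
    then have e: "f 1 \<in> nbrs (f 2)" "f 3 \<in> nbrs (f 2)" by (simp_all add: nbrs_def insert_commute)
    have 123: "{1..3} = {1, 2, 3::nat}" by auto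
    then have S: "img f path2 = ({f 1, f 2, f 3}, {{f 1, f 2}, {f 2, f 3}})"
      unfolding img_def path2_def fst_conv snd_conv 123 by simp
    have "inj_on f {1, 2, 3}" using f 123 by (simp only: emb_def path2_def fst_conv)
    then have "f 1 \<noteq> f 3" by (simp add: inj_on_def)
    then consider "f 1 < f 3" | "f 3 < f 1" by linarith
    then show "S \<in> ?g ` P2_set G"
    proof cases
      case 1
      then show ?thesis unfolding Sf using S e by (intro image_eqI[of _ _ "(f 1, f 2, f 3)"]) (simp_all add: P2_set_nbrs)
    next
      case 2
      then show ?thesis unfolding Sf using S e
        by (intro image_eqI[of _ _ "(f 3, f 2, f 1)"]) (simp_all add: P2_set_nbrs insert_commute)
    qed
  qed
  then show ?thesis
    unfolding copies_eq[OF simple_path2]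
    using finite_P2_set by (meson card_image_le card_mono finite_imageI le_trans)
qed

text \<open>The 4-cycle through the given vertices as a subgraph; different lists can give the same
one.\<close>

definition cgraph :: "nat \<Rightarrow> nat \<Rightarrow> nat \<Rightarrow> nat \<Rightarrow> nat ugraph" where
  "cgraph a b c e = ({a, b, c, e}, {{a, b}, {b, c}, {c, e}, {e, a}})"

lemma cgraph_rotate: "cgraph a b c e = cgraph b c e a"
  and cgraph_reflect: "cgraph a b c e = cgraph a e c b"
  by (simp_all add: cgraph_def insert_commute)

text \<open>The list of a 4-cycle is rotated to start at its smallest vertex and then reversed if
necessary.\<close>

lemma cyc_normal_form:
  assumes "cyc a b c e"
  shows "cgraph a b c e \<in> (\<lambda>(i, j, k, l). cgraph i j k l) ` C4_set G"
proof -
  let ?m = "Min {a, b, c, e}"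
  have 1: "cgraph a b c e \<in> (\<lambda>(i, j, k, l). cgraph i j k l) ` C4_set G"
    if cy: "cyc a b c e" and le: "a \<le> b" "a \<le> c" "a \<le> e" for a b c e
  proof -
    have dis: "a \<noteq> b" "a \<noteq> c" "a \<noteq> e" "b \<noteq> e" using cy by (simp_all add: cyc_def)
    then consider "b < e" | "e < b" by linarith
    then show ?thesis
    proof cases
      case 1
      then show ?thesis using cy dis le
        by (intro image_eqI[of _ _ "(a, b, c, e)"]) (simp_all add: C4_set_cyc)
    next
      case 2
      have "cyc a e c b" using cy cyc_reflect by simp
      then show ?thesis using dis le 2 cgraph_reflect[of a b c e]
        by (intro image_eqI[of _ _ "(a, e, c, b)"]) (simp_all add: C4_set_cyc)
    qed
  qed
  have r: "cyc b c e a" "cyc c e a b" "cyc e a b c" using assms cyc_rotate by blast+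
  have g: "cgraph b c e a = cgraph a b c e" "cgraph c e a b = cgraph a b c e" "cgraph e a b c = cgraph a b c e"
    using cgraph_rotate by metis+
  consider "a \<le> b" "a \<le> c" "a \<le> e" | "b \<le> c" "b \<le> e" "b \<le> a" | "c \<le> e" "c \<le> a" "c \<le> b"
    | "e \<le> a" "e \<le> b" "e \<le> c" by linarith
  then show ?thesis
    using 1[OF assms] 1[OF r(1)] 1[OF r(2)] 1[OF r(3)] unfolding g by cases
qed

lemma num_cycle4: "num_sub G cycle4 \<le> card (C4_set G)"
proof -
  have "{img f cycle4 | f. emb cycle4 G f} \<subseteq> (\<lambda>(i, j, k, l). cgraph i j k l) ` C4_set G"
  proof
    fix S assume "S \<in> {img f cycle4 | f. emb cycle4 G f}"
    then obtain f where f: "emb cycle4 G f" and Sf: "S = img f cycle4" by blast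
    have eq: "{1..4} = {1, 2, 3, 4::nat}" by auto
    have "inj_on f {1, 2, 3, 4}" using f eq by (simp only: emb_def cycle4_def fst_conv)
    then have "distinct [f 1, f 2, f 3, f 4]" by (simp add: inj_on_def)
    then have "cyc (f 1) (f 2) (f 3) (f 4)" using f by (simp add: cyc_def emb_def cycle4_def)
    moreover have "img f cycle4 = cgraph (f 1) (f 2) (f 3) (f 4)"
      unfolding img_def cycle4_def cgraph_def fst_conv snd_conv eq by simp
    ultimately show "S \<in> (\<lambda>(i, j, k, l). cgraph i j k l) ` C4_set G"
      unfolding Sf using cyc_normal_form by simp
  qed
  then show ?thesis
    unfolding copies_eq[OF simple_cycle4]
    using finite_C4_set by (meson card_image_le card_mono finite_imageI le_trans)
qed

lemma num_terms_le: "num_terms \<le> card (C4_set G) + card (P2_set G) + card (edge_pairs G)"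
  using num_cycle4 num_path2 num_single_edge by (simp add: num_terms_def)

lemma meets_same_vertices:
  "meets list4 (C4_set G) 4 \<le> 16777216 * num_terms" "meets list3 (P2_set G) 3 \<le> 19683 * num_terms"
  "meets list2 (edge_pairs G) 2 \<le> 64 * num_terms"
proof -
  have "meets list4 (C4_set G) 4 \<le> 65536 * (256 * num_terms)"
    using meets_le(1)[of 4] pairs_same_vertices[OF finite_cycle_lists, of 4] cycle_lists_props card_cycle_lists by fastforce
  then show "meets list4 (C4_set G) 4 \<le> 16777216 * num_terms" by simp
  have "meets list3 (P2_set G) 3 \<le> 729 * (27 * num_terms)"
    using meets_le(2)[of 3] pairs_same_vertices[OF finite_path_lists, of 3] path_lists_props card_path_lists by fastforce
  then show "meets list3 (P2_set G) 3 \<le> 19683 * num_terms" by simp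
  show "meets list2 (edge_pairs G) 2 \<le> 64 * num_terms"
    using meets_le(3)[of 2] pairs_same_vertices[OF finite_edge_lists, of 2] edge_lists_props card_edge_lists by fastforce
qed

lemma meets_edge_bound:
  assumes "D \<ge> 1"
  shows "D ^ 2 * meets list2 (edge_pairs G) 2 + meets list2 (edge_pairs G) 1 \<le> 10 ^ 19 * (D ^ 2 * num_terms + num_bad)"
proof -
  have 2: "D ^ 2 * meets list2 (edge_pairs G) 2 \<le> 64 * (D ^ 2 * num_terms)"
    using meets_same_vertices(3) by simp
  have 1: "meets list2 (edge_pairs G) 1 \<le> 81 * (31 * num_terms)"
    using meets_le(3)[of 1] pairs_edge_1 deg_sum_2 edge_lists_props by fastforce
  have "num_terms \<le> D ^ 2 * num_terms" using assms by simp
  have K: "10 ^ 19 = (10000000000000000000::nat)" by simp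
  show ?thesis unfolding K distrib_left using \<open>num_terms \<le> D ^ 2 * num_terms\<close> 1 2 by linarith
qed

lemma meets_path_bound:
  assumes "D \<ge> 1"
  shows "D ^ 2 * meets list3 (P2_set G) 3 + D * meets list3 (P2_set G) 2 + meets list3 (P2_set G) 1
     \<le> 10 ^ 19 * (D ^ 2 * num_terms + num_bad)"
proof -
  have K: "10 ^ 19 = (10000000000000000000::nat)" by simp
  have 3: "D ^ 2 * meets list3 (P2_set G) 3 \<le> 19683 * (D ^ 2 * num_terms)"
    using meets_same_vertices(2) by simp
  have "meets list3 (P2_set G) 2 \<le> 12288 * deg_sum 3"
    using meets_le(2)[of 2] pairs_path_2 path_lists_props by fastforce
  then have "D * meets list3 (P2_set G) 2 \<le> 12288 * (D * deg_sum 3)" by simp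
  moreover have "D ^ 2 * deg_sum 2 \<le> 31 * (D ^ 2 * num_terms)" using deg_sum_2 by simp
  moreover note D_deg_sum_3[of D]
  moreover have "meets list3 (P2_set G) 1 \<le> 109375 * deg_sum 4"
    using meets_le(2)[of 1] pairs_path_1 path_lists_props by fastforce
  moreover have "deg_sum 4 \<le> 34375 * num_bad + 108 * num_terms" using deg_sum_4 by (simp add: num_bad_def)
  moreover have "num_terms \<le> D ^ 2 * num_terms" using assms by simp
  ultimately show ?thesis unfolding K distrib_left using 3 by linarith
qed

text \<open>The weights \<open>D\<^sup>2\<close>, \<open>D\<close>, 1, 1 are, up to a common factor, the bounds for the covariance of
two summands with four, three, two or one common vertices. The constant \<open>10\<^sup>1\<^sup>9\<close> is a crude common
bound for the factors \<open>m\<^sup>r\<close> that have accumulated.\<close>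

lemma meets_cycle_bound:
  assumes "D \<ge> 1"
  shows "D ^ 2 * meets list4 (C4_set G) 4 + D * meets list4 (C4_set G) 3 + meets list4 (C4_set G) 2
    + meets list4 (C4_set G) 1 \<le> 10 ^ 19 * (D ^ 2 * num_terms + num_bad)"
proof -
  have K: "10 ^ 19 = (10000000000000000000::nat)" by simp
  have p4: "card (pairs cycle_lists 4) \<le> 65536 * (256 * num_terms)"
    using pairs_same_vertices[OF finite_cycle_lists, of 4] cycle_lists_props card_cycle_lists by fastforce
  have m: "meets list4 (C4_set G) s \<le> card (pairs cycle_lists s)" for s
    using meets_le(1)[of s] cycle_lists_props by blast
  have 4: "D ^ 2 * meets list4 (C4_set G) 4 \<le> 16777216 * (D ^ 2 * num_terms)"
    using meets_same_vertices(1) by simp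
  have "meets list4 (C4_set G) 3 \<le> 1171875 * codeg_sum 3" using m[of 3] pairs_cycle_3 by simp
  then have "D * meets list4 (C4_set G) 3 \<le> 1171875 * (D * codeg_sum 3)" by simp
  moreover have "D ^ 2 * codeg_sum 2 \<le> 283 * (D ^ 2 * num_terms)" using codeg_sum_2 by simp
  moreover note D_codeg_sum_3[of D]
  moreover have "codeg_sum 4 \<le> 513216 * num_bad + 729 * num_terms" using codeg_sum_4 by (simp add: num_bad_def)
  moreover have "num_terms \<le> D ^ 2 * num_terms" using assms by simp
  moreover have "codeg_sum 3 \<le> D * codeg_sum 3" using assms by simp
  moreover have "card (pairs cycle_lists 3) \<le> 1171875 * codeg_sum 3" using pairs_cycle_3 by simp
  moreover have "card edge_glued \<le> 1679616 * num_bad + card (pairs cycle_lists 3) + card (pairs cycle_lists 4)"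
    using card_edge_glued by (simp add: num_bad_def)
  moreover have "card (pairs cycle_lists 2) \<le> 1679616 * (num_bad + card edge_glued + codeg_sum 4)"
    using pairs_cycle_2 by (simp add: num_bad_def)
  moreover have "card (pairs cycle_lists 1) \<le> 5764801 * num_bad" using pairs_cycle_1 by (simp add: num_bad_def)
  moreover note m[of 1] m[of 2] p4
  ultimately show ?thesis unfolding K distrib_left using 4 by linarith
qed

end

section \<open>Averaging over independent coordinates\<close>

text \<open>All functions below are polynomials in Gaussian variables. This class is closed under sums
and products and contains all of them, so integrability never has to be argued by hand.\<close>

definition all_moments :: "'a measure \<Rightarrow> ('a \<Rightarrow> real) \<Rightarrow> bool" where
  "all_moments M f \<longleftrightarrow> f \<in> borel_measurable M \<and> (\<forall>k. integrable M (\<lambda>x. \<bar>f x\<bar> ^ k))"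

lemma all_moments_measurable: "all_moments M f \<Longrightarrow> f \<in> borel_measurable M"
  by (simp add: all_moments_def)

lemma all_moments_power_integrable:
  assumes "all_moments M f" shows "integrable M (\<lambda>x. f x ^ k)"
proof (rule Bochner_Integration.integrable_bound)
  show "integrable M (\<lambda>x. \<bar>f x\<bar> ^ k)" using assms by (simp add: all_moments_def)
  show "(\<lambda>x. f x ^ k) \<in> borel_measurable M"
    using all_moments_measurable[OF assms] by (rule borel_measurable_power)
qed (simp add: power_abs)

lemma all_moments_integrable: "all_moments M f \<Longrightarrow> integrable M f"
  using all_moments_power_integrable[of M f 1] by simp

lemma (in finite_measure) all_moments_const: "all_moments M (\<lambda>x. c)"
  by (simp add: all_moments_def)

lemma all_moments_add:
  assumes "all_moments M f" "all_moments M g" shows "all_moments M (\<lambda>x. f x + g x)"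
  unfolding all_moments_def
proof (intro conjI allI)
  have [measurable]: "f \<in> borel_measurable M" "g \<in> borel_measurable M"
    using assms by (simp_all add: all_moments_def)
  show "(\<lambda>x. f x + g x) \<in> borel_measurable M" by measurable
  fix k
  show "integrable M (\<lambda>x. \<bar>f x + g x\<bar> ^ k)"
  proof (rule Bochner_Integration.integrable_bound)
    show "integrable M (\<lambda>x. 2 ^ k * (\<bar>f x\<bar> ^ k + \<bar>g x\<bar> ^ k))"
      using assms by (simp add: all_moments_def)
    show "AE x in M. norm (\<bar>f x + g x\<bar> ^ k) \<le> norm (2 ^ k * (\<bar>f x\<bar> ^ k + \<bar>g x\<bar> ^ k))"
    proof (rule AE_I2)
      fix x
      have "\<bar>f x + g x\<bar> ^ k \<le> (2 * max \<bar>f x\<bar> \<bar>g x\<bar>) ^ k" by (intro power_mono) auto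
      also have "\<dots> = 2 ^ k * max \<bar>f x\<bar> \<bar>g x\<bar> ^ k" by (simp add: power_mult_distrib)
      also have "\<dots> \<le> 2 ^ k * (\<bar>f x\<bar> ^ k + \<bar>g x\<bar> ^ k)" by (intro mult_left_mono) (auto simp: max_def)
      finally show "norm (\<bar>f x + g x\<bar> ^ k) \<le> norm (2 ^ k * (\<bar>f x\<bar> ^ k + \<bar>g x\<bar> ^ k))" by simp
    qed
  qed measurable
qed

lemma all_moments_mult:
  assumes "all_moments M f" "all_moments M g" shows "all_moments M (\<lambda>x. f x * g x)"
  unfolding all_moments_def
proof (intro conjI allI)
  have [measurable]: "f \<in> borel_measurable M" "g \<in> borel_measurable M"
    using assms by (simp_all add: all_moments_def)
  show "(\<lambda>x. f x * g x) \<in> borel_measurable M" by measurable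
  fix k
  show "integrable M (\<lambda>x. \<bar>f x * g x\<bar> ^ k)"
  proof (rule Bochner_Integration.integrable_bound)
    show "integrable M (\<lambda>x. \<bar>f x\<bar> ^ (2 * k) + \<bar>g x\<bar> ^ (2 * k))"
      using assms unfolding all_moments_def by (intro Bochner_Integration.integrable_add) blast+
    show "AE x in M. norm (\<bar>f x * g x\<bar> ^ k) \<le> norm (\<bar>f x\<bar> ^ (2 * k) + \<bar>g x\<bar> ^ (2 * k))"
    proof (rule AE_I2)
      fix x
      let ?a = "\<bar>f x\<bar> ^ k" and ?b = "\<bar>g x\<bar> ^ k"
      have "0 \<le> ?a * ?b" by simp
      moreover have "2 * (?a * ?b) \<le> ?a\<^sup>2 + ?b\<^sup>2" using sum_squares_bound[of ?a ?b] by (simp add: mult.assoc)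
      ultimately have "?a * ?b \<le> ?a\<^sup>2 + ?b\<^sup>2" by linarith
      then show "norm (\<bar>f x * g x\<bar> ^ k) \<le> norm (\<bar>f x\<bar> ^ (2 * k) + \<bar>g x\<bar> ^ (2 * k))"
        by (simp add: abs_mult power_mult_distrib power_even_eq)
    qed
  qed measurable
qed

context prob_space
begin

lemma all_moments_cmult: "all_moments M f \<Longrightarrow> all_moments M (\<lambda>x. c * f x)"
  by (intro all_moments_mult all_moments_const)

lemma all_moments_diff: "all_moments M f \<Longrightarrow> all_moments M g \<Longrightarrow> all_moments M (\<lambda>x. f x - g x)"
  using all_moments_add[OF _ all_moments_cmult[of g "-1"], of f] by simp

lemma all_moments_divide: "all_moments M f \<Longrightarrow> all_moments M (\<lambda>x. f x / c)"
  using all_moments_cmult[of f "inverse c"] by (simp add: divide_inverse mult.commute)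

lemma all_moments_power: "all_moments M f \<Longrightarrow> all_moments M (\<lambda>x. f x ^ k)"
  by (induction k) (auto intro: all_moments_const all_moments_mult)

lemma all_moments_sum: "(\<And>i. i \<in> A \<Longrightarrow> all_moments M (f i)) \<Longrightarrow> all_moments M (\<lambda>x. \<Sum>i\<in>A. f i x)"
  by (induction A rule: infinite_finite_induct) (auto intro: all_moments_const all_moments_add)

lemmas all_moments_intros = all_moments_const all_moments_add all_moments_mult all_moments_diff
  all_moments_divide all_moments_power all_moments_sum

end

text \<open>The equation is required for all arguments, not only for those in the product space; this
is what explicit formulas in the coordinates satisfy.\<close>

definition ignores :: "'i \<Rightarrow> (('i \<Rightarrow> 'a) \<Rightarrow> real) \<Rightarrow> bool" where
  "ignores v g \<longleftrightarrow> (\<forall>x y. g (x(v := y)) = g x)"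

locale indep_coords =
  fixes I :: "'i set" and M :: "'i \<Rightarrow> 'a measure"
  assumes prob_M: "\<And>i. prob_space (M i)"
begin

sublocale P: prob_space "PiM I M"
  using prob_M by (rule prob_space_PiM)

text \<open>If \<open>h\<close> ignores \<open>J\<close>, it is the conditional expectation of \<open>f\<close> given the coordinates outside
\<open>J\<close>. Only the characterizing identity is recorded, tested against functions with all moments that
ignore \<open>J\<close>, since that is the form in which it is composed and applied.\<close>

definition averages_to :: "'i set \<Rightarrow> (('i \<Rightarrow> 'a) \<Rightarrow> real) \<Rightarrow> (('i \<Rightarrow> 'a) \<Rightarrow> real) \<Rightarrow> bool" where
  "averages_to J f h \<longleftrightarrow> all_moments (PiM I M) f \<and> all_moments (PiM I M) h \<and>
     (\<forall>g. all_moments (PiM I M) g \<longrightarrow> (\<forall>v\<in>J. ignores v g) \<longrightarrow>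
        P.expectation (\<lambda>x. f x * g x) = P.expectation (\<lambda>x. h x * g x))"

text \<open>Replacing the coordinate \<open>v\<close> by an independent copy does not change the law; then Fubini's
theorem is applied.\<close>

lemma expectation_resample:
  fixes f :: "('i \<Rightarrow> 'a) \<Rightarrow> real"
  assumes "v \<in> I" "integrable (PiM I M) f"
  shows "P.expectation f = P.expectation (\<lambda>x. \<integral>y. f (x(v := y)) \<partial>M v)"
proof -
  interpret Mv: prob_space "M v" by (rule prob_M)
  interpret Q: pair_sigma_finite "M v" "PiM I M" ..
  let ?T = "\<lambda>(y, x). x(v := y)"
  have ins: "insert v I = I" using assms(1) by auto
  have d: "distr (M v \<Otimes>\<^sub>M PiM I M) (PiM I M) ?T = PiM I M"
    using distr_pair_PiM_eq_PiM[of I M v] prob_M unfolding ins by blast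
  have T: "?T \<in> measurable (M v \<Otimes>\<^sub>M PiM I M) (PiM I M)"
    using measurable_fun_upd[of I I v snd _ M fst] assms(1)
    by (simp add: split_beta' ins insert_absorb) 
  have "integrable (distr (M v \<Otimes>\<^sub>M PiM I M) (PiM I M) ?T) f" unfolding d by (rule assms(2))
  then have int: "integrable (M v \<Otimes>\<^sub>M PiM I M) (\<lambda>z. f (?T z))" using integrable_distr_eq[OF T, of f] borel_measurable_integrable[OF assms(2)] by simp
  have "P.expectation f = integral\<^sup>L (distr (M v \<Otimes>\<^sub>M PiM I M) (PiM I M) ?T) f" unfolding d ..
  also have "\<dots> = (\<integral>z. f (?T z) \<partial>(M v \<Otimes>\<^sub>M PiM I M))"
    using assms(2) by (intro integral_distr[OF T]) auto
  also have "\<dots> = (\<integral>x. (\<integral>y. f (x(v := y)) \<partial>M v) \<partial>PiM I M)"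
    using Q.integral_snd[of "\<lambda>y x. f (x(v := y))"] int by (simp add: split_beta')
  finally show ?thesis .
qed

lemma averages_to_refl: "all_moments (PiM I M) f \<Longrightarrow> averages_to {} f f"
  by (simp add: averages_to_def)

lemma averages_to_step:
  assumes "v \<in> I" "all_moments (PiM I M) f" "all_moments (PiM I M) h"
    and "\<And>x. (\<integral>y. f (x(v := y)) \<partial>M v) = h x"
  shows "averages_to {v} f h"
  unfolding averages_to_def
proof (intro conjI assms(2,3) allI impI)
  fix g assume g: "all_moments (PiM I M) g" "\<forall>v\<in>{v}. ignores v g"
  have "P.expectation (\<lambda>x. f x * g x) = P.expectation (\<lambda>x. \<integral>y. f (x(v := y)) * g (x(v := y)) \<partial>M v)"
    using assms(1) all_moments_integrable[OF all_moments_mult[OF assms(2) g(1)]]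
    by (rule expectation_resample)
  also have "\<dots> = P.expectation (\<lambda>x. h x * g x)"
    using g(2) by (simp add: ignores_def assms(4))
  finally show "P.expectation (\<lambda>x. f x * g x) = P.expectation (\<lambda>x. h x * g x)" .
qed

lemma averages_to_trans: "averages_to J f h \<Longrightarrow> averages_to J' h h' \<Longrightarrow> averages_to (J \<union> J') f h'"
  unfolding averages_to_def by (metis UnCI)

lemma averages_to_expectation: "averages_to J f h \<Longrightarrow> P.expectation f = P.expectation h"
  unfolding averages_to_def using P.all_moments_const[of 1] by (auto simp: ignores_def dest: spec[of _ "\<lambda>_. 1"])

text \<open>This is conditional independence: \<open>f\<close> may be averaged while \<open>f'\<close> is held fixed, and then
\<open>f'\<close> while \<open>h\<close> is held fixed.\<close>

lemma averages_to_product: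
  assumes f: "averages_to J f h" and f': "averages_to J' f' h'"
    and "\<And>v. v \<in> J \<Longrightarrow> ignores v f'" "\<And>v. v \<in> J' \<Longrightarrow> ignores v h"
  shows "P.expectation (\<lambda>x. f x * f' x) = P.expectation (\<lambda>x. h x * h' x)"
proof -
  have "P.expectation (\<lambda>x. f x * f' x) = P.expectation (\<lambda>x. h x * f' x)"
    using f f' assms(3) unfolding averages_to_def by blast
  also have "\<dots> = P.expectation (\<lambda>x. f' x * h x)" by (simp add: mult.commute)
  also have "\<dots> = P.expectation (\<lambda>x. h' x * h x)"
    using f f' assms(4) unfolding averages_to_def by blast
  finally show ?thesis by (simp add: mult.commute)
qed

end

context prob_space
begin

lemma expectation_mult_le_of_second_moments:
  assumes f: "all_moments M f" and g: "all_moments M g"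
    and "expectation (\<lambda>x. f x ^ 2) \<le> b" "expectation (\<lambda>x. g x ^ 2) \<le> b"
  shows "expectation (\<lambda>x. f x * g x) \<le> b"
proof -
  have "expectation (\<lambda>x. f x * g x) \<le> expectation (\<lambda>x. (f x ^ 2 + g x ^ 2) / 2)"
  proof (rule integral_mono)
    show "integrable M (\<lambda>x. f x * g x)" "integrable M (\<lambda>x. (f x ^ 2 + g x ^ 2) / 2)"
      by (intro all_moments_integrable all_moments_intros f g)+
    show "f x * g x \<le> (f x ^ 2 + g x ^ 2) / 2" for x
      using sum_squares_bound[of "f x" "g x"] by simp
  qed
  also have "\<dots> = (expectation (\<lambda>x. f x ^ 2) + expectation (\<lambda>x. g x ^ 2)) / 2"
    using all_moments_power_integrable[OF f, of 2] all_moments_power_integrable[OF g, of 2] by simp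
  finally show ?thesis using assms(3,4) by simp
qed

lemma variance_sum_le:
  assumes "finite T" "\<And>t. t \<in> T \<Longrightarrow> all_moments M (X t)"
    and cov: "\<And>t t'. t \<in> T \<Longrightarrow> t' \<in> T \<Longrightarrow>
      expectation (\<lambda>x. X t x * X t' x) - expectation (X t) * expectation (X t') \<le> c t t'"
  shows "variance (\<lambda>x. \<Sum>t\<in>T. X t x) \<le> (\<Sum>t\<in>T. \<Sum>t'\<in>T. c t t')"
proof -
  let ?S = "\<lambda>x. \<Sum>t\<in>T. X t x"
  have am: "all_moments M ?S" using assms by (intro all_moments_intros)
  have ES: "expectation ?S = (\<Sum>t\<in>T. expectation (X t))"
    using assms by (intro Bochner_Integration.integral_sum all_moments_integrable)
  have int2: "integrable M (\<lambda>x. X t x * X t' x)" if "t \<in> T" "t' \<in> T" for t t'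
    using that assms by (intro all_moments_integrable all_moments_intros)
  have "variance ?S = expectation (\<lambda>x. (?S x) ^ 2) - (expectation ?S) ^ 2"
    using all_moments_integrable[OF am] all_moments_power_integrable[OF am, of 2] by (rule variance_eq)
  also have "expectation (\<lambda>x. (?S x) ^ 2) = (\<Sum>t\<in>T. \<Sum>t'\<in>T. expectation (\<lambda>x. X t x * X t' x))"
    unfolding power2_eq_square sum_product using int2
    by (subst Bochner_Integration.integral_sum;
        auto intro!: sum.cong Bochner_Integration.integrable_sum Bochner_Integration.integral_sum)
  also have "\<dots> - (expectation ?S) ^ 2 =
      (\<Sum>t\<in>T. \<Sum>t'\<in>T. expectation (\<lambda>x. X t x * X t' x) - expectation (X t) * expectation (X t'))"
    unfolding ES power2_eq_square sum_product by (simp add: sum_subtractf)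
  also have "\<dots> \<le> (\<Sum>t\<in>T. \<Sum>t'\<in>T. c t t')"
    using cov by (intro sum_mono)
  finally show ?thesis .
qed

lemma variance_add3_le:
  assumes "all_moments M f" "all_moments M g" "all_moments M h"
  shows "variance (\<lambda>x. f x + g x + h x) \<le> 3 * (variance f + variance g + variance h)"
proof -
  note [simp] = assms[THEN all_moments_integrable]
  let ?f = "\<lambda>x. f x - expectation f" and ?g = "\<lambda>x. g x - expectation g" and ?h = "\<lambda>x. h x - expectation h"
  have "variance (\<lambda>x. f x + g x + h x) = expectation (\<lambda>x. (?f x + ?g x + ?h x) ^ 2)"
    by (simp add: algebra_simps)
  also have "\<dots> \<le> expectation (\<lambda>x. 3 * (?f x ^ 2 + ?g x ^ 2 + ?h x ^ 2))"
  proof (rule integral_mono)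
    show "integrable M (\<lambda>x. (?f x + ?g x + ?h x) ^ 2)" "integrable M (\<lambda>x. 3 * (?f x ^ 2 + ?g x ^ 2 + ?h x ^ 2))"
      by (intro all_moments_integrable all_moments_intros assms)+
    have "(a + b + c) ^ 2 \<le> 3 * (a ^ 2 + b ^ 2 + c ^ 2)" for a b c :: real
      using sum_squares_bound[of a b] sum_squares_bound[of b c] sum_squares_bound[of a c]
      by (simp add: power2_sum algebra_simps)
    then show "(?f x + ?g x + ?h x) ^ 2 \<le> 3 * (?f x ^ 2 + ?g x ^ 2 + ?h x ^ 2)" for x by blast
  qed
  also have "\<dots> = 3 * (variance f + variance g + variance h)"
  proof -
    have "integrable M (\<lambda>x. ?f x ^ 2)" "integrable M (\<lambda>x. ?g x ^ 2)" "integrable M (\<lambda>x. ?h x ^ 2)"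
      by (intro all_moments_integrable all_moments_intros assms)+
    then show ?thesis by simp
  qed
  finally show ?thesis .
qed

end

section \<open>Moments of standard Gaussian vectors\<close>

abbreviation N01 :: "real measure" where "N01 \<equiv> density lborel std_normal_density"

lemma all_moments_normal:
  assumes "\<sigma> > 0" shows "all_moments (density lborel (normal_density 0 \<sigma>)) (\<lambda>x. x)"
  unfolding all_moments_def
proof (intro conjI allI)
  fix k
  have "integrable lborel (\<lambda>x. normal_density 0 \<sigma> x * \<bar>x - 0\<bar> ^ k)"
    using assms by (rule integrable_normal_moment_abs)
  then show "integrable (density lborel (normal_density 0 \<sigma>)) (\<lambda>x. \<bar>x\<bar> ^ k)"
    by (subst integrable_density) auto
qed simp

lemma integral_normal_power_even:
  assumes "\<sigma> > 0"
  shows "(\<integral>x. x ^ (2 * k) \<partial>density lborel (normal_density 0 \<sigma>)) = fact (2 * k) / (2 ^ k * fact k) * (\<sigma> ^ 2) ^ k"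
proof -
  have "(\<integral>x. x ^ (2 * k) \<partial>density lborel (normal_density 0 \<sigma>)) = (\<integral>x. normal_density 0 \<sigma> x * (x - 0) ^ (2 * k) \<partial>lborel)"
    by (subst integral_density) auto
  also have "\<dots> = fact (2 * k) / ((2 / \<sigma>\<^sup>2) ^ k * fact k)"
    using assms by (rule integral_normal_moment_even)
  also have "\<dots> = fact (2 * k) / (2 ^ k * fact k) * (\<sigma> ^ 2) ^ k"
    using assms by (simp add: power_divide)
  finally show ?thesis .
qed

lemma integral_normal_power_odd:
  assumes "\<sigma> > 0"
  shows "(\<integral>x. x ^ (2 * k + 1) \<partial>density lborel (normal_density 0 \<sigma>)) = 0"
proof -
  have "(\<integral>x. x ^ (2 * k + 1) \<partial>density lborel (normal_density 0 \<sigma>)) = (\<integral>x. normal_density 0 \<sigma> x * (x - 0) ^ (2 * k + 1) \<partial>lborel)"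
    by (subst integral_density) auto
  also have "\<dots> = 0" using assms by (rule integral_normal_moment_odd)
  finally show ?thesis .
qed

lemma prob_N01: "prob_space N01"
  by (rule prob_space_normal_density) simp

lemma all_moments_component:
  assumes "\<And>i. i \<in> I \<Longrightarrow> prob_space (M i)" "i \<in> I" "all_moments (M i) g"
  shows "all_moments (PiM I M) (\<lambda>x. g (x i))"
proof -
  have d: "distr (PiM I M) (M i) (\<lambda>x. x i) = M i" using assms(1,2) by (rule distr_PiM_component)
  have m: "(\<lambda>x. x i) \<in> measurable (PiM I M) (M i)" using assms(2) by simp
  have g: "g \<in> borel_measurable (M i)" using assms(3) by (rule all_moments_measurable)
  have "integrable (PiM I M) (\<lambda>x. \<bar>g (x i)\<bar> ^ k)" for k
    using assms(3) integrable_distr_eq[OF m, of "\<lambda>y. \<bar>g y\<bar> ^ k"] g unfolding d all_moments_def by simp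
  then show ?thesis using measurable_compose[OF m g] by (simp add: all_moments_def)
qed

text \<open>The law \<open>\<gamma>\<close> of one column of the Gaussian matrix.\<close>

locale gauss_vec =
  fixes d :: nat
  assumes d_pos: "d > 0"
begin

definition \<gamma> :: "(nat \<Rightarrow> real) measure" where "\<gamma> = PiM {1..d} (\<lambda>_. N01)"
definition ip :: "(nat \<Rightarrow> real) \<Rightarrow> (nat \<Rightarrow> real) \<Rightarrow> real" where "ip x y = (\<Sum>k=1..d. x k * y k)"

sublocale G: prob_space \<gamma>
  unfolding \<gamma>_def using prob_N01 by (rule prob_space_PiM)

lemma ip_commute: "ip x y = ip y x" by (simp add: ip_def mult.commute)
lemma ip_add: "ip x (\<lambda>k. y k + z k) = ip x y + ip x z" "ip (\<lambda>k. y k + z k) x = ip y x + ip z x"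
  by (simp_all add: ip_def algebra_simps sum.distrib)
lemma ip_diff: "ip x (\<lambda>k. y k - z k) = ip x y - ip x z" "ip (\<lambda>k. y k - z k) x = ip y x - ip z x"
  by (simp_all add: ip_def algebra_simps sum_subtractf)

lemma all_moments_coord: "k \<in> {1..d} \<Longrightarrow> all_moments \<gamma> (\<lambda>y. y k)"
  unfolding \<gamma>_def using prob_N01 by (rule all_moments_component) (auto intro: all_moments_normal)

lemma all_moments_ip: "all_moments \<gamma> (\<lambda>y. ip y a)"
  unfolding ip_def by (intro G.all_moments_intros all_moments_coord) auto

lemma all_moments_sq: "all_moments \<gamma> (\<lambda>y. ip y y)"
  unfolding ip_def by (intro G.all_moments_intros all_moments_coord) auto

lemmas am = G.all_moments_intros all_moments_ip all_moments_sq

lemma indep_vars_coord: "G.indep_vars (\<lambda>_. borel) (\<lambda>k y. y k) {1..d}"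
proof -
  have rv: "(\<lambda>y. y k) \<in> borel_measurable \<gamma>" if "k \<in> {1..d}" for k
    using all_moments_measurable[OF all_moments_coord[OF that]] .
  have ne: "{1..d} \<noteq> {}" using d_pos by auto
  have comp: "distr \<gamma> borel (\<lambda>y. y k) = N01" if "k \<in> {1..d}" for k
  proof -
    have "distr \<gamma> borel (\<lambda>y. y k) = distr \<gamma> N01 (\<lambda>y. y k)" by (rule distr_cong) auto
    also have "\<dots> = N01" unfolding \<gamma>_def using that prob_N01 by (intro distr_PiM_component) auto
    finally show ?thesis .
  qed
  have sets: "sets (PiM {1..d} (\<lambda>_. borel :: real measure)) = sets \<gamma>"
    unfolding \<gamma>_def by (intro sets_PiM_cong) auto
  have "distr \<gamma> (PiM {1..d} (\<lambda>_. borel)) (\<lambda>x. \<lambda>i\<in>{1..d}. x i) = distr \<gamma> \<gamma> (\<lambda>x. x)"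
    using sets by (intro distr_cong) (auto simp: \<gamma>_def space_PiM)
  also have "\<dots> = \<gamma>" by (rule distr_id2) simp
  also have "\<dots> = PiM {1..d} (\<lambda>_. N01)" by (rule \<gamma>_def)
  also have "\<dots> = PiM {1..d} (\<lambda>k. distr \<gamma> borel (\<lambda>y. y k))"
    by (rule PiM_cong) (simp_all only: comp)
  finally show ?thesis
    by (subst G.indep_vars_iff_distr_eq_PiM'[OF ne]) (use rv in auto)
qed

text \<open>The linear form \<open>\<langle>y, a\<rangle>\<close> is a centered normal variable with variance \<open>|a|\<^sup>2\<close>. Coordinates
with \<open>a\<^sub>i = 0\<close> are left out, because the normal density requires a positive variance.\<close>

lemma ip_moment_even:
  assumes "k > 0"
  shows "(\<integral>y. ip y a ^ (2 * k) \<partial>\<gamma>) = fact (2 * k) / (2 ^ k * fact k) * ip a a ^ k"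
proof (cases "\<forall>i\<in>{1..d}. a i = 0")
  case True
  then have "ip a a = 0" "ip y a = 0" for y by (simp_all add: ip_def)
  then show ?thesis using assms by (simp add: zero_power)
next
  case False
  let ?K = "{i\<in>{1..d}. a i \<noteq> 0}"
  let ?\<sigma> = "sqrt (\<Sum>i\<in>?K. \<bar>a i\<bar>\<^sup>2)"
  have K: "finite ?K" "?K \<noteq> {}" using False by auto
  have sub: "?K \<subseteq> {1..d}" by auto
  have ind: "G.indep_vars (\<lambda>_. borel) (\<lambda>i y. 0 + a i * y i) ?K"
    using G.indep_vars_compose2[OF G.indep_vars_subset[OF indep_vars_coord sub], of "\<lambda>i x. 0 + a i * x" "\<lambda>_. borel"]
    by auto
  have dist: "distributed \<gamma> lborel (\<lambda>y. 0 + a i * y i) (normal_density (0 + a i * 0) (\<bar>a i\<bar> * 1))" if "i \<in> ?K" for i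
  proof (rule G.normal_density_affine)
    have "distr \<gamma> lborel (\<lambda>y. y i) = distr \<gamma> N01 (\<lambda>y. y i)" by (rule distr_cong) auto
    also have "\<dots> = N01" unfolding \<gamma>_def using that prob_N01 by (intro distr_PiM_component) auto
    finally show "distributed \<gamma> lborel (\<lambda>y. y i) std_normal_density"
      using all_moments_measurable[OF all_moments_coord[of i]] that by (simp add: distributed_def)
  qed (use that in auto)
  have "distributed \<gamma> lborel (\<lambda>y. \<Sum>i\<in>?K. 0 + a i * y i)
      (normal_density (\<Sum>i\<in>?K. 0 + a i * 0) (sqrt (\<Sum>i\<in>?K. (\<bar>a i\<bar> * 1)\<^sup>2)))"
    using K ind dist by (intro G.sum_indep_normal) auto
  then have D: "distributed \<gamma> lborel (\<lambda>y. \<Sum>i\<in>?K. a i * y i) (normal_density 0 ?\<sigma>)" by simp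
  have ipK: "ip y a = (\<Sum>i\<in>?K. a i * y i)" for y
    unfolding ip_def by (intro sum.mono_neutral_cong_right) auto
  have pos: "(\<Sum>i\<in>?K. \<bar>a i\<bar>\<^sup>2) > 0" using K by (intro sum_pos) auto
  have "(\<Sum>i\<in>?K. \<bar>a i\<bar>\<^sup>2) = ip a a"
    unfolding ip_def by (intro sum.mono_neutral_cong_left) (auto simp: power2_eq_square)
  then have \<sigma>: "?\<sigma> ^ 2 = ip a a" "?\<sigma> > 0" using pos by simp_all
  have "(\<integral>y. ip y a ^ (2 * k) \<partial>\<gamma>) = (\<integral>x. normal_density 0 ?\<sigma> x * x ^ (2 * k) \<partial>lborel)"
    unfolding ipK by (rule distributed_integral[OF D, symmetric]) auto
  also have "\<dots> = (\<integral>x. x ^ (2 * k) \<partial>density lborel (normal_density 0 ?\<sigma>))"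
    by (subst integral_density) auto
  also have "\<dots> = fact (2 * k) / (2 ^ k * fact k) * ip a a ^ k"
    unfolding integral_normal_power_even[OF \<sigma>(2)] \<sigma>(1) ..
  finally show ?thesis .
qed

lemma ip_moment2: "(\<integral>y. ip y a ^ 2 \<partial>\<gamma>) = ip a a"
  using ip_moment_even[of 1 a] by simp

lemma ip_moment4: "(\<integral>y. ip y a ^ 4 \<partial>\<gamma>) = 3 * ip a a ^ 2"
  using ip_moment_even[of 2 a] by (simp add: fact_numeral)

lemmas integrable_am = all_moments_integrable[where M = \<gamma>]

text \<open>Polarization of the second moment.\<close>

lemma ip_moment11: "(\<integral>y. ip y a * ip y b \<partial>\<gamma>) = ip a b"
proof -
  have e: "ip y a * ip y b = (ip y (\<lambda>k. a k + b k) ^ 2 - ip y (\<lambda>k. a k - b k) ^ 2) / 4" for y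
    by (simp add: ip_add ip_diff power2_eq_square algebra_simps)
  have "(\<integral>y. ip y a * ip y b \<partial>\<gamma>) =
      ((\<integral>y. ip y (\<lambda>k. a k + b k) ^ 2 \<partial>\<gamma>) - (\<integral>y. ip y (\<lambda>k. a k - b k) ^ 2 \<partial>\<gamma>)) / 4"
    unfolding e by (subst Bochner_Integration.integral_diff[symmetric]) (auto intro!: integrable_am am)
  also have "\<dots> = ip a b"
    unfolding ip_moment2 by (simp add: ip_add ip_diff ip_commute[of b a])
  finally show ?thesis .
qed

text \<open>Polarization of the fourth moment, from \<open>12 p\<^sup>2 q\<^sup>2 = (p + q)\<^sup>4 + (p - q)\<^sup>4 - 2 p\<^sup>4 - 2 q\<^sup>4\<close>.\<close>

lemma ip_moment22: "(\<integral>y. ip y a ^ 2 * ip y b ^ 2 \<partial>\<gamma>) = ip a a * ip b b + 2 * ip a b ^ 2"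
proof -
  let ?p = "\<lambda>k. a k + b k" and ?m = "\<lambda>k. a k - b k"
  have e: "ip y a ^ 2 * ip y b ^ 2 = (ip y ?p ^ 4 + ip y ?m ^ 4 - (2 * ip y a ^ 4 + 2 * ip y b ^ 4)) / 12" for y
    by (simp add: ip_add ip_diff power2_eq_square power4_eq_xxxx algebra_simps)
  have i: "integrable \<gamma> (\<lambda>y. ip y c ^ 4)" for c by (intro integrable_am am)
  have "(\<integral>y. ip y a ^ 2 * ip y b ^ 2 \<partial>\<gamma>) =
      ((\<integral>y. ip y ?p ^ 4 \<partial>\<gamma>) + (\<integral>y. ip y ?m ^ 4 \<partial>\<gamma>)
        - (2 * (\<integral>y. ip y a ^ 4 \<partial>\<gamma>) + 2 * (\<integral>y. ip y b ^ 4 \<partial>\<gamma>))) / 12"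
    unfolding e using i by simp
  also have "\<dots> = ip a a * ip b b + 2 * ip a b ^ 2"
    unfolding ip_moment4 by (simp add: ip_add ip_diff ip_commute[of b a] power2_eq_square algebra_simps)
  finally show ?thesis .
qed

definition unit_vec :: "nat \<Rightarrow> nat \<Rightarrow> real" where "unit_vec k = (\<lambda>i. if i = k then 1 else 0)"

lemma ip_unit_vec: "k \<in> {1..d} \<Longrightarrow> ip y (unit_vec k) = y k"
  by (simp add: ip_def unit_vec_def if_distrib[of "\<lambda>t. _ * t"] cong: if_cong)

lemma unit_vec_same [simp]: "unit_vec k k = 1" by (simp add: unit_vec_def)

lemma ip_unit_vec_unit_vec: "k \<in> {1..d} \<Longrightarrow> ip (unit_vec k) (unit_vec k) = 1"
  by (subst ip_unit_vec) (simp_all add: unit_vec_def)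

lemma sq_eq_sum_unit_vec: "ip y y = (\<Sum>k=1..d. ip y (unit_vec k) ^ 2)"
  unfolding ip_def[of y y] by (intro sum.cong refl) (simp add: ip_unit_vec power2_eq_square)

text \<open>Since \<open>|y|\<^sup>2\<close> is the sum of \<open>\<langle>y, e\<^sub>k\<rangle>\<^sup>2\<close> over the standard basis, this is a sum of instances
of \<open>ip_moment22\<close>.\<close>

lemma sq_moment_ip2: "(\<integral>y. ip y y * ip y a ^ 2 \<partial>\<gamma>) = (real d + 2) * ip a a"
proof -
  have e: "ip y y * ip y a ^ 2 = (\<Sum>k=1..d. ip y a ^ 2 * ip y (unit_vec k) ^ 2)" for y
    unfolding sq_eq_sum_unit_vec[of y] by (simp add: sum_distrib_left mult.commute)
  have "(\<integral>y. ip y y * ip y a ^ 2 \<partial>\<gamma>) = (\<Sum>k=1..d. \<integral>y. ip y a ^ 2 * ip y (unit_vec k) ^ 2 \<partial>\<gamma>)"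
    unfolding e by (intro Bochner_Integration.integral_sum integrable_am am)
  also have "\<dots> = (\<Sum>k=1..d. ip a a + 2 * (a k * a k))"
    unfolding ip_moment22 by (intro sum.cong) (simp_all add: ip_unit_vec ip_unit_vec_unit_vec power2_eq_square)
  also have "\<dots> = (real d + 2) * ip a a"
    by (simp add: sum.distrib sum_distrib_left[symmetric] distrib_right) (simp add: ip_def)
  finally show ?thesis .
qed

lemma sq_moment: "(\<integral>y. ip y y \<partial>\<gamma>) = real d"
proof -
  have "(\<integral>y. ip y y \<partial>\<gamma>) = (\<Sum>k=1..d. \<integral>y. ip y (unit_vec k) ^ 2 \<partial>\<gamma>)"
    by (subst sq_eq_sum_unit_vec) (intro Bochner_Integration.integral_sum integrable_am am)
  also have "\<dots> = real d"
    unfolding ip_moment2 by (simp add: ip_unit_vec_unit_vec)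
  finally show ?thesis .
qed

end

lemma normal_centered_square_moments:
  "(\<integral>y. (y ^ 2 - 1) \<partial>N01) = 0" "(\<integral>y. (y ^ 2 - 1) ^ 2 \<partial>N01) = 2" "(\<integral>y. (y ^ 2 - 1) ^ 4 \<partial>N01) = 60"
proof -
  interpret prob_space N01 by (rule prob_N01)
  have one: "prob UNIV = 1" using prob_space by simp
  have i: "integrable N01 (\<lambda>y. y ^ k)" for k
    using all_moments_power_integrable[OF all_moments_normal[of 1]] by simp
  have m: "(\<integral>y. y ^ 2 \<partial>N01) = 1" "(\<integral>y. y ^ 4 \<partial>N01) = 3" "(\<integral>y. y ^ 6 \<partial>N01) = 15" "(\<integral>y. y ^ 8 \<partial>N01) = 105"
    using integral_normal_power_even[of 1 1] integral_normal_power_even[of 1 2]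
      integral_normal_power_even[of 1 3] integral_normal_power_even[of 1 4]
    by (simp_all add: fact_numeral)
  show "(\<integral>y. (y ^ 2 - 1) \<partial>N01) = 0" using i m by (simp add: one)
  have e: "(y ^ 2 - 1) ^ 2 = y ^ 4 - 2 * y ^ 2 + (1::real)" for y by (simp add: power2_eq_square power4_eq_xxxx algebra_simps)
  show "(\<integral>y. (y ^ 2 - 1) ^ 2 \<partial>N01) = 2" unfolding e using i m by (simp add: one)
  have e: "(y ^ 2 - 1) ^ 4 = y ^ 8 - 4 * y ^ 6 + 6 * y ^ 4 - 4 * y ^ 2 + (1::real)" for y
    by (simp add: power2_eq_square power4_eq_xxxx eval_nat_numeral algebra_simps)
  show "(\<integral>y. (y ^ 2 - 1) ^ 4 \<partial>N01) = 60" unfolding e using i m by (simp add: one)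
qed

text \<open>The fluctuation of a chi-square variable with \<open>card K\<close> degrees of freedom is of order
\<open>\<surd>(card K)\<close>. The fourth moment is computed by adding one coordinate at a time; its third moment
enters only multiplied by the mean 0 of the sum so far.\<close>

lemma centered_square_sum_moments:
  fixes K :: "nat set"
  assumes "finite K"
  defines "P \<equiv> PiM K (\<lambda>_. N01)"
  defines "S \<equiv> \<lambda>y. \<Sum>k\<in>K. (y k) ^ 2 - 1"
  shows "(\<integral>y. S y \<partial>P) = 0 \<and> (\<integral>y. S y ^ 2 \<partial>P) = 2 * card K \<and> (\<integral>y. S y ^ 4 \<partial>P) \<le> 60 * card K ^ 2"
  unfolding P_def S_def using assms(1)
proof (induction K)
  case empty
  show ?case by simp
next
  case (insert i K)
  interpret indep_coords "insert i K" "\<lambda>_. N01" by (rule indep_coords.intro) (rule prob_N01)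
  interpret K: indep_coords K "\<lambda>_. N01" by (rule indep_coords.intro) (rule prob_N01)
  interpret N: prob_space N01 by (rule prob_N01)
  interpret Q: product_prob_space "\<lambda>_. N01"
    by (rule product_prob_spaceI) (rule prob_N01)
  have one: "N.prob UNIV = 1" using N.prob_space by simp
  let ?S = "\<lambda>y. \<Sum>k\<in>K. (y k) ^ 2 - 1" and ?z = "\<lambda>t::real. t ^ 2 - 1"
  have am0: "all_moments N01 (\<lambda>x. x)" using all_moments_normal[of 1] by simp
  have amz: "all_moments N01 ?z" by (intro N.all_moments_intros am0)
  have amK: "all_moments (PiM K (\<lambda>_. N01)) (\<lambda>y. y k)" if "k \<in> K" for k
    using all_moments_component[OF prob_N01 that am0] .
  have amS: "all_moments (PiM K (\<lambda>_. N01)) ?S" by (intro K.P.all_moments_intros amK)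
  have amI: "all_moments (PiM (insert i K) (\<lambda>_. N01)) (\<lambda>y. y k)" if "k \<in> insert i K" for k
    using all_moments_component[OF prob_N01 that am0] .
  have amSI: "all_moments (PiM (insert i K) (\<lambda>_. N01)) (\<lambda>y. \<Sum>k\<in>insert i K. (y k) ^ 2 - 1)"
    by (intro P.all_moments_intros amI)
  have split: "(\<integral>y. (\<Sum>k\<in>insert i K. (y k) ^ 2 - 1) ^ p \<partial>PiM (insert i K) (\<lambda>_. N01)) =
     (\<integral>x. (\<integral>t. (?S x + ?z t) ^ p \<partial>N01) \<partial>PiM K (\<lambda>_. N01))" for p
  proof (subst Q.product_integral_insert[OF insert.hyps(1,2) all_moments_power_integrable[OF amSI]])
    have "(\<Sum>k\<in>insert i K. ((x(i := t)) k) ^ 2 - 1) = ?S x + ?z t" for x :: "nat \<Rightarrow> real" and t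
    proof -
      have "(\<Sum>k\<in>K. ((x(i := t)) k) ^ 2 - 1) = ?S x"
        using insert.hyps(2) by (intro sum.cong) auto
      then show ?thesis using insert.hyps by simp
    qed
    then show "(\<integral>x. \<integral>y. (\<Sum>k\<in>insert i K. ((x(i := y)) k)\<^sup>2 - 1) ^ p \<partial>N01 \<partial>Pi\<^sub>M K (\<lambda>_. N01)) =
      (\<integral>x. (\<integral>t. (?S x + ?z t) ^ p \<partial>N01) \<partial>PiM K (\<lambda>_. N01))" by simp
  qed
  note iz = all_moments_power_integrable[OF amz] all_moments_integrable[OF amz]
  note iS = all_moments_power_integrable[OF amS] all_moments_integrable[OF amS]
  note mz = normal_centered_square_moments
  let ?m3 = "\<integral>t. (?z t) ^ 3 \<partial>N01"
  have e1: "(\<integral>t. (s + ?z t) ^ 1 \<partial>N01) = s" for s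
    using iz mz by (simp add: one)
  have e2: "(\<integral>t. (s + ?z t) ^ 2 \<partial>N01) = s ^ 2 + 2" for s
  proof -
    have "(s + ?z t) ^ 2 = s ^ 2 + (2 * s) * ?z t + (?z t) ^ 2" for t
      by (simp add: power2_sum)
    then have "(\<integral>t. (s + ?z t) ^ 2 \<partial>N01) = (\<integral>t. s ^ 2 + (2 * s) * ?z t + (?z t) ^ 2 \<partial>N01)" by simp
    also have "\<dots> = s ^ 2 + (2 * s) * (\<integral>t. ?z t \<partial>N01) + (\<integral>t. (?z t) ^ 2 \<partial>N01)"
      using iz by (simp only: Bochner_Integration.integral_add Bochner_Integration.integrable_add
          integrable_mult_right integral_mult_right_zero N.integrable_const) (simp add: one)
    finally show ?thesis unfolding mz by simp
  qed
  have e4: "(\<integral>t. (s + ?z t) ^ 4 \<partial>N01) = s ^ 4 + 12 * s ^ 2 + 4 * ?m3 * s + 60" for s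
  proof -
    have "(s + ?z t) ^ 4 = s ^ 4 + (4 * s ^ 3) * ?z t + (6 * s ^ 2) * (?z t) ^ 2 + (4 * s) * (?z t) ^ 3 + (?z t) ^ 4" for t
      by (simp add: power4_eq_xxxx power3_eq_cube power2_eq_square algebra_simps)
    then have "(\<integral>t. (s + ?z t) ^ 4 \<partial>N01) = (\<integral>t. s ^ 4 + (4 * s ^ 3) * ?z t + (6 * s ^ 2) * (?z t) ^ 2 + (4 * s) * (?z t) ^ 3 + (?z t) ^ 4 \<partial>N01)"
      by simp
    also have "\<dots> = s ^ 4 + (4 * s ^ 3) * (\<integral>t. ?z t \<partial>N01) + (6 * s ^ 2) * (\<integral>t. (?z t) ^ 2 \<partial>N01)
        + (4 * s) * ?m3 + (\<integral>t. (?z t) ^ 4 \<partial>N01)"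
      using iz by (simp only: Bochner_Integration.integral_add Bochner_Integration.integrable_add
          integrable_mult_right integral_mult_right_zero N.integrable_const) (simp add: one)
    finally show ?thesis unfolding mz by simp
  qed
  have 1: "(\<integral>y. (\<Sum>k\<in>insert i K. (y k) ^ 2 - 1) \<partial>PiM (insert i K) (\<lambda>_. N01)) = 0"
    using split[of 1] e1 insert.IH by simp
  have 2: "(\<integral>y. (\<Sum>k\<in>insert i K. (y k) ^ 2 - 1) ^ 2 \<partial>PiM (insert i K) (\<lambda>_. N01)) = 2 * card (insert i K)"
    using split[of 2] insert.IH iS insert.hyps unfolding e2 by (simp add: K.P.prob_space)
  have "(\<integral>y. (\<Sum>k\<in>insert i K. (y k) ^ 2 - 1) ^ 4 \<partial>PiM (insert i K) (\<lambda>_. N01)) =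
     (\<integral>x. ?S x ^ 4 + 12 * ?S x ^ 2 + 4 * ?m3 * ?S x + 60 \<partial>PiM K (\<lambda>_. N01))"
    unfolding split e4 ..
  also have "\<dots> = (\<integral>x. ?S x ^ 4 \<partial>PiM K (\<lambda>_. N01)) + 12 * (\<integral>x. ?S x ^ 2 \<partial>PiM K (\<lambda>_. N01))
      + 4 * ?m3 * (\<integral>x. ?S x \<partial>PiM K (\<lambda>_. N01)) + 60"
    using iS by (simp only: Bochner_Integration.integral_add Bochner_Integration.integrable_add
          integrable_mult_right integral_mult_right_zero K.P.integrable_const) (simp add: K.P.prob_space)
  \<comment> \<open>Twelve times the second moment \<open>2 * card K\<close> gives the linear term.\<close>
  also have "\<dots> \<le> 60 * real (card K) ^ 2 + 24 * real (card K) + 60" using insert.IH by simp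
  also have "\<dots> \<le> 60 * real (card (insert i K)) ^ 2"
    using insert.hyps by (simp add: power2_eq_square algebra_simps)
  finally show ?case using 1 2 by simp
qed

section \<open>Covariances and conditional expectations\<close>

context indep_coords
begin

text \<open>The conditional expectation of \<open>f\<close>, a function of the coordinates in \<open>S\<close>, given those in
\<open>J\<close> has second moment at most \<open>b (card J)\<close>. For \<open>J = {}\<close> it is the mean of \<open>f\<close>, and \<open>c\<close> records
its value.\<close>

definition reduces :: "(nat \<Rightarrow> real) \<Rightarrow> real \<Rightarrow> 'i set \<Rightarrow> (('i \<Rightarrow> 'a) \<Rightarrow> real) \<Rightarrow> 'i set \<Rightarrow> bool" where
  "reduces b c S f J \<longleftrightarrow> (\<exists>h. averages_to (S - J) f h \<and> (\<forall>v. v \<notin> J \<longrightarrow> ignores v h) \<and>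
     P.expectation (\<lambda>x. h x ^ 2) \<le> b (card J) \<and> (J = {} \<longrightarrow> h = (\<lambda>_. c)))"

lemma reduces_self:
  assumes "all_moments (PiM I M) f" "\<And>v. v \<notin> S \<Longrightarrow> ignores v f"
    and "P.expectation (\<lambda>x. f x ^ 2) \<le> b (card S)" "S \<noteq> {}"
  shows "reduces b c S f S"
  unfolding reduces_def using assms by (intro exI[of _ f]) (auto intro: averages_to_refl)

text \<open>Averaging out the coordinate \<open>r\<close> first reduces the claim for \<open>f\<close> to the claim for the
average. All the bounds below are chains of such steps, so only one-vertex averages have to be
computed.\<close>

lemma reduces_step:
  assumes "averages_to {r} f f'" "reduces b c S f' J" "r \<notin> J"
  shows "reduces b c (insert r S) f J"
proof -
  obtain h where h: "averages_to (S - J) f' h" "\<forall>v. v \<notin> J \<longrightarrow> ignores v h"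
     "P.expectation (\<lambda>x. h x ^ 2) \<le> b (card J)" "J = {} \<longrightarrow> h = (\<lambda>_. c)"
    using assms(2) unfolding reduces_def by blast
  have "insert r S - J = {r} \<union> (S - J)" using assms(3) by auto
  then have "averages_to (insert r S - J) f h" using averages_to_trans[OF assms(1) h(1)] by simp
  then show ?thesis unfolding reduces_def using h by blast
qed

lemma reduces_const:
  assumes "c ^ 2 \<le> b 0" shows "reduces b c {} (\<lambda>_. c) {}"
proof -
  have "averages_to {} (\<lambda>_. c) (\<lambda>_. c)" by (rule averages_to_refl[OF P.all_moments_const])
  then show ?thesis
    unfolding reduces_def using assms by (intro exI[of _ "\<lambda>_. c"]) (simp add: ignores_def P.prob_space)
qed

lemma reduces_expectation: "reduces b c S f {} \<Longrightarrow> P.expectation f = c"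
  unfolding reduces_def by (auto dest!: averages_to_expectation simp: P.prob_space)

lemma reduces_all_moments: "reduces b c S f J \<Longrightarrow> all_moments (PiM I M) f"
  by (auto simp: reduces_def averages_to_def)

text \<open>The product of the means is dropped, which is allowed because it is nonnegative, except if
there are no common coordinates; then both conditional expectations are the constant \<open>c\<close> and the
covariance is 0. The condition \<open>finite S\<close> is there because an infinite intersection has
cardinality 0, too.\<close>

lemma covariance_le_reduces:
  assumes r: "reduces b c S f (S \<inter> S')" "reduces b c S' f' (S \<inter> S')"
    and ig: "\<And>v. v \<notin> S \<Longrightarrow> ignores v f" "\<And>v. v \<notin> S' \<Longrightarrow> ignores v f'"
    and E: "P.expectation f = c" "P.expectation f' = c" and c: "c \<ge> 0"
  shows "P.expectation (\<lambda>x. f x * f' x) - P.expectation f * P.expectation f'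
    \<le> (if card (S \<inter> S') = 0 \<and> finite S then 0 else b (card (S \<inter> S')))"
proof -
  let ?J = "S \<inter> S'"
  obtain h where h: "averages_to (S - ?J) f h" "\<And>v. v \<notin> ?J \<Longrightarrow> ignores v h"
     "P.expectation (\<lambda>x. h x ^ 2) \<le> b (card ?J)" "?J = {} \<Longrightarrow> h = (\<lambda>_. c)"
    using r(1) unfolding reduces_def by blast
  obtain h' where h': "averages_to (S' - ?J) f' h'" "\<And>v. v \<notin> ?J \<Longrightarrow> ignores v h'"
     "P.expectation (\<lambda>x. h' x ^ 2) \<le> b (card ?J)" "?J = {} \<Longrightarrow> h' = (\<lambda>_. c)"
    using r(2) unfolding reduces_def by blast
  have eq: "P.expectation (\<lambda>x. f x * f' x) = P.expectation (\<lambda>x. h x * h' x)"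
  proof (rule averages_to_product[OF h(1) h'(1)])
    show "ignores v f'" if "v \<in> S - ?J" for v using that by (intro ig(2)) auto
    show "ignores v h" if "v \<in> S' - ?J" for v using that by (intro h(2)) auto
  qed
  show ?thesis
  proof (cases "?J = {}")
    case True
    then have "P.expectation (\<lambda>x. f x * f' x) = c * c"
      unfolding eq using h(4) h'(4) by (simp add: P.prob_space)
    then have "P.expectation (\<lambda>x. f x * f' x) - P.expectation f * P.expectation f' = 0" using E by simp
    moreover have "0 \<le> b 0"
    proof -
      have "0 \<le> P.expectation (\<lambda>x. h x ^ 2)" by (rule Bochner_Integration.integral_nonneg) simp
      also have "\<dots> \<le> b (card ?J)" by (rule h(3))
      finally show ?thesis using True by simp
    qed
    ultimately show ?thesis using True by simp
  next
    case False
    have "P.expectation (\<lambda>x. h x * h' x) \<le> b (card ?J)"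
      using h h' by (intro P.expectation_mult_le_of_second_moments) (auto simp: averages_to_def)
    moreover have "0 \<le> P.expectation f * P.expectation f'" using E c by simp
    ultimately show ?thesis using False eq by auto
  qed
qed

end

section \<open>Norms and inner products of the columns\<close>

text \<open>A configuration assigns a vector of length \<open>d\<close> to each vertex; these are the independent
columns of the Gaussian matrix. The random variable \<open>w i j\<close> is the off-diagonal entry of the
normalized Wishart matrix, and \<open>s i\<close> is the conditional variance of \<open>w i j\<close> given the column \<open>i\<close>.\<close>

locale wishart = gauss_vec d for d :: nat +
  fixes V :: "nat set"
begin

abbreviation "\<Omega> \<equiv> PiM V (\<lambda>_. \<gamma>)"

sublocale W: indep_coords "V" "\<lambda>_. \<gamma>"
  by (rule indep_coords.intro) (rule G.prob_space_axioms)

definition s :: "nat \<Rightarrow> (nat \<Rightarrow> nat \<Rightarrow> real) \<Rightarrow> real" where "s i x = ip (x i) (x i) / real d"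
definition w :: "nat \<Rightarrow> nat \<Rightarrow> (nat \<Rightarrow> nat \<Rightarrow> real) \<Rightarrow> real" where "w i j x = ip (x i) (x j) / sqrt (real d)"

lemma w_commute: "w i j = w j i" by (auto simp: w_def ip_commute)

lemma s_nonneg: "s i x \<ge> 0" by (simp add: s_def ip_def sum_nonneg)

lemma all_moments_entry: "i \<in> V \<Longrightarrow> k \<in> {1..d} \<Longrightarrow> all_moments \<Omega> (\<lambda>x. x i k)"
  by (rule all_moments_component[where M = "\<lambda>_. \<gamma>" and g = "\<lambda>y. y k", OF G.prob_space_axioms _ all_moments_coord])

lemma all_moments_w: "i \<in> V \<Longrightarrow> j \<in> V \<Longrightarrow> all_moments \<Omega> (w i j)"
  unfolding w_def ip_def by (intro W.P.all_moments_intros all_moments_entry) auto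

lemma all_moments_s: "i \<in> V \<Longrightarrow> all_moments \<Omega> (s i)"
  unfolding s_def ip_def by (intro W.P.all_moments_intros all_moments_entry) auto

lemmas amW = W.P.all_moments_intros all_moments_w all_moments_s
lemmas intW = all_moments_integrable[where M = \<Omega>]

lemma expectation_column:
  fixes \<phi> :: "(nat \<Rightarrow> real) \<Rightarrow> real"
  assumes "i \<in> V" "\<phi> \<in> borel_measurable \<gamma>"
  shows "W.P.expectation (\<lambda>x. \<phi> (x i)) = G.expectation \<phi>"
proof -
  have d: "distr \<Omega> \<gamma> (\<lambda>x. x i) = \<gamma>" using assms(1) G.prob_space_axioms by (intro distr_PiM_component) auto
  have "G.expectation \<phi> = integral\<^sup>L (distr \<Omega> \<gamma> (\<lambda>x. x i)) \<phi>" unfolding d ..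
  also have "\<dots> = W.P.expectation (\<lambda>x. \<phi> (x i))" using assms by (intro integral_distr) auto
  finally show ?thesis ..
qed

lemma s_centered_moments:
  assumes "i \<in> V"
  shows "W.P.expectation (s i) = 1" "W.P.expectation (\<lambda>x. (s i x - 1) ^ 2) = 2 / d"
    "W.P.expectation (\<lambda>x. (s i x - 1) ^ 4) \<le> 60 / d ^ 2"
proof -
  let ?S = "\<lambda>y. \<Sum>k\<in>{1..d}. (y k) ^ 2 - 1"
  have S: "?S y = ip y y - real d" for y
    by (simp add: ip_def sum_subtractf power2_eq_square)
  have m: "G.expectation (\<lambda>y. (ip y y - real d) ^ 2) = 2 * d" "G.expectation (\<lambda>y. (ip y y - real d) ^ 4) \<le> 60 * d ^ 2"
    using centered_square_sum_moments[of "{1..d}"] unfolding \<gamma>_def[symmetric] S by simp_all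
  have meas: "(\<lambda>y. ip y y) \<in> borel_measurable \<gamma>" by (rule all_moments_measurable[OF all_moments_sq])
  have "W.P.expectation (s i) = G.expectation (\<lambda>y. ip y y / real d)"
    unfolding s_def using assms meas by (intro expectation_column) auto
  then show "W.P.expectation (s i) = 1" using sq_moment d_pos by simp
  have e: "(s i x - 1) ^ p = (ip (x i) (x i) - real d) ^ p / real d ^ p" for x p
    using d_pos by (simp add: s_def power_divide[symmetric] diff_divide_distrib)
  have E: "W.P.expectation (\<lambda>x. (s i x - 1) ^ p) = G.expectation (\<lambda>y. (ip y y - real d) ^ p) / real d ^ p" for p
    unfolding e using expectation_column[OF assms, of "\<lambda>y. (ip y y - real d) ^ p"] meas by simp
  show "W.P.expectation (\<lambda>x. (s i x - 1) ^ 2) = 2 / d"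
    unfolding E m using d_pos by (simp add: power2_eq_square)
  have "G.expectation (\<lambda>y. (ip y y - real d) ^ 4) / real d ^ 4 \<le> (60 * real d ^ 2) / real d ^ 4"
    using m(2) by (intro divide_right_mono) simp_all
  also have "\<dots> = 60 / d ^ 2"
    using d_pos by (simp add: power4_eq_xxxx power2_eq_square)
  finally show "W.P.expectation (\<lambda>x. (s i x - 1) ^ 4) \<le> 60 / d ^ 2"
    unfolding E .
qed

lemma d_ge_1: "real d \<ge> 1" using d_pos by simp

lemma s_moment4: assumes "i \<in> V" shows "W.P.expectation (\<lambda>x. s i x ^ 4) \<le> 488"
proof -
  have "t ^ 4 \<le> 8 * ((t - 1) ^ 4 + 1)" for t :: real
  proof -
    have "(u + 1) ^ 2 \<le> 2 * (u ^ 2 + 1)" for u :: real using sum_squares_bound[of u 1] by (simp add: power2_sum)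
    from this[of "t - 1"] have "t ^ 2 \<le> 2 * ((t - 1) ^ 2 + 1)" by simp
    then have "(t ^ 2) ^ 2 \<le> (2 * ((t - 1) ^ 2 + 1)) ^ 2" by (intro power_mono) auto
    also have "\<dots> \<le> 4 * (2 * (((t - 1) ^ 2) ^ 2 + 1))"
      using sum_squares_bound[of "(t - 1) ^ 2" 1] by (simp add: power2_sum power_mult_distrib)
    finally show ?thesis by (simp add: power_mult[symmetric])
  qed
  then have "W.P.expectation (\<lambda>x. s i x ^ 4) \<le> W.P.expectation (\<lambda>x. 8 * ((s i x - 1) ^ 4 + 1))"
    by (intro integral_mono intW amW assms)
  also have "\<dots> = 8 * (W.P.expectation (\<lambda>x. (s i x - 1) ^ 4) + 1)"
  proof -
    have "integrable \<Omega> (\<lambda>x. (s i x - 1) ^ 4)" by (intro intW amW assms)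
    then show ?thesis by (simp add: W.P.prob_space)
  qed
  also have "\<dots> \<le> 8 * (60 / d ^ 2 + 1)" using s_centered_moments(3)[OF assms] by simp
  also have "60 / real (d ^ 2) \<le> 60"
    using d_ge_1 by (simp add: divide_le_eq)
  finally show ?thesis by simp
qed

lemma s_moment2: assumes "i \<in> V" shows "W.P.expectation (\<lambda>x. s i x ^ 2) \<le> 6"
proof -
  have "t ^ 2 \<le> 2 * ((t - 1) ^ 2 + 1)" for t :: real
    using sum_squares_bound[of "t - 1" 1] by (simp add: power2_eq_square algebra_simps)
  then have "W.P.expectation (\<lambda>x. s i x ^ 2) \<le> W.P.expectation (\<lambda>x. 2 * ((s i x - 1) ^ 2 + 1))"
    by (intro integral_mono intW amW assms)
  also have "\<dots> = 2 * (W.P.expectation (\<lambda>x. (s i x - 1) ^ 2) + 1)"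
  proof -
    have "integrable \<Omega> (\<lambda>x. (s i x - 1) ^ 2)" by (intro intW amW assms)
    then show ?thesis by (simp add: W.P.prob_space)
  qed
  also have "\<dots> \<le> 6" using s_centered_moments(2)[OF assms] d_ge_1 by (simp add: divide_le_eq)
  finally show ?thesis .
qed

lemma s_moment3: assumes "i \<in> V" shows "W.P.expectation (\<lambda>x. s i x ^ 3) \<le> 489"
proof -
  have "t ^ 3 \<le> t ^ 4 + 1" if "t \<ge> 0" for t :: real
  proof (cases "t \<le> 1")
    case True then have "t ^ 3 \<le> 1" using that by (intro power_le_one) auto
    then show ?thesis using that by (simp add: add_increasing)
  next
    case False then have "t ^ 3 \<le> t ^ 4" by (intro power_increasing) auto
    then show ?thesis by simp
  qed
  then have "W.P.expectation (\<lambda>x. s i x ^ 3) \<le> W.P.expectation (\<lambda>x. s i x ^ 4 + 1)"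
    using s_nonneg by (intro integral_mono intW amW assms) auto
  also have "\<dots> = W.P.expectation (\<lambda>x. s i x ^ 4) + 1"
  proof -
    have "integrable \<Omega> (\<lambda>x. s i x ^ 4)" by (intro intW amW assms)
    then show ?thesis by (simp add: W.P.prob_space)
  qed
  finally show ?thesis using s_moment4[OF assms] by simp
qed

text \<open>Given the column \<open>i\<close>, the variable \<open>w i j\<close> is normal with variance \<open>s i\<close>.\<close>

lemma expectation_w_power:
  assumes ij: "i \<in> V" "j \<in> V" "i \<noteq> j" and "k > 0"
  shows "W.P.expectation (\<lambda>x. w i j x ^ (2 * k)) = fact (2 * k) / (2 ^ k * fact k) * W.P.expectation (\<lambda>x. s i x ^ k)"
proof -
  have "W.P.expectation (\<lambda>x. w i j x ^ (2 * k)) = W.P.expectation (\<lambda>x. \<integral>y. w i j (x(j := y)) ^ (2 * k) \<partial>\<gamma>)"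
    using ij by (intro W.expectation_resample intW amW) auto
  also have "\<dots> = W.P.expectation (\<lambda>x. fact (2 * k) / (2 ^ k * fact k) * s i x ^ k)"
  proof (rule Bochner_Integration.integral_cong[OF refl])
    fix x
    have "(\<integral>y. w i j (x(j := y)) ^ (2 * k) \<partial>\<gamma>) = (\<integral>y. ip y (x i) ^ (2 * k) / real d ^ k \<partial>\<gamma>)"
      using ij d_pos by (simp add: w_def ip_commute[of "x i"] power_divide power_mult)
    also have "\<dots> = (\<integral>y. ip y (x i) ^ (2 * k) \<partial>\<gamma>) / real d ^ k" by simp
    also have "\<dots> = fact (2 * k) / (2 ^ k * fact k) * s i x ^ k"
      unfolding ip_moment_even[OF \<open>k > 0\<close>] s_def by (simp add: power_divide)
    finally show "(\<integral>y. w i j (x(j := y)) ^ (2 * k) \<partial>\<gamma>) = fact (2 * k) / (2 ^ k * fact k) * s i x ^ k" .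
  qed
  finally show ?thesis by simp
qed

text \<open>The normal moments 3, 15 and 105 times the bounds 6, 489 and 488 for the moments of \<open>s i\<close>.\<close>

lemma w_moments:
  assumes "i \<in> V" "j \<in> V" "i \<noteq> j"
  shows "W.P.expectation (\<lambda>x. w i j x ^ 4) \<le> 18" "W.P.expectation (\<lambda>x. w i j x ^ 6) \<le> 7335"
    "W.P.expectation (\<lambda>x. w i j x ^ 8) \<le> 51240"
  using expectation_w_power[OF assms, of 2] expectation_w_power[OF assms, of 3] expectation_w_power[OF assms, of 4]
    s_moment2[OF assms(1)] s_moment3[OF assms(1)] s_moment4[OF assms(1)]
  by (simp_all add: fact_numeral)

lemma w2_centered_moment4:
  assumes "i \<in> V" "j \<in> V" "i \<noteq> j"
  shows "W.P.expectation (\<lambda>x. (w i j x ^ 2 - 1) ^ 4) \<le> 409928"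
proof -
  have "(t ^ 2 - 1) ^ 4 \<le> 8 * (t ^ 8 + 1)" for t :: real
  proof -
    have "(t ^ 2 - 1) ^ 2 \<le> 2 * ((t ^ 2) ^ 2 + 1)"
      using sum_squares_bound[of "- (t ^ 2)" 1] by (simp add: power2_diff)
    then have "(t ^ 2 - 1) ^ 2 \<le> 2 * (t ^ 4 + 1)" by (simp add: power_mult[symmetric])
    then have "((t ^ 2 - 1) ^ 2) ^ 2 \<le> (2 * (t ^ 4 + 1)) ^ 2" by (intro power_mono) auto
    also have "\<dots> \<le> 8 * ((t ^ 4) ^ 2 + 1)"
      using sum_squares_bound[of "t ^ 4" 1] by (simp add: power2_sum power_mult_distrib)
    finally show ?thesis by (simp add: power_mult[symmetric])
  qed
  then have "W.P.expectation (\<lambda>x. (w i j x ^ 2 - 1) ^ 4) \<le> W.P.expectation (\<lambda>x. 8 * (w i j x ^ 8 + 1))"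
    by (intro integral_mono intW amW assms)
  also have "\<dots> = 8 * (W.P.expectation (\<lambda>x. w i j x ^ 8) + 1)"
  proof -
    have "integrable \<Omega> (\<lambda>x. w i j x ^ 8)" by (intro intW amW assms)
    then show ?thesis by (simp add: W.P.prob_space)
  qed
  finally show ?thesis using w_moments(3)[OF assms] by simp
qed

lemma ignores_w: "v \<noteq> i \<Longrightarrow> v \<noteq> j \<Longrightarrow> w i j (x(v := y)) = w i j x"
  and ignores_s: "v \<noteq> i \<Longrightarrow> s i (x(v := y)) = s i x"
  by (simp_all add: w_def s_def)

section \<open>Conditional expectations of the Wishart summands\<close>

definition cycle_term :: "nat \<Rightarrow> nat \<Rightarrow> nat \<Rightarrow> nat \<Rightarrow> (nat \<Rightarrow> nat \<Rightarrow> real) \<Rightarrow> real" where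
  "cycle_term i j k l x = w i j x * w j k x * w k l x * w l i x"

text \<open>The average of a 4-cycle over one vertex. It is invariant under all permutations of its
three vertices, so it is irrelevant which vertex is averaged out next.\<close>

definition triangle_term :: "nat \<Rightarrow> nat \<Rightarrow> nat \<Rightarrow> (nat \<Rightarrow> nat \<Rightarrow> real) \<Rightarrow> real" where
  "triangle_term i j k x = w i j x * w j k x * w k i x / sqrt d"
definition path_term :: "nat \<Rightarrow> nat \<Rightarrow> nat \<Rightarrow> (nat \<Rightarrow> nat \<Rightarrow> real) \<Rightarrow> real" where
  "path_term i j k x = (w i j x ^ 2 - 1) * (w j k x ^ 2 - 1)"
definition edge_term :: "nat \<Rightarrow> nat \<Rightarrow> (nat \<Rightarrow> nat \<Rightarrow> real) \<Rightarrow> real" where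
  "edge_term i j x = w i j x ^ 4 - 6 * w i j x ^ 2 + 3"

lemma cycle_rotate: "cycle_term i j k l = cycle_term j k l i"
  by (auto simp: cycle_term_def)
lemma triangle_rotate: "triangle_term i j k = triangle_term j k i"
  by (auto simp: triangle_term_def)
lemma path_reverse: "path_term i j k = path_term k j i"
  by (auto simp: path_term_def w_commute[of k j] w_commute[of j i] mult.commute)
lemma edge_commute: "edge_term i j = edge_term j i"
  by (auto simp: edge_term_def w_commute[of i j])

lemma d_nonzero: "real d \<noteq> 0" "sqrt (real d) * sqrt (real d) = real d"
  using d_pos by simp_all

lemma integral_w_w:
  assumes "i \<noteq> v" "j \<noteq> v"
  shows "(\<integral>y. w i v (x(v := y)) * w j v (x(v := y)) \<partial>\<gamma>) = ip (x i) (x j) / d"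
proof -
  have "(\<integral>y. w i v (x(v := y)) * w j v (x(v := y)) \<partial>\<gamma>) = (\<integral>y. ip y (x i) * ip y (x j) / d \<partial>\<gamma>)"
    using assms d_nonzero by (simp add: w_def ip_commute[of "x _"])
  then show ?thesis by (simp add: ip_moment11)
qed

lemma integral_w2:
  assumes "i \<noteq> v" shows "(\<integral>y. w i v (x(v := y)) ^ 2 \<partial>\<gamma>) = s i x"
  using integral_w_w[OF assms assms, of x] by (simp add: power2_eq_square s_def)

lemma integral_w4:
  assumes "i \<noteq> v" shows "(\<integral>y. w i v (x(v := y)) ^ 4 \<partial>\<gamma>) = 3 * s i x ^ 2"
proof -
  have "(\<integral>y. w i v (x(v := y)) ^ 4 \<partial>\<gamma>) = (\<integral>y. ip y (x i) ^ 4 / d ^ 2 \<partial>\<gamma>)"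
    using assms d_nonzero by (simp add: w_def ip_commute[of "x _"] power_divide power4_eq_xxxx power2_eq_square)
  then show ?thesis by (simp add: ip_moment4 s_def power_divide)
qed

lemma integral_w2_w2:
  assumes "i \<noteq> v" "j \<noteq> v"
  shows "(\<integral>y. w i v (x(v := y)) ^ 2 * w j v (x(v := y)) ^ 2 \<partial>\<gamma>) = s i x * s j x + 2 * w i j x ^ 2 / d"
proof -
  have "(\<integral>y. w i v (x(v := y)) ^ 2 * w j v (x(v := y)) ^ 2 \<partial>\<gamma>) = (\<integral>y. ip y (x i) ^ 2 * ip y (x j) ^ 2 / d ^ 2 \<partial>\<gamma>)"
    using assms d_nonzero by (simp add: w_def ip_commute[of "x _"] power_divide power2_eq_square)
  also have "\<dots> = (ip (x i) (x i) * ip (x j) (x j) + 2 * ip (x i) (x j) ^ 2) / d ^ 2" by (simp add: ip_moment22)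
  also have "\<dots> = s i x * s j x + 2 * w i j x ^ 2 / d"
    using d_nonzero by (simp add: s_def w_def power_divide power2_eq_square add_divide_distrib)
  finally show ?thesis .
qed

lemma integral_s: "(\<integral>y. s v (x(v := y)) \<partial>\<gamma>) = 1"
  using sq_moment d_nonzero by (simp add: s_def)

lemma integral_s_w2:
  assumes "i \<noteq> v" shows "(\<integral>y. s v (x(v := y)) * w i v (x(v := y)) ^ 2 \<partial>\<gamma>) = s i x + 2 * s i x / d"
proof -
  have "(\<integral>y. s v (x(v := y)) * w i v (x(v := y)) ^ 2 \<partial>\<gamma>) = (\<integral>y. ip y y * ip y (x i) ^ 2 / d ^ 2 \<partial>\<gamma>)"
    using assms d_nonzero by (simp add: s_def w_def ip_commute[of "x _"] power_divide power2_eq_square)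
  also have "\<dots> = (real d + 2) * ip (x i) (x i) / d ^ 2" by (simp add: sq_moment_ip2)
  also have "\<dots> = s i x + 2 * s i x / d"
    using d_nonzero by (simp add: s_def power2_eq_square divide_simps algebra_simps)
  finally show ?thesis .
qed

lemma am_w_column: "i \<noteq> v \<Longrightarrow> all_moments \<gamma> (\<lambda>y. w i v (x(v := y)))"
  unfolding w_def ip_commute[of "(x(v := _)) i"] by (simp, intro am)

lemma am_s_column: "all_moments \<gamma> (\<lambda>y. s v (x(v := y)))"
  unfolding s_def by (simp, intro am)

lemma averages_to_cycle:
  assumes "i \<in> V" "j \<in> V" "k \<in> V" "l \<in> V" "distinct [i, j, k, l]"
  shows "W.averages_to {l} (cycle_term i j k l) (triangle_term i j k)"
proof (rule W.averages_to_step)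
  fix x
  have "(\<integral>y. cycle_term i j k l (x(l := y)) \<partial>\<gamma>) =
      (\<integral>y. (w i j x * w j k x) * (w k l (x(l := y)) * w i l (x(l := y))) \<partial>\<gamma>)"
    using assms(5) by (simp add: cycle_term_def ignores_w w_commute[of l i] mult.assoc)
  also have "\<dots> = (w i j x * w j k x) * (ip (x k) (x i) / d)"
    using assms(5) by (simp only: integral_mult_right_zero) (simp add: integral_w_w)
  also have "\<dots> = triangle_term i j k x"
    using d_nonzero by (simp add: triangle_term_def w_def)
  finally show "(\<integral>y. cycle_term i j k l (x(l := y)) \<partial>\<gamma>) = triangle_term i j k x" .
qed (use assms in \<open>auto intro!: amW simp: cycle_term_def[abs_def] triangle_term_def[abs_def]\<close>)

lemma averages_to_triangle:
  assumes "i \<in> V" "j \<in> V" "k \<in> V" "distinct [i, j, k]"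
  shows "W.averages_to {k} (triangle_term i j k) (\<lambda>x. w i j x ^ 2 / d)"
proof (rule W.averages_to_step)
  fix x
  have "(\<integral>y. triangle_term i j k (x(k := y)) \<partial>\<gamma>) =
      (\<integral>y. (w i j x / sqrt d) * (w j k (x(k := y)) * w i k (x(k := y))) \<partial>\<gamma>)"
    using assms(4) by (simp add: triangle_term_def ignores_w w_commute[of k i] mult.assoc)
  also have "\<dots> = (w i j x / sqrt d) * (ip (x j) (x i) / d)"
    using assms(4) by (simp only: integral_mult_right_zero) (simp add: integral_w_w)
  also have "\<dots> = w i j x ^ 2 / d"
    using d_nonzero by (simp add: w_def power2_eq_square ip_commute[of "x j"])
  finally show "(\<integral>y. triangle_term i j k (x(k := y)) \<partial>\<gamma>) = w i j x ^ 2 / d" .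
qed (use assms in \<open>auto intro!: amW simp: triangle_term_def[abs_def]\<close>)

lemma averages_to_w2:
  assumes "i \<in> V" "j \<in> V" "i \<noteq> j"
  shows "W.averages_to {j} (\<lambda>x. w i j x ^ 2 / d) (\<lambda>x. s i x / d)"
  by (rule W.averages_to_step) (use assms in \<open>auto intro!: amW simp: integral_w2\<close>)

lemma averages_to_s:
  assumes "i \<in> V" shows "W.averages_to {i} (\<lambda>x. c * s i x) (\<lambda>x. c)"
  by (rule W.averages_to_step) (use assms in \<open>auto intro!: amW simp: integral_s\<close>)

lemma averages_to_s_centered2:
  assumes "i \<in> V" shows "W.averages_to {i} (\<lambda>x. c * (s i x - 1) ^ 2) (\<lambda>x. c * (2 / d))"
proof (rule W.averages_to_step)
  fix x :: "nat \<Rightarrow> nat \<Rightarrow> real"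
  have "(\<integral>y. (s i (x(i := y)) - 1) ^ 2 \<partial>\<gamma>) = G.expectation (\<lambda>y. (ip y y / d - 1) ^ 2)"
    by (simp add: s_def)
  also have "\<dots> = W.P.expectation (\<lambda>x. (s i x - 1) ^ 2)"
    unfolding s_def using all_moments_measurable[OF all_moments_sq]
    by (intro expectation_column[OF assms, symmetric]) auto
  finally show "(\<integral>y. c * (s i (x(i := y)) - 1) ^ 2 \<partial>\<gamma>) = c * (2 / d)"
    using s_centered_moments(2)[OF assms] by simp
qed (use assms in \<open>auto intro!: amW\<close>)

text \<open>For 2-paths the order matters. Averaging out an endpoint leaves a factor \<open>s j - 1\<close> at the
center \<open>j\<close>, while averaging out the center leaves a term that correlates the two endpoints.\<close>

lemma averages_to_path_end:
  assumes "i \<in> V" "j \<in> V" "k \<in> V" "distinct [i, j, k]"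
  shows "W.averages_to {i} (path_term i j k) (\<lambda>x. (s j x - 1) * (w j k x ^ 2 - 1))"
proof (rule W.averages_to_step)
  fix x
  have int: "integrable \<gamma> (\<lambda>y. w j i (x(i := y)) ^ 2)"
    using assms(4) by (intro integrable_am am am_w_column) auto
  have "(\<integral>y. path_term i j k (x(i := y)) \<partial>\<gamma>) = (\<integral>y. (w j i (x(i := y)) ^ 2 - 1) * (w j k x ^ 2 - 1) \<partial>\<gamma>)"
    using assms(4) by (simp add: path_term_def ignores_w w_commute[of i j])
  also have "\<dots> = (s j x - 1) * (w j k x ^ 2 - 1)"
    using assms(4) int by (simp add: integral_w2 G.prob_space)
  finally show "(\<integral>y. path_term i j k (x(i := y)) \<partial>\<gamma>) = (s j x - 1) * (w j k x ^ 2 - 1)" .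
qed (use assms in \<open>auto intro!: amW simp: path_term_def[abs_def]\<close>)

lemma averages_to_path_center:
  assumes "i \<in> V" "j \<in> V" "k \<in> V" "distinct [i, j, k]"
  shows "W.averages_to {j} (path_term i j k) (\<lambda>x. (s i x - 1) * (s k x - 1) + 2 * w i k x ^ 2 / d)"
proof (rule W.averages_to_step)
  fix x
  let ?a = "\<lambda>y. w i j (x(j := y)) ^ 2" and ?b = "\<lambda>y. w k j (x(j := y)) ^ 2"
  have int: "integrable \<gamma> (\<lambda>y. ?a y * ?b y)" "integrable \<gamma> ?a" "integrable \<gamma> ?b"
    using assms(4) by (auto intro!: integrable_am am am_w_column)
  have "(\<integral>y. path_term i j k (x(j := y)) \<partial>\<gamma>) = (\<integral>y. ?a y * ?b y - ?a y - ?b y + 1 \<partial>\<gamma>)"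
    by (simp add: path_term_def w_commute[of j k] algebra_simps)
  also have "\<dots> = (s i x * s k x + 2 * w i k x ^ 2 / d) - s i x - s k x + 1"
    using int assms(4) by (simp add: integral_w2 integral_w2_w2 G.prob_space)
  finally show "(\<integral>y. path_term i j k (x(j := y)) \<partial>\<gamma>) = (s i x - 1) * (s k x - 1) + 2 * w i k x ^ 2 / d"
    by (simp add: algebra_simps)
qed (use assms in \<open>auto intro!: amW simp: path_term_def[abs_def]\<close>)

lemma averages_to_half_path_end:
  assumes "j \<in> V" "k \<in> V" "j \<noteq> k"
  shows "W.averages_to {k} (\<lambda>x. (s j x - 1) * (w j k x ^ 2 - 1)) (\<lambda>x. 1 * (s j x - 1) ^ 2)"
proof (rule W.averages_to_step)
  fix x
  have int: "integrable \<gamma> (\<lambda>y. w j k (x(k := y)) ^ 2)"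
    using assms(3) by (intro integrable_am am am_w_column)
  show "(\<integral>y. (s j (x(k := y)) - 1) * (w j k (x(k := y)) ^ 2 - 1) \<partial>\<gamma>) = 1 * (s j x - 1) ^ 2"
    using assms(3) int by (simp add: ignores_s integral_w2 G.prob_space) (simp add: power2_eq_square)
qed (use assms in \<open>auto intro!: amW\<close>)

lemma averages_to_half_path_center:
  assumes "j \<in> V" "k \<in> V" "j \<noteq> k"
  shows "W.averages_to {j} (\<lambda>x. (s j x - 1) * (w j k x ^ 2 - 1)) (\<lambda>x. (2 / d) * s k x)"
proof (rule W.averages_to_step)
  fix x
  let ?a = "\<lambda>y. s j (x(j := y))" and ?b = "\<lambda>y. w k j (x(j := y)) ^ 2"
  have int: "integrable \<gamma> (\<lambda>y. ?a y * ?b y)" "integrable \<gamma> ?a" "integrable \<gamma> ?b"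
    using assms(3) by (auto intro!: integrable_am am am_w_column am_s_column)
  have "(\<integral>y. (s j (x(j := y)) - 1) * (w j k (x(j := y)) ^ 2 - 1) \<partial>\<gamma>) = (\<integral>y. ?a y * ?b y - ?a y - ?b y + 1 \<partial>\<gamma>)"
    by (simp add: w_commute[of j k] algebra_simps)
  also have "\<dots> = (s k x + 2 * s k x / d) - 1 - s k x + 1"
    using int assms(3) by (simp add: integral_w2 integral_s integral_s_w2 G.prob_space)
  finally show "(\<integral>y. (s j (x(j := y)) - 1) * (w j k (x(j := y)) ^ 2 - 1) \<partial>\<gamma>) = (2 / d) * s k x"
    by simp
qed (use assms in \<open>auto intro!: amW\<close>)

lemma averages_to_end_pair:
  assumes "i \<in> V" "k \<in> V" "i \<noteq> k"
  shows "W.averages_to {k} (\<lambda>x. (s i x - 1) * (s k x - 1) + 2 * w i k x ^ 2 / d) (\<lambda>x. (2 / d) * s i x)"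
proof (rule W.averages_to_step)
  fix x
  have int: "integrable \<gamma> (\<lambda>y. s k (x(k := y)))" "integrable \<gamma> (\<lambda>y. w i k (x(k := y)) ^ 2)"
    using assms(3) by (auto intro!: integrable_am am am_w_column am_s_column)
  show "(\<integral>y. (s i (x(k := y)) - 1) * (s k (x(k := y)) - 1) + 2 * w i k (x(k := y)) ^ 2 / d \<partial>\<gamma>) = (2 / d) * s i x"
    using assms(3) int by (simp add: ignores_s integral_w2 integral_s G.prob_space)
qed (use assms in \<open>auto intro!: amW\<close>)

lemma averages_to_edge:
  assumes "i \<in> V" "j \<in> V" "i \<noteq> j"
  shows "W.averages_to {j} (edge_term i j) (\<lambda>x. 3 * (s i x - 1) ^ 2)"
proof (rule W.averages_to_step)
  fix x
  have int: "integrable \<gamma> (\<lambda>y. w i j (x(j := y)) ^ 4)" "integrable \<gamma> (\<lambda>y. w i j (x(j := y)) ^ 2)"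
    using assms(3) by (auto intro!: integrable_am am am_w_column)
  show "(\<integral>y. edge_term i j (x(j := y)) \<partial>\<gamma>) = 3 * (s i x - 1) ^ 2"
    unfolding edge_term_def using assms(3) int
    by (simp add: integral_w2 integral_w4 G.prob_space) (simp add: power2_eq_square algebra_simps)
qed (use assms in \<open>auto intro!: amW simp: edge_term_def[abs_def]\<close>)

end

section \<open>Second moments of the conditional expectations\<close>

text \<open>Products are replaced by sums of powers of single factors, whose moments are known.\<close>

lemma square_mult_le: "(a * b) ^ 2 \<le> a ^ 4 + b ^ 4" for a b :: real
proof -
  have "2 * (a * b) ^ 2 \<le> a ^ 4 + b ^ 4"
    using sum_squares_bound[of "a ^ 2" "b ^ 2"] by (simp add: power_mult_distrib power_mult[symmetric])
  moreover have "0 \<le> (a * b) ^ 2" by simp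
  ultimately show ?thesis by linarith
qed

lemma square_mult3_le: "(a * b * c) ^ 2 \<le> a ^ 6 + b ^ 6 + c ^ 6" for a b c :: real
proof -
  define m where "m = max (a ^ 2) (max (b ^ 2) (c ^ 2))"
  have m: "a ^ 2 \<le> m" "b ^ 2 \<le> m" "c ^ 2 \<le> m" "m = a ^ 2 \<or> m = b ^ 2 \<or> m = c ^ 2"
    by (auto simp: m_def max_def)
  have m0: "0 \<le> m" using m(1) zero_le_power2[of a] by linarith
  have "(a * b * c) ^ 2 = a ^ 2 * b ^ 2 * c ^ 2" by (simp add: power_mult_distrib)
  also have "\<dots> \<le> m * m * m" using m m0 by (intro mult_mono) auto
  also have "\<dots> = m ^ 3" by (simp add: power3_eq_cube)
  also have "\<dots> \<le> (a ^ 2) ^ 3 + (b ^ 2) ^ 3 + (c ^ 2) ^ 3"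
    using m(4) by (elim disjE) simp_all
  also have "\<dots> = a ^ 6 + b ^ 6 + c ^ 6" by (simp add: power_mult[symmetric])
  finally show ?thesis .
qed

lemma square_mult4_le: "(a * b * c * e) ^ 2 \<le> a ^ 8 + b ^ 8 + c ^ 8 + e ^ 8" for a b c e :: real
proof -
  have 4: "(x * y) ^ 4 \<le> x ^ 8 + y ^ 8" for x y :: real
    using square_mult_le[of "x ^ 2" "y ^ 2"] by (simp add: power_mult_distrib power_mult[symmetric])
  have "(a * b * c * e) ^ 2 \<le> (a * b) ^ 4 + (c * e) ^ 4"
    using square_mult_le[of "a * b" "c * e"] by (simp add: mult.assoc)
  then show ?thesis using 4[of a b] 4[of c e] by linarith
qed

text \<open>The fourth Hermite polynomial, which is the summand of an edge.\<close>

lemma hermite4_square_le: "(a ^ 4 - 6 * a ^ 2 + 3) ^ 2 \<le> 3 * a ^ 8 + 108 * a ^ 4 + 27" for a :: real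
proof -
  have sq: "(x + y + z) ^ 2 \<le> 3 * x ^ 2 + 3 * y ^ 2 + 3 * z ^ 2" for x y z :: real
    using sum_squares_bound[of x y] sum_squares_bound[of x z] sum_squares_bound[of y z]
    by (simp add: power2_sum algebra_simps)
  show ?thesis using sq[of "a ^ 4" "- 6 * a ^ 2" 3]
    by (simp add: power_mult_distrib power_mult[symmetric])
qed

context wishart
begin

text \<open>The common bound for the second moment of the conditional expectation of a summand with \<open>m\<close>
vertices given \<open>p\<close> of them. The factor \<open>1/d\<close> instead of \<open>1/d\<^sup>2\<close> is needed only if one vertex is
averaged out and at least two are left. The constant \<open>10\<^sup>6\<close> exceeds all explicit constants below.\<close>

definition moment_bound :: "nat \<Rightarrow> nat \<Rightarrow> real" where
  "moment_bound m p = (if p = m then 10 ^ 6 else if Suc p = m \<and> p \<ge> 2 then 10 ^ 6 / d else 10 ^ 6 / d ^ 2)"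

lemma d_bounds: "real d ^ 2 \<ge> real d" "real d ^ 2 \<ge> 1" "real d > 0"
  using d_ge_1 power_increasing[of 1 2 "real d"] one_le_power[of "real d" 2] by simp_all

lemma moment_bound_lower: "10 ^ 6 / d ^ 2 \<le> moment_bound m p"
proof -
  have "10 ^ 6 / real d ^ 2 \<le> 10 ^ 6 / real d" using d_bounds by (intro divide_left_mono) auto
  moreover have "10 ^ 6 / real d ^ 2 \<le> 10 ^ 6 / 1" using d_bounds by (intro divide_left_mono) auto
  ultimately show ?thesis by (simp add: moment_bound_def)
qed

lemma le_moment_bound: "c \<le> 10 ^ 6 / d ^ 2 \<Longrightarrow> c \<le> moment_bound m p"
  using moment_bound_lower order_trans by blast

lemma scaled_le: "c \<le> 10 ^ 6 \<Longrightarrow> c / d ^ 2 \<le> 10 ^ 6 / d ^ 2"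
  by (simp add: divide_right_mono)

lemma reduces_const': assumes "\<bar>c\<bar> \<le> 10 / d" shows "W.reduces (moment_bound m) c {} (\<lambda>_. c) {}"
proof (rule W.reduces_const)
  have "c ^ 2 \<le> (10 / real d) ^ 2" using power_mono[OF assms, of 2] by simp
  also have "\<dots> = 100 / d ^ 2" by (simp add: power_divide)
  finally show "c ^ 2 \<le> moment_bound m 0" using scaled_le[of 100] by (intro le_moment_bound) simp
qed

text \<open>From here on the subset \<open>J\<close> of kept vertices is arbitrary. If it is the whole vertex set,
the second moment is bounded directly; otherwise some vertex is missing from \<open>J\<close> and is averaged
out, after a rotation or reflection of the summand if necessary.\<close>

lemma reduces_s:
  assumes "i \<in> V" "J \<subseteq> {i}" "\<bar>c\<bar> \<le> 10 / d"
  shows "W.reduces (moment_bound m) c {i} (\<lambda>x. c * s i x) J"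
proof (cases "J = {}")
  case True
  then show ?thesis using W.reduces_step[OF averages_to_s[OF assms(1)] reduces_const'[OF assms(3), of m]] by simp
next
  case False
  then have J: "J = {i}" using assms(2) by blast
  show ?thesis unfolding J
  proof (rule W.reduces_self)
    show "all_moments \<Omega> (\<lambda>x. c * s i x)" by (intro amW assms(1))
    have "W.P.expectation (\<lambda>x. (c * s i x) ^ 2) = c ^ 2 * W.P.expectation (\<lambda>x. s i x ^ 2)"
      by (simp add: power_mult_distrib)
    also have "\<dots> \<le> (10 / real d) ^ 2 * 6"
      using power_mono[OF assms(3), of 2] s_moment2[OF assms(1)] by (intro mult_mono) auto
    also have "\<dots> = 600 / d ^ 2" by (simp add: power_divide)
    finally show "W.P.expectation (\<lambda>x. (c * s i x) ^ 2) \<le> moment_bound m (card {i})"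
      using scaled_le[of 600] by (intro le_moment_bound) simp
  qed (simp_all add: ignores_def ignores_s)
qed

lemma reduces_s_centered2:
  assumes "i \<in> V" "J \<subseteq> {i}" "\<bar>c\<bar> \<le> 3"
  shows "W.reduces (moment_bound m) (c * (2 / d)) {i} (\<lambda>x. c * (s i x - 1) ^ 2) J"
proof (cases "J = {}")
  case True
  have "\<bar>c * (2 / d)\<bar> \<le> 10 / d" using assms(3) d_bounds(3) by (simp add: abs_mult divide_simps)
  then show ?thesis using True W.reduces_step[OF averages_to_s_centered2[OF assms(1)] reduces_const'[of "c * (2 / d)" m]] by simp
next
  case False
  then have J: "J = {i}" using assms(2) by blast
  show ?thesis unfolding J
  proof (rule W.reduces_self)
    show "all_moments \<Omega> (\<lambda>x. c * (s i x - 1) ^ 2)" by (intro amW assms(1))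
    have "W.P.expectation (\<lambda>x. (c * (s i x - 1) ^ 2) ^ 2) = c ^ 2 * W.P.expectation (\<lambda>x. (s i x - 1) ^ 4)"
      by (simp add: power_mult_distrib power_mult[symmetric])
    also have "\<dots> \<le> 3 ^ 2 * (60 / d ^ 2)"
      using power_mono[OF assms(3), of 2] s_centered_moments(3)[OF assms(1)] by (intro mult_mono) auto
    also have "\<dots> = 540 / d ^ 2" by simp
    finally show "W.P.expectation (\<lambda>x. (c * (s i x - 1) ^ 2) ^ 2) \<le> moment_bound m (card {i})"
      using scaled_le[of 540] by (intro le_moment_bound) simp
  qed (simp_all add: ignores_def ignores_s)
qed

lemma reduces_w2:
  assumes "i \<in> V" "j \<in> V" "i \<noteq> j" "J \<subseteq> {i, j}"
  shows "W.reduces (moment_bound 4) (1 / d) {i, j} (\<lambda>x. w i j x ^ 2 / d) J"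
proof -
  have 1: "W.reduces (moment_bound 4) (1 / d) {a, b} (\<lambda>x. w a b x ^ 2 / d) J"
    if "a \<in> V" "b \<in> V" "a \<noteq> b" "J \<subseteq> {a, b}" "b \<notin> J" for a b
  proof -
    have "W.reduces (moment_bound 4) (1 / d) {a} (\<lambda>x. s a x / d) J"
      using reduces_s[of a J "1 / d" 4] that d_bounds by (auto simp: divide_right_mono)
    from W.reduces_step[OF averages_to_w2[OF that(1-3)] this that(5)] show ?thesis by (simp add: insert_commute)
  qed
  show ?thesis
  proof (cases "J = {i, j}")
    case True
    show ?thesis unfolding True
    proof (rule W.reduces_self)
      have "W.P.expectation (\<lambda>x. (w i j x ^ 2 / d) ^ 2) = W.P.expectation (\<lambda>x. w i j x ^ 4) / d ^ 2"
        by (simp add: power_divide power_mult[symmetric])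
      also have "\<dots> \<le> 18 / d ^ 2" using w_moments(1)[OF assms(1-3)] by (intro divide_right_mono) auto
      finally show "W.P.expectation (\<lambda>x. (w i j x ^ 2 / d) ^ 2) \<le> moment_bound 4 (card {i, j})"
        using scaled_le[of 18] by (intro le_moment_bound) simp
    qed (auto intro!: amW simp: assms ignores_def ignores_w)
  next
    case False
    then have "i \<notin> J \<or> j \<notin> J" using assms(4) by blast
    then show ?thesis
      using 1[of i j] 1[of j i] assms by (auto simp: w_commute[of j i] insert_commute)
  qed
qed

lemma reduces_triangle:
  assumes "i \<in> V" "j \<in> V" "k \<in> V" "distinct [i, j, k]" "J \<subseteq> {i, j, k}"
  shows "W.reduces (moment_bound 4) (1 / d) {i, j, k} (triangle_term i j k) J"
proof -
  have 1: "W.reduces (moment_bound 4) (1 / d) {a, b, c} (triangle_term a b c) J"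
    if "a \<in> V" "b \<in> V" "c \<in> V" "distinct [a, b, c]" "J \<subseteq> {a, b, c}" "c \<notin> J" for a b c
  proof -
    have "J \<subseteq> {a, b}" using that by blast
    with that have "W.reduces (moment_bound 4) (1 / d) {a, b} (\<lambda>x. w a b x ^ 2 / d) J" by (intro reduces_w2) auto
    from W.reduces_step[OF averages_to_triangle[OF that(1-4)] this that(6)] show ?thesis by (simp add: insert_commute)
  qed
  have e: "{j, k, i} = {i, j, k}" "{k, i, j} = {i, j, k}" by auto
  show ?thesis
  proof (cases "J = {i, j, k}")
    case True
    show ?thesis unfolding True
    proof (rule W.reduces_self)
      let ?a = "w i j" and ?b = "w j k" and ?c = "w k i"
      have int: "integrable \<Omega> (\<lambda>x. ?a x ^ 6)" "integrable \<Omega> (\<lambda>x. ?b x ^ 6)" "integrable \<Omega> (\<lambda>x. ?c x ^ 6)"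
        by (intro intW amW assms)+
      have "W.P.expectation (\<lambda>x. (?a x * ?b x * ?c x) ^ 2) \<le> W.P.expectation (\<lambda>x. ?a x ^ 6 + ?b x ^ 6 + ?c x ^ 6)"
        by (intro integral_mono square_mult3_le intW amW assms)
      also have "\<dots> = W.P.expectation (\<lambda>x. ?a x ^ 6) + W.P.expectation (\<lambda>x. ?b x ^ 6) + W.P.expectation (\<lambda>x. ?c x ^ 6)"
        using int by simp
      also have "\<dots> \<le> 7335 + 7335 + 7335"
        using assms by (intro add_mono w_moments(2)) auto
      finally have 6: "W.P.expectation (\<lambda>x. (?a x * ?b x * ?c x) ^ 2) \<le> 10 ^ 6" by simp
      have "W.P.expectation (\<lambda>x. triangle_term i j k x ^ 2) = W.P.expectation (\<lambda>x. (?a x * ?b x * ?c x) ^ 2) / d"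
        using d_bounds by (simp add: triangle_term_def power_divide)
      also have "\<dots> \<le> 10 ^ 6 / d" using 6 d_bounds(3) by (intro divide_right_mono) simp_all
      finally have "W.P.expectation (\<lambda>x. triangle_term i j k x ^ 2) \<le> 10 ^ 6 / d" .
      then show "W.P.expectation (\<lambda>x. triangle_term i j k x ^ 2) \<le> moment_bound 4 (card {i, j, k})"
        using assms(4) by (simp add: moment_bound_def)
    qed (auto intro!: amW simp: assms ignores_def ignores_w triangle_term_def[abs_def])
  next
    case False
    then have "i \<notin> J \<or> j \<notin> J \<or> k \<notin> J" using assms(5) by blast
    then show ?thesis
    proof (elim disjE)
      assume "k \<notin> J" then show ?thesis using 1 assms by simp
    next
      assume "i \<notin> J"
      then have "W.reduces (moment_bound 4) (1 / d) {j, k, i} (triangle_term j k i) J" using assms by (intro 1) auto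
      then show ?thesis by (simp only: e triangle_rotate[of i j k])
    next
      assume "j \<notin> J"
      then have "W.reduces (moment_bound 4) (1 / d) {k, i, j} (triangle_term k i j) J" using assms by (intro 1) auto
      then show ?thesis by (simp only: e triangle_rotate[of k i j])
    qed
  qed
qed

lemma reduces_cycle:
  assumes "i \<in> V" "j \<in> V" "k \<in> V" "l \<in> V" "distinct [i, j, k, l]" "J \<subseteq> {i, j, k, l}"
  shows "W.reduces (moment_bound 4) (1 / d) {i, j, k, l} (cycle_term i j k l) J"
proof -
  have 1: "W.reduces (moment_bound 4) (1 / d) {a, b, c, e} (cycle_term a b c e) J"
    if "a \<in> V" "b \<in> V" "c \<in> V" "e \<in> V" "distinct [a, b, c, e]" "J \<subseteq> {a, b, c, e}" "e \<notin> J" for a b c e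
  proof -
    have "J \<subseteq> {a, b, c}" using that by blast
    with that have "W.reduces (moment_bound 4) (1 / d) {a, b, c} (triangle_term a b c) J" by (intro reduces_triangle) auto
    from W.reduces_step[OF averages_to_cycle[OF that(1-5)] this that(7)] show ?thesis by (simp add: insert_commute)
  qed
  have e: "{j, k, l, i} = {i, j, k, l}" "{k, l, i, j} = {i, j, k, l}" "{l, i, j, k} = {i, j, k, l}" by auto
  show ?thesis
  proof (cases "J = {i, j, k, l}")
    case True
    show ?thesis unfolding True
    proof (rule W.reduces_self)
      let ?a = "w i j" and ?b = "w j k" and ?c = "w k l" and ?e = "w l i"
      have int: "integrable \<Omega> (\<lambda>x. ?a x ^ 8)" "integrable \<Omega> (\<lambda>x. ?b x ^ 8)" "integrable \<Omega> (\<lambda>x. ?c x ^ 8)" "integrable \<Omega> (\<lambda>x. ?e x ^ 8)"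
        by (intro intW amW assms)+
      have "W.P.expectation (\<lambda>x. cycle_term i j k l x ^ 2) \<le> W.P.expectation (\<lambda>x. ?a x ^ 8 + ?b x ^ 8 + ?c x ^ 8 + ?e x ^ 8)"
        unfolding cycle_term_def by (intro integral_mono square_mult4_le intW amW assms)
      also have "\<dots> = W.P.expectation (\<lambda>x. ?a x ^ 8) + W.P.expectation (\<lambda>x. ?b x ^ 8) + W.P.expectation (\<lambda>x. ?c x ^ 8) + W.P.expectation (\<lambda>x. ?e x ^ 8)"
        using int by simp
      also have "\<dots> \<le> 51240 + 51240 + 51240 + 51240"
        using assms by (intro add_mono w_moments(3)) auto
      finally show "W.P.expectation (\<lambda>x. cycle_term i j k l x ^ 2) \<le> moment_bound 4 (card {i, j, k, l})"
        using assms(5) by (simp add: moment_bound_def)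
    qed (auto intro!: amW simp: assms ignores_def ignores_w cycle_term_def[abs_def])
  next
    case False
    then have "i \<notin> J \<or> j \<notin> J \<or> k \<notin> J \<or> l \<notin> J" using assms(6) by blast
    then show ?thesis
    proof (elim disjE)
      assume "l \<notin> J" then show ?thesis using 1 assms by simp
    next
      assume "i \<notin> J"
      then have "W.reduces (moment_bound 4) (1 / d) {j, k, l, i} (cycle_term j k l i) J" using assms by (intro 1) auto
      then show ?thesis by (simp only: e cycle_rotate[of i j k l])
    next
      assume "j \<notin> J"
      then have "W.reduces (moment_bound 4) (1 / d) {k, l, i, j} (cycle_term k l i j) J" using assms by (intro 1) auto
      then show ?thesis by (simp only: e cycle_rotate[of k l i j] cycle_rotate[of l i j k])
    next
      assume "k \<notin> J"
      then have "W.reduces (moment_bound 4) (1 / d) {l, i, j, k} (cycle_term l i j k) J" using assms by (intro 1) auto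
      then show ?thesis by (simp only: e cycle_rotate[of l i j k])
    qed
  qed
qed

text \<open>The second moment is of order \<open>1/d\<close> although \<open>s j - 1\<close> and \<open>w j k\<close> are dependent: the
weights in \<open>2 p q \<le> d p\<^sup>2 + q\<^sup>2 / d\<close> are chosen to balance the fourth moment of \<open>s j - 1\<close>, which is
of order \<open>1/d\<^sup>2\<close>, against that of \<open>w j k ^ 2 - 1\<close>, which is of order 1.\<close>

lemma reduces_half_path:
  assumes "j \<in> V" "k \<in> V" "j \<noteq> k" "J \<subseteq> {j, k}"
  shows "W.reduces (moment_bound 3) (2 / d) {j, k} (\<lambda>x. (s j x - 1) * (w j k x ^ 2 - 1)) J"
proof -
  consider "J = {j, k}" | "k \<notin> J" "J \<subseteq> {j}" | "j \<notin> J" "J \<subseteq> {k}" using assms(4) by blast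
  then show ?thesis
  proof cases
    case 1
    show ?thesis unfolding 1
    proof (rule W.reduces_self)
      have am: "(a * b) ^ 2 \<le> d * a ^ 4 + b ^ 4 / d" for a b :: real
      proof -
        have "2 * (sqrt d * a ^ 2) * (b ^ 2 / sqrt d) \<le> (sqrt d * a ^ 2) ^ 2 + (b ^ 2 / sqrt d) ^ 2"
          by (rule sum_squares_bound)
        moreover have "(sqrt d * a ^ 2) * (b ^ 2 / sqrt d) = (a * b) ^ 2"
          using d_bounds(3) by (simp add: power_mult_distrib)
        moreover have "(sqrt d * a ^ 2) ^ 2 + (b ^ 2 / sqrt d) ^ 2 = d * a ^ 4 + b ^ 4 / d"
          using d_bounds(3) by (simp add: power_mult_distrib power_divide power_mult[symmetric])
        moreover have "0 \<le> (a * b) ^ 2" by simp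
        ultimately show ?thesis by linarith
      qed
      have int: "integrable \<Omega> (\<lambda>x. (s j x - 1) ^ 4)" "integrable \<Omega> (\<lambda>x. (w j k x ^ 2 - 1) ^ 4)"
        by (intro intW amW assms)+
      have "W.P.expectation (\<lambda>x. ((s j x - 1) * (w j k x ^ 2 - 1)) ^ 2)
          \<le> W.P.expectation (\<lambda>x. d * (s j x - 1) ^ 4 + (w j k x ^ 2 - 1) ^ 4 / d)"
        by (intro integral_mono am intW amW assms)
      also have "\<dots> = d * W.P.expectation (\<lambda>x. (s j x - 1) ^ 4) + W.P.expectation (\<lambda>x. (w j k x ^ 2 - 1) ^ 4) / d"
        using int by simp
      also have "\<dots> \<le> d * (60 / d ^ 2) + 409928 / d"
        using s_centered_moments(3)[OF assms(1)] w2_centered_moment4[OF assms(1-3)]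
        by (intro add_mono mult_left_mono divide_right_mono) auto
      also have "\<dots> = 409988 / d" using d_bounds(3) by (simp add: power2_eq_square divide_simps)
      also have "\<dots> \<le> 10 ^ 6 / d" using d_bounds(3) by (intro divide_right_mono) auto
      finally show "W.P.expectation (\<lambda>x. ((s j x - 1) * (w j k x ^ 2 - 1)) ^ 2) \<le> moment_bound 3 (card {j, k})"
        using assms(3) by (simp add: moment_bound_def)
    qed (auto intro!: amW simp: assms ignores_def ignores_w ignores_s)
  next
    case 2
    have "W.reduces (moment_bound 3) (1 * (2 / d)) {j} (\<lambda>x. 1 * (s j x - 1) ^ 2) J"
      using 2 assms by (intro reduces_s_centered2) auto
    from W.reduces_step[OF averages_to_half_path_end[OF assms(1-3)] this 2(1)] show ?thesis by (simp add: insert_commute)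
  next
    case 3
    have "W.reduces (moment_bound 3) (2 / d) {k} (\<lambda>x. (2 / d) * s k x) J"
      using 3 assms d_bounds(3) by (intro reduces_s) (auto simp: divide_right_mono)
    from W.reduces_step[OF averages_to_half_path_center[OF assms(1-3)] this 3(1)] show ?thesis by simp
  qed
qed

lemma reduces_end_pair:
  assumes "i \<in> V" "k \<in> V" "i \<noteq> k" "J \<subseteq> {i, k}"
  shows "W.reduces (moment_bound 3) (2 / d) {i, k} (\<lambda>x. (s i x - 1) * (s k x - 1) + 2 * w i k x ^ 2 / d) J"
proof -
  have 1: "W.reduces (moment_bound 3) (2 / d) {a, b} (\<lambda>x. (s a x - 1) * (s b x - 1) + 2 * w a b x ^ 2 / d) J"
    if "a \<in> V" "b \<in> V" "a \<noteq> b" "J \<subseteq> {a, b}" "b \<notin> J" for a b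
  proof -
    have "W.reduces (moment_bound 3) (2 / d) {a} (\<lambda>x. (2 / d) * s a x) J"
      using that d_bounds(3) by (intro reduces_s) (auto simp: divide_right_mono)
    from W.reduces_step[OF averages_to_end_pair[OF that(1-3)] this that(5)] show ?thesis by (simp add: insert_commute)
  qed
  show ?thesis
  proof (cases "J = {i, k}")
    case True
    show ?thesis unfolding True
    proof (rule W.reduces_self)
      have am: "(a * b + 2 * c ^ 2 / d) ^ 2 \<le> a ^ 4 + b ^ 4 + 8 * c ^ 4 / d ^ 2" for a b c :: real
      proof -
        have "(a * b + 2 * c ^ 2 / d) ^ 2 \<le> 2 * (a * b) ^ 2 + 2 * (2 * c ^ 2 / d) ^ 2"
          using sum_squares_bound[of "a * b" "2 * c ^ 2 / d"] by (simp add: power2_sum)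
        also have "2 * (a * b) ^ 2 \<le> a ^ 4 + b ^ 4"
          using sum_squares_bound[of "a ^ 2" "b ^ 2"] by (simp add: power_mult_distrib power_mult[symmetric])
        also have "2 * (2 * c ^ 2 / d) ^ 2 = 8 * c ^ 4 / d ^ 2"
          by (simp add: power_mult_distrib power_divide power_mult[symmetric])
        finally show ?thesis by simp
      qed
      have int: "integrable \<Omega> (\<lambda>x. (s i x - 1) ^ 4)" "integrable \<Omega> (\<lambda>x. (s k x - 1) ^ 4)" "integrable \<Omega> (\<lambda>x. w i k x ^ 4)"
        by (intro intW amW assms)+
      have "W.P.expectation (\<lambda>x. ((s i x - 1) * (s k x - 1) + 2 * w i k x ^ 2 / d) ^ 2)
          \<le> W.P.expectation (\<lambda>x. (s i x - 1) ^ 4 + (s k x - 1) ^ 4 + 8 * w i k x ^ 4 / d ^ 2)"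
        by (intro integral_mono am intW amW assms)
      also have "\<dots> = W.P.expectation (\<lambda>x. (s i x - 1) ^ 4) + W.P.expectation (\<lambda>x. (s k x - 1) ^ 4)
          + 8 * W.P.expectation (\<lambda>x. w i k x ^ 4) / d ^ 2"
        using int by simp
      also have "\<dots> \<le> 60 / d ^ 2 + 60 / d ^ 2 + 8 * 18 / d ^ 2"
        using s_centered_moments(3)[OF assms(1)] s_centered_moments(3)[OF assms(2)] w_moments(1)[OF assms(1-3)]
        by (intro add_mono mult_left_mono divide_right_mono) auto
      also have "\<dots> = 264 / d ^ 2" by (simp add: add_divide_distrib[symmetric])
      finally show "W.P.expectation (\<lambda>x. ((s i x - 1) * (s k x - 1) + 2 * w i k x ^ 2 / d) ^ 2) \<le> moment_bound 3 (card {i, k})"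
        using scaled_le[of 264] by (intro le_moment_bound) simp
    qed (auto intro!: amW simp: assms ignores_def ignores_w ignores_s)
  next
    case False
    then have "i \<notin> J \<or> k \<notin> J" using assms(4) by blast
    then show ?thesis
      using 1[of i k] 1[of k i] assms by (auto simp: w_commute[of k i] insert_commute mult.commute)
  qed
qed

lemma reduces_path:
  assumes "i \<in> V" "j \<in> V" "k \<in> V" "distinct [i, j, k]" "J \<subseteq> {i, j, k}"
  shows "W.reduces (moment_bound 3) (2 / d) {i, j, k} (path_term i j k) J"
proof -
  have 1: "W.reduces (moment_bound 3) (2 / d) {a, b, c} (path_term a b c) J"
    if "a \<in> V" "b \<in> V" "c \<in> V" "distinct [a, b, c]" "J \<subseteq> {a, b, c}" "a \<notin> J" for a b c
  proof -
    have "J \<subseteq> {b, c}" using that by blast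
    with that have "W.reduces (moment_bound 3) (2 / d) {b, c} (\<lambda>x. (s b x - 1) * (w b c x ^ 2 - 1)) J"
      by (intro reduces_half_path) auto
    from W.reduces_step[OF averages_to_path_end[OF that(1-4)] this that(6)] show ?thesis .
  qed
  consider "J = {i, j, k}" | "i \<notin> J" | "k \<notin> J" | "j \<notin> J" "J \<subseteq> {i, k}" using assms(5) by blast
  then show ?thesis
  proof cases
    case 1
    show ?thesis unfolding 1
    proof (rule W.reduces_self)
      have int: "integrable \<Omega> (\<lambda>x. (w i j x ^ 2 - 1) ^ 4)" "integrable \<Omega> (\<lambda>x. (w j k x ^ 2 - 1) ^ 4)"
        by (intro intW amW assms)+
      have "W.P.expectation (\<lambda>x. path_term i j k x ^ 2)
          \<le> W.P.expectation (\<lambda>x. (w i j x ^ 2 - 1) ^ 4 + (w j k x ^ 2 - 1) ^ 4)"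
        unfolding path_term_def by (intro integral_mono square_mult_le intW amW assms)
      also have "\<dots> = W.P.expectation (\<lambda>x. (w i j x ^ 2 - 1) ^ 4) + W.P.expectation (\<lambda>x. (w j k x ^ 2 - 1) ^ 4)"
        using int by simp
      also have "\<dots> \<le> 409928 + 409928"
        using assms by (intro add_mono w2_centered_moment4) auto
      finally show "W.P.expectation (\<lambda>x. path_term i j k x ^ 2) \<le> moment_bound 3 (card {i, j, k})"
        using assms(4) by (simp add: moment_bound_def)
    qed (auto intro!: amW simp: assms ignores_def ignores_w path_term_def[abs_def])
  next
    case 2
    then show ?thesis using 1 assms by blast
  next
    case 3
    then have "W.reduces (moment_bound 3) (2 / d) {k, j, i} (path_term k j i) J" using assms by (intro 1) auto
    moreover have "{k, j, i} = {i, j, k}" by auto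
    ultimately show ?thesis using path_reverse[of i j k] by simp
  next
    case 4
    have "W.reduces (moment_bound 3) (2 / d) {i, k} (\<lambda>x. (s i x - 1) * (s k x - 1) + 2 * w i k x ^ 2 / d) J"
      using 4 assms by (intro reduces_end_pair) auto
    from W.reduces_step[OF averages_to_path_center[OF assms(1-4)] this 4(1)] show ?thesis by (simp add: insert_commute)
  qed
qed

lemma reduces_edge:
  assumes "i \<in> V" "j \<in> V" "i \<noteq> j" "J \<subseteq> {i, j}"
  shows "W.reduces (moment_bound 2) (6 / d) {i, j} (edge_term i j) J"
proof -
  have 1: "W.reduces (moment_bound 2) (6 / d) {a, b} (edge_term a b) J"
    if "a \<in> V" "b \<in> V" "a \<noteq> b" "J \<subseteq> {a, b}" "b \<notin> J" for a b
  proof -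
    have "W.reduces (moment_bound 2) (3 * (2 / d)) {a} (\<lambda>x. 3 * (s a x - 1) ^ 2) J"
      using that by (intro reduces_s_centered2) auto
    from W.reduces_step[OF averages_to_edge[OF that(1-3)] this that(5)] show ?thesis by (simp add: insert_commute)
  qed
  show ?thesis
  proof (cases "J = {i, j}")
    case True
    show ?thesis unfolding True
    proof (rule W.reduces_self)
      have int: "integrable \<Omega> (\<lambda>x. w i j x ^ 8)" "integrable \<Omega> (\<lambda>x. w i j x ^ 4)"
        by (intro intW amW assms)+
      have "W.P.expectation (\<lambda>x. edge_term i j x ^ 2)
          \<le> W.P.expectation (\<lambda>x. 3 * w i j x ^ 8 + 108 * w i j x ^ 4 + 27)"
        unfolding edge_term_def by (intro integral_mono hermite4_square_le intW amW assms)
      also have "\<dots> = 3 * W.P.expectation (\<lambda>x. w i j x ^ 8) + 108 * W.P.expectation (\<lambda>x. w i j x ^ 4) + 27"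
        using int by (simp add: W.P.prob_space)
      also have "\<dots> \<le> 3 * 51240 + 108 * 18 + 27"
        using w_moments[OF assms(1-3)] by (intro add_mono mult_left_mono) auto
      finally show "W.P.expectation (\<lambda>x. edge_term i j x ^ 2) \<le> moment_bound 2 (card {i, j})"
        using assms(3) by (simp add: moment_bound_def)
    qed (auto intro!: amW simp: assms ignores_def ignores_w edge_term_def[abs_def])
  next
    case False
    then have "i \<notin> J \<or> j \<notin> J" using assms(4) by blast
    then show ?thesis
      using 1[of i j] 1[of j i] assms by (auto simp: edge_commute[of j i] insert_commute)
  qed
qed

end

section \<open>The statistic under the Wishart law\<close>

lemma sum_pairs_by_meets:
  fixes \<phi> :: "nat \<Rightarrow> real"
  assumes "finite T" "\<And>t. t \<in> T \<Longrightarrow> length (l t) \<le> m"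
  shows "(\<Sum>t\<in>T. \<Sum>t'\<in>T. \<phi> (card (set (l t) \<inter> set (l t')))) = (\<Sum>p\<le>m. \<phi> p * real (meets l T p))"
proof -
  let ?c = "\<lambda>(t, t'). card (set (l t) \<inter> set (l t'))"
  have c: "?c z \<le> m" if zT: "z \<in> T \<times> T" for z
  proof -
    obtain t t' where z: "z = (t, t')" "t \<in> T" using zT by auto
    have "card (set (l t) \<inter> set (l t')) \<le> card (set (l t))" by (intro card_mono) auto
    also have "\<dots> \<le> length (l t)" by (rule card_length)
    also have "\<dots> \<le> m" using z assms by auto
    finally show ?thesis using z by simp
  qed
  have "(\<Sum>t\<in>T. \<Sum>t'\<in>T. \<phi> (card (set (l t) \<inter> set (l t')))) = (\<Sum>z\<in>T \<times> T. \<phi> (?c z))"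
    by (simp add: sum.cartesian_product case_prod_beta)
  also have "\<dots> = (\<Sum>p\<le>m. \<Sum>z | z \<in> T \<times> T \<and> ?c z = p. \<phi> (?c z))"
    using assms(1) c by (intro sum.group[symmetric]) auto
  also have "\<dots> = (\<Sum>p\<le>m. \<phi> p * real (meets l T p))"
  proof (rule sum.cong[OF refl])
    fix p
    have "{z. z \<in> T \<times> T \<and> ?c z = p} = {(t, t'). t \<in> T \<and> t' \<in> T \<and> card (set (l t) \<inter> set (l t')) = p}" by auto
    then have "card {z. z \<in> T \<times> T \<and> ?c z = p} = meets l T p" by (simp add: meets_def)
    moreover have "(\<Sum>z | z \<in> T \<times> T \<and> ?c z = p. \<phi> (?c z)) = (\<Sum>z | z \<in> T \<times> T \<and> ?c z = p. \<phi> p)"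
      by (rule sum.cong) auto
    ultimately show "(\<Sum>z | z \<in> T \<times> T \<and> ?c z = p. \<phi> (?c z)) = \<phi> p * real (meets l T p)" by simp
  qed
  finally show ?thesis .
qed

context indep_coords
begin

text \<open>Summing the covariance bounds over all pairs of summands, grouped by the number of common
vertices.\<close>

lemma reduces_family:
  fixes l :: "'b \<Rightarrow> 'i list"
  assumes "finite T" "\<And>t. t \<in> T \<Longrightarrow> length (l t) = m"
    and reduces: "\<And>t J. t \<in> T \<Longrightarrow> J \<subseteq> set (l t) \<Longrightarrow> reduces b c (set (l t)) (f t) J"
    and ig: "\<And>t v. t \<in> T \<Longrightarrow> v \<notin> set (l t) \<Longrightarrow> ignores v (f t)"
    and c: "c \<ge> 0"
  shows "all_moments (PiM I M) (\<lambda>x. \<Sum>t\<in>T. f t x)"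
    and "P.expectation (\<lambda>x. \<Sum>t\<in>T. f t x) = c * card T"
    and "P.variance (\<lambda>x. \<Sum>t\<in>T. f t x) \<le> (\<Sum>p\<le>m. (if p = 0 then 0 else b p) * real (meets l T p))"
proof -
  have am: "all_moments (PiM I M) (f t)" if "t \<in> T" for t
    using reduces_all_moments[OF reduces[OF that empty_subsetI]] .
  have E: "P.expectation (f t) = c" if "t \<in> T" for t
    using reduces_expectation[OF reduces[OF that empty_subsetI]] .
  show "all_moments (PiM I M) (\<lambda>x. \<Sum>t\<in>T. f t x)" using am by (rule P.all_moments_sum)
  have "P.expectation (\<lambda>x. \<Sum>t\<in>T. f t x) = (\<Sum>t\<in>T. P.expectation (f t))"
    using am by (intro Bochner_Integration.integral_sum all_moments_integrable)
  then show "P.expectation (\<lambda>x. \<Sum>t\<in>T. f t x) = c * card T" using E by simp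
  have "P.variance (\<lambda>x. \<Sum>t\<in>T. f t x) \<le>
     (\<Sum>t\<in>T. \<Sum>t'\<in>T. (\<lambda>p. if p = 0 then 0 else b p) (card (set (l t) \<inter> set (l t'))))"
  proof (rule P.variance_sum_le[OF assms(1) am])
    fix t t' assume t: "t \<in> T" "t' \<in> T"
    show "P.expectation (\<lambda>x. f t x * f t' x) - P.expectation (f t) * P.expectation (f t')
      \<le> (\<lambda>p. if p = 0 then 0 else b p) (card (set (l t) \<inter> set (l t')))"
      using covariance_le_reduces[OF reduces[OF t(1) Int_lower1] reduces[OF t(2) Int_lower2] ig[OF t(1)] ig[OF t(2)] E[OF t(1)] E[OF t(2)] c]
      by simp
  qed
  also have "\<dots> = (\<Sum>p\<le>m. (if p = 0 then 0 else b p) * real (meets l T p))"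
    using assms(1,2) by (intro sum_pairs_by_meets) simp_all
  finally show "P.variance (\<lambda>x. \<Sum>t\<in>T. f t x) \<le> (\<Sum>p\<le>m. (if p = 0 then 0 else b p) * real (meets l T p))" .
qed

end

context vertex_graph
begin

lemma C4_set_V: "(i, j, k, l) \<in> C4_set G \<Longrightarrow> i \<in> V \<and> j \<in> V \<and> k \<in> V \<and> l \<in> V \<and> distinct [i, j, k, l]"
  using cyc_V[of i j k l] by (simp add: C4_set_cyc cyc_def)

lemma P2_set_V: "(i, j, k) \<in> P2_set G \<Longrightarrow> i \<in> V \<and> j \<in> V \<and> k \<in> V \<and> distinct [i, j, k]"
  using nbrs_V[of i j] nbrs_V[of k j] by (auto simp: P2_set_nbrs)

lemma edge_pairs_V: "(i, j) \<in> edge_pairs G \<Longrightarrow> i \<in> V \<and> j \<in> V \<and> i \<noteq> j"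
  using nbrs_V[of j i] by (auto simp: edge_pairs_nbrs)

text \<open>The statistic as a function of the entries, so that the same formula can be evaluated at
the Wishart and at the GOE variables.\<close>

definition kappa_of :: "(nat \<Rightarrow> nat \<Rightarrow> real) \<Rightarrow> real" where
  "kappa_of m = (\<Sum>(i, j, k, l)\<in>C4_set G. m i j * m j k * m k l * m l i) +
     (\<Sum>(i, j, k)\<in>P2_set G. (m i j ^ 2 - 1) * (m j k ^ 2 - 1)) +
     (\<Sum>(i, j)\<in>edge_pairs G. m i j ^ 4 - 6 * m i j ^ 2 + 3)"

end

text \<open>The graph together with the dimension; the vertices index the columns.\<close>

locale masked = gauss_vec d + vertex_graph n G for d n :: nat and G :: "nat ugraph"
begin

sublocale X: wishart d V ..

definition kappa_W :: "(nat \<Rightarrow> nat \<Rightarrow> real) \<Rightarrow> real" where "kappa_W x = kappa_of (\<lambda>i j. X.w i j x)"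

lemma kappa_W_eq: "kappa_W x = (\<Sum>t\<in>C4_set G. (\<lambda>(i, j, k, l). X.cycle_term i j k l) t x) +
    (\<Sum>t\<in>P2_set G. (\<lambda>(i, j, k). X.path_term i j k) t x) + (\<Sum>t\<in>edge_pairs G. (\<lambda>(i, j). X.edge_term i j) t x)"
  unfolding kappa_W_def kappa_of_def by (simp add: X.cycle_term_def X.path_term_def X.edge_term_def case_prod_beta)

lemma atMost_num: "{..4::nat} = {0, 1, 2, 3, 4}" "{..3::nat} = {0, 1, 2, 3}" "{..2::nat} = {0, 1, 2}"
  by auto

abbreviation "var_bound \<equiv> 10 ^ 25 * (real d ^ 2 * real num_terms + real num_bad) / real d ^ 2"

text \<open>The weights in the variance are \<open>10\<^sup>6\<close>, \<open>10\<^sup>6 / d\<close> and \<open>10\<^sup>6 / d\<^sup>2\<close>, that is \<open>10\<^sup>6 / d\<^sup>2\<close> times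
the weights in the counting bounds.\<close>

lemma meets_bound_real:
  assumes "d ^ 2 * a + d * b + c \<le> 10 ^ 19 * (d ^ 2 * num_terms + num_bad)"
  shows "10 ^ 6 * real a + 10 ^ 6 / real d * real b + 10 ^ 6 / real d ^ 2 * real c \<le> var_bound"
proof -
  have "real (d ^ 2 * a + d * b + c) \<le> real (10 ^ 19 * (d ^ 2 * num_terms + num_bad))"
    using assms by (rule of_nat_mono)
  then have "real d ^ 2 * a + d * b + c \<le> 10 ^ 19 * (real d ^ 2 * num_terms + num_bad)" by simp
  then have "10 ^ 6 * (real d ^ 2 * a + d * b + c) / real d ^ 2 \<le> 10 ^ 6 * (10 ^ 19 * (real d ^ 2 * num_terms + num_bad)) / real d ^ 2"
    by (intro divide_right_mono mult_left_mono) simp_all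
  moreover have "10 ^ 6 * (real d ^ 2 * a + d * b + c) / real d ^ 2 =
     10 ^ 6 * real a + 10 ^ 6 / real d * real b + 10 ^ 6 / real d ^ 2 * real c"
    using d_pos by (simp add: add_divide_distrib distrib_left power2_eq_square)
  ultimately show ?thesis by simp
qed

lemma d_ge1: "d \<ge> 1" using d_pos by simp

lemma cycle_sum:
  defines "f \<equiv> \<lambda>x. \<Sum>t\<in>C4_set G. (\<lambda>(i, j, k, l). X.cycle_term i j k l) t x"
  shows "all_moments X.\<Omega> f" "X.W.P.expectation f = card (C4_set G) / d" "X.W.P.variance f \<le> var_bound"
proof -
  let ?T = "\<lambda>(i, j, k, l). X.cycle_term i j k l"
  have reduces: "X.W.reduces (X.moment_bound 4) (1 / d) (set (list4 t)) (?T t) J" if "t \<in> C4_set G" "J \<subseteq> set (list4 t)" for t J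
    using that by (cases t) (auto dest!: C4_set_V intro!: X.reduces_cycle)
  have ig: "ignores v (?T t)" if "t \<in> C4_set G" "v \<notin> set (list4 t)" for t v
    using that by (cases t) (auto simp: ignores_def X.cycle_term_def X.ignores_w)
  have len: "length (list4 t) = 4" for t by (cases t) simp
  note F = X.W.reduces_family[where T = "C4_set G" and l = list4 and f = ?T and b = "X.moment_bound 4" and c = "1 / d" and m = 4,
      OF finite_C4_set len reduces ig]
  show "all_moments X.\<Omega> f" unfolding f_def by (rule F(1)) simp_all
  show "X.W.P.expectation f = card (C4_set G) / d" unfolding f_def by (subst F(2)) simp_all
  have "X.W.P.variance f \<le> (\<Sum>p\<le>4. (if p = 0 then 0 else X.moment_bound 4 p) * real (meets list4 (C4_set G) p))"
    unfolding f_def by (rule F(3)) simp_all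
  also have "\<dots> = 10 ^ 6 * real (meets list4 (C4_set G) 4) + 10 ^ 6 / real d * real (meets list4 (C4_set G) 3)
     + 10 ^ 6 / real d ^ 2 * real (meets list4 (C4_set G) 2 + meets list4 (C4_set G) 1)"
    unfolding atMost_num by (simp add: X.moment_bound_def algebra_simps add_divide_distrib)
  also have "\<dots> \<le> var_bound"
    using meets_cycle_bound[OF d_ge1] by (intro meets_bound_real) simp
  finally show "X.W.P.variance f \<le> var_bound" .
qed

lemma path_sum:
  defines "f \<equiv> \<lambda>x. \<Sum>t\<in>P2_set G. (\<lambda>(i, j, k). X.path_term i j k) t x"
  shows "all_moments X.\<Omega> f" "X.W.P.expectation f = 2 * card (P2_set G) / d" "X.W.P.variance f \<le> var_bound"
proof -
  let ?T = "\<lambda>(i, j, k). X.path_term i j k"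
  have reduces: "X.W.reduces (X.moment_bound 3) (2 / d) (set (list3 t)) (?T t) J" if "t \<in> P2_set G" "J \<subseteq> set (list3 t)" for t J
    using that by (cases t) (auto dest!: P2_set_V intro!: X.reduces_path)
  have ig: "ignores v (?T t)" if "t \<in> P2_set G" "v \<notin> set (list3 t)" for t v
    using that by (cases t) (auto simp: ignores_def X.path_term_def X.ignores_w)
  have len: "length (list3 t) = 3" for t by (cases t) simp
  note F = X.W.reduces_family[where T = "P2_set G" and l = list3 and f = ?T and b = "X.moment_bound 3" and c = "2 / d" and m = 3,
      OF finite_P2_set len reduces ig]
  show "all_moments X.\<Omega> f" unfolding f_def by (rule F(1)) simp_all
  show "X.W.P.expectation f = 2 * card (P2_set G) / d" unfolding f_def by (subst F(2)) simp_all
  have "X.W.P.variance f \<le> (\<Sum>p\<le>3. (if p = 0 then 0 else X.moment_bound 3 p) * real (meets list3 (P2_set G) p))"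
    unfolding f_def by (rule F(3)) simp_all
  also have "\<dots> = 10 ^ 6 * real (meets list3 (P2_set G) 3) + 10 ^ 6 / real d * real (meets list3 (P2_set G) 2)
     + 10 ^ 6 / real d ^ 2 * real (meets list3 (P2_set G) 1)"
    unfolding atMost_num by (simp add: X.moment_bound_def)
  also have "\<dots> \<le> var_bound"
    using meets_path_bound[OF d_ge1] by (intro meets_bound_real) simp
  finally show "X.W.P.variance f \<le> var_bound" .
qed

lemma edge_sum:
  defines "f \<equiv> \<lambda>x. \<Sum>t\<in>edge_pairs G. (\<lambda>(i, j). X.edge_term i j) t x"
  shows "all_moments X.\<Omega> f" "X.W.P.expectation f = 6 * card (edge_pairs G) / d" "X.W.P.variance f \<le> var_bound"
proof -
  let ?T = "\<lambda>(i, j). X.edge_term i j"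
  have reduces: "X.W.reduces (X.moment_bound 2) (6 / d) (set (list2 t)) (?T t) J" if "t \<in> edge_pairs G" "J \<subseteq> set (list2 t)" for t J
    using that by (cases t) (auto dest!: edge_pairs_V intro!: X.reduces_edge)
  have ig: "ignores v (?T t)" if "t \<in> edge_pairs G" "v \<notin> set (list2 t)" for t v
    using that by (cases t) (auto simp: ignores_def X.edge_term_def X.ignores_w)
  have len: "length (list2 t) = 2" for t by (cases t) simp
  note F = X.W.reduces_family[where T = "edge_pairs G" and l = list2 and f = ?T and b = "X.moment_bound 2" and c = "6 / d" and m = 2,
      OF finite_edge_pairs len reduces ig]
  show "all_moments X.\<Omega> f" unfolding f_def by (rule F(1)) simp_all
  show "X.W.P.expectation f = 6 * card (edge_pairs G) / d" unfolding f_def by (subst F(2)) simp_all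
  have "X.W.P.variance f \<le> (\<Sum>p\<le>2. (if p = 0 then 0 else X.moment_bound 2 p) * real (meets list2 (edge_pairs G) p))"
    unfolding f_def by (rule F(3)) simp_all
  also have "\<dots> = 10 ^ 6 * real (meets list2 (edge_pairs G) 2) + 10 ^ 6 / real d * real 0
     + 10 ^ 6 / real d ^ 2 * real (meets list2 (edge_pairs G) 1)"
    unfolding atMost_num by (simp add: X.moment_bound_def)
  also have "\<dots> \<le> var_bound"
    using meets_edge_bound[OF d_ge1] by (intro meets_bound_real) simp
  finally show "X.W.P.variance f \<le> var_bound" .
qed

text \<open>The factor 9 comes from splitting the variance of a sum of three terms and from using the
same bound for each of them.\<close>

lemma kappa_W_moments:
  shows "all_moments X.\<Omega> kappa_W" "X.W.P.expectation kappa_W \<ge> num_terms / d" "X.W.P.variance kappa_W \<le> 9 * var_bound"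
proof -
  note am = cycle_sum(1) path_sum(1) edge_sum(1)
  have eq: "kappa_W = (\<lambda>x. (\<Sum>t\<in>C4_set G. (\<lambda>(i, j, k, l). X.cycle_term i j k l) t x) +
    (\<Sum>t\<in>P2_set G. (\<lambda>(i, j, k). X.path_term i j k) t x) + (\<Sum>t\<in>edge_pairs G. (\<lambda>(i, j). X.edge_term i j) t x))"
    by (rule ext) (rule kappa_W_eq)
  show "all_moments X.\<Omega> kappa_W" unfolding eq by (intro X.W.P.all_moments_intros(2) am)
  have "X.W.P.expectation kappa_W = card (C4_set G) / d + 2 * card (P2_set G) / d + 6 * card (edge_pairs G) / d"
    unfolding eq using am[THEN all_moments_integrable] cycle_sum(2) path_sum(2) edge_sum(2) by simp
  also have "\<dots> = (card (C4_set G) + 2 * card (P2_set G) + 6 * card (edge_pairs G)) / d"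
    by (simp add: add_divide_distrib)
  also have "\<dots> \<ge> num_terms / d" using num_terms_le by (intro divide_right_mono) simp_all
  finally show "X.W.P.expectation kappa_W \<ge> num_terms / d" .
  have "X.W.P.variance kappa_W \<le> 3 * (var_bound + var_bound + var_bound)"
    unfolding eq by (rule order_trans[OF X.W.P.variance_add3_le[OF am]])
      (intro mult_left_mono add_mono cycle_sum(3) path_sum(3) edge_sum(3); simp)
  moreover have "3 * (b + b + b) = 9 * b" for b :: real by simp
  ultimately show "X.W.P.variance kappa_W \<le> 9 * var_bound" by (simp only:)
qed

end

section \<open>The statistic under the GOE law\<close>

context vertex_graph
begin

definition upper :: "(nat \<times> nat) set" where "upper = {(i, j). 1 \<le> i \<and> i \<le> j \<and> j \<le> n}"
definition entry_law :: "nat \<times> nat \<Rightarrow> real measure" where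
  "entry_law = (\<lambda>(i, j). density lborel (normal_density 0 (if i = j then sqrt 2 else 1)))"

text \<open>The GOE entry at \<open>(i, j)\<close> is the coordinate at the position on or above the diagonal.\<close>

definition uindex :: "nat \<Rightarrow> nat \<Rightarrow> nat \<times> nat" where "uindex i j = (min i j, max i j)"

sublocale Y: indep_coords upper entry_law
proof (rule indep_coords.intro)
  show "prob_space (entry_law i)" for i
    by (cases i) (simp add: entry_law_def prob_space_normal_density)
qed

abbreviation "\<Psi> \<equiv> PiM upper entry_law"

lemma uindex_commute: "uindex i j = uindex j i" by (simp add: uindex_def min.commute max.commute)

lemma uindex_eq_iff: "uindex i j = uindex a b \<longleftrightarrow> i = a \<and> j = b \<or> i = b \<and> j = a"
  by (auto simp: uindex_def min_def max_def split: if_splits)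

lemma uindex_upper: "i \<in> V \<Longrightarrow> j \<in> V \<Longrightarrow> uindex i j \<in> upper"
  by (auto simp: uindex_def upper_def V_def)

lemma entry_law_uindex: "i \<noteq> j \<Longrightarrow> entry_law (uindex i j) = N01"
  by (auto simp: entry_law_def uindex_def min_def max_def)

lemma all_moments_N01: "all_moments N01 (\<lambda>x. x)"
  using all_moments_normal[of 1] by simp

lemma all_moments_Y:
  assumes "i \<in> V" "j \<in> V" "i \<noteq> j" shows "all_moments \<Psi> (\<lambda>x. x (uindex i j))"
  using Y.prob_M uindex_upper[OF assms(1,2)]
  by (rule all_moments_component) (simp add: entry_law_uindex assms(3) all_moments_N01)

lemmas amY = Y.P.all_moments_intros all_moments_Y

lemma expectation_Y:
  fixes \<phi> :: "real \<Rightarrow> real"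
  assumes "i \<in> V" "j \<in> V" "i \<noteq> j" "\<phi> \<in> borel_measurable borel"
  shows "Y.P.expectation (\<lambda>x. \<phi> (x (uindex i j))) = (\<integral>y. \<phi> y \<partial>N01)"
proof -
  have d: "distr \<Psi> N01 (\<lambda>x. x (uindex i j)) = N01"
    using distr_PiM_component[of upper entry_law, OF Y.prob_M uindex_upper[OF assms(1,2)]]
    by (simp add: entry_law_uindex[OF assms(3)])
  have m: "(\<lambda>x. x (uindex i j)) \<in> measurable \<Psi> N01"
    using measurable_component_singleton[OF uindex_upper[OF assms(1,2)], of entry_law]
    by (simp add: entry_law_uindex[OF assms(3)])
  have "(\<integral>y. \<phi> y \<partial>N01) = integral\<^sup>L (distr \<Psi> N01 (\<lambda>x. x (uindex i j))) \<phi>" unfolding d ..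
  also have "\<dots> = Y.P.expectation (\<lambda>x. \<phi> (x (uindex i j)))" using assms(4) by (intro integral_distr[OF m]) auto
  finally show ?thesis ..
qed

lemma N01_even: "(\<integral>y. y ^ 2 \<partial>N01) = 1" "(\<integral>y. y ^ 4 \<partial>N01) = 3" "(\<integral>y. y ^ 8 \<partial>N01) = 105" "(\<integral>y. y \<partial>N01) = 0"
  using integral_normal_power_even[of 1 1] integral_normal_power_even[of 1 2]
    integral_normal_power_even[of 1 4] integral_normal_power_odd[of 1 0]
  by (simp_all add: fact_numeral)

lemma N01_integrable: "integrable N01 (\<lambda>y. y ^ k)"
  using all_moments_power_integrable[OF all_moments_N01] .

lemma N01_hermite4: "(\<integral>y. y ^ 4 - 6 * y ^ 2 + 3 \<partial>N01) = 0"
proof -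
  interpret N: prob_space N01 by (rule prob_N01)
  have "N.prob UNIV = 1" using N.prob_space by simp
  then show ?thesis using N01_integrable N01_even by simp
qed

definition goe_cycle where "goe_cycle = (\<lambda>(i, j, k, l) x. x (uindex i j) * x (uindex j k) * x (uindex k l) * x (uindex l i) :: real)"
definition goe_path where "goe_path = (\<lambda>(i, j, k) x. (x (uindex i j) ^ 2 - 1) * (x (uindex j k) ^ 2 - 1) :: real)"
definition goe_edge where "goe_edge = (\<lambda>(i, j) x. x (uindex i j) ^ 4 - 6 * x (uindex i j) ^ 2 + 3 :: real)"

text \<open>Some variable on an edge at the vertex \<open>v\<close> averages out to 0. If \<open>v\<close> is not a vertex of
another summand, then that summand ignores this variable, so the two are uncorrelated.\<close>

definition centered_at :: "nat \<Rightarrow> (((nat \<times> nat) \<Rightarrow> real) \<Rightarrow> real) \<Rightarrow> bool" where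
  "centered_at v f \<longleftrightarrow> (\<exists>u. Y.averages_to {uindex u v} f (\<lambda>_. 0))"

lemma centered_product:
  assumes "i \<in> V" "j \<in> V" "i \<noteq> j" "(\<integral>y. \<phi> y \<partial>N01) = 0"
    and "all_moments \<Psi> f" "\<And>x. f x = \<phi> (x (uindex i j)) * g x" "ignores (uindex i j) g"
  shows "Y.averages_to {uindex i j} f (\<lambda>_. 0)"
proof (rule Y.averages_to_step)
  show "(\<integral>y. f (x(uindex i j := y)) \<partial>entry_law (uindex i j)) = 0" for x
    using assms(4,7) by (simp add: assms(6) entry_law_uindex[OF assms(3)] ignores_def)
qed (use assms uindex_upper in \<open>auto intro: Y.P.all_moments_const\<close>)

text \<open>A cycle contains each of its edge variables exactly once, and these have mean 0.\<close>

lemma goe_cycle_centered: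
  assumes "(i, j, k, l) \<in> C4_set G" "v \<in> {i, j, k, l}"
  shows "centered_at v (goe_cycle (i, j, k, l))"
proof -
  have V: "i \<in> V" "j \<in> V" "k \<in> V" "l \<in> V" "distinct [i, j, k, l]" using C4_set_V[OF assms(1)] by auto
  have 1: "Y.averages_to {uindex a b} (goe_cycle (a, b, c, e)) (\<lambda>_. 0)"
    if "a \<in> V" "b \<in> V" "c \<in> V" "e \<in> V" "distinct [a, b, c, e]" for a b c e
  proof (rule centered_product[where \<phi> = "\<lambda>y. y" and g = "\<lambda>x. x (uindex b c) * x (uindex c e) * x (uindex e a)"])
    show "all_moments \<Psi> (goe_cycle (a, b, c, e))"
      unfolding goe_cycle_def case_prod_conv using that by (intro amY) auto
  qed (use that N01_even in \<open>auto simp: goe_cycle_def ignores_def uindex_eq_iff\<close>)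
  have rot: "goe_cycle (i, j, k, l) = goe_cycle (j, k, l, i)" "goe_cycle (i, j, k, l) = goe_cycle (k, l, i, j)"
    "goe_cycle (i, j, k, l) = goe_cycle (l, i, j, k)"
    by (auto simp: goe_cycle_def)
  have "v = i \<or> v = j \<or> v = k \<or> v = l" using assms(2) by simp
  then show ?thesis
  proof (elim disjE)
    assume "v = i"
    then show ?thesis using 1[of i j k l] V unfolding centered_at_def by (intro exI[of _ j]) (simp add: uindex_commute)
  next
    assume "v = j"
    then show ?thesis using 1[of j k l i] V unfolding centered_at_def rot(1) by (intro exI[of _ k]) (simp add: uindex_commute)
  next
    assume "v = k"
    then show ?thesis using 1[of k l i j] V unfolding centered_at_def rot(2) by (intro exI[of _ l]) (simp add: uindex_commute)
  next
    assume "v = l"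
    then show ?thesis using 1[of l i j k] V unfolding centered_at_def rot(3) by (intro exI[of _ i]) (simp add: uindex_commute)
  qed
qed

text \<open>Each factor \<open>y\<^sup>2 - 1\<close> has mean 0, and each vertex of the path lies on an edge of the path.\<close>

lemma goe_path_centered:
  assumes "(i, j, k) \<in> P2_set G" "v \<in> {i, j, k}"
  shows "centered_at v (goe_path (i, j, k))"
proof -
  have V: "i \<in> V" "j \<in> V" "k \<in> V" "distinct [i, j, k]" using P2_set_V[OF assms(1)] by auto
  have am: "all_moments \<Psi> (goe_path (i, j, k))"
    unfolding goe_path_def case_prod_conv using V by (intro amY) auto
  have 1: "Y.averages_to {uindex i j} (goe_path (i, j, k)) (\<lambda>_. 0)"
    by (rule centered_product[where \<phi> = "\<lambda>y. y ^ 2 - 1" and g = "\<lambda>x. x (uindex j k) ^ 2 - 1"])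
      (use V am normal_centered_square_moments in \<open>auto simp: goe_path_def ignores_def uindex_eq_iff\<close>)
  have 2: "Y.averages_to {uindex j k} (goe_path (i, j, k)) (\<lambda>_. 0)"
    by (rule centered_product[where \<phi> = "\<lambda>y. y ^ 2 - 1" and g = "\<lambda>x. x (uindex i j) ^ 2 - 1"])
      (use V am normal_centered_square_moments in \<open>auto simp: goe_path_def ignores_def uindex_eq_iff\<close>)
  have "v = i \<or> v = j \<or> v = k" using assms(2) by simp
  then show ?thesis
    unfolding centered_at_def using 1 2 uindex_commute[of i j] by metis
qed

lemma goe_edge_centered:
  assumes "(i, j) \<in> edge_pairs G" "v \<in> {i, j}"
  shows "centered_at v (goe_edge (i, j))"
proof -
  have V: "i \<in> V" "j \<in> V" "i \<noteq> j" using edge_pairs_V[OF assms(1)] by auto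
  have am: "all_moments \<Psi> (goe_edge (i, j))"
    unfolding goe_edge_def case_prod_conv using V by (intro amY) auto
  have 1: "Y.averages_to {uindex i j} (goe_edge (i, j)) (\<lambda>_. 0)"
    by (rule centered_product[where \<phi> = "\<lambda>y. y ^ 4 - 6 * y ^ 2 + 3" and g = "\<lambda>_. 1"])
      (use V am N01_hermite4 in \<open>auto simp: goe_edge_def ignores_def\<close>)
  have "v = i \<or> v = j" using assms(2) by simp
  then show ?thesis
    unfolding centered_at_def using 1 uindex_commute[of i j] by metis
qed

text \<open>Summands on different vertex sets of the same size are uncorrelated, so only pairs on the
same vertices contribute to the variance.\<close>

lemma centered_family:
  fixes l :: "'b \<Rightarrow> nat list"
  assumes "finite T" "\<And>t. t \<in> T \<Longrightarrow> length (l t) = m \<and> distinct (l t)" "m > 0"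
    and am: "\<And>t. t \<in> T \<Longrightarrow> all_moments \<Psi> (f t)"
    and sq: "\<And>t. t \<in> T \<Longrightarrow> Y.P.expectation (\<lambda>x. f t x ^ 2) \<le> 10 ^ 6"
    and ce: "\<And>t v. t \<in> T \<Longrightarrow> v \<in> set (l t) \<Longrightarrow> centered_at v (f t)"
    and ig: "\<And>t u v. t \<in> T \<Longrightarrow> v \<notin> set (l t) \<Longrightarrow> ignores (uindex u v) (f t)"
  shows "all_moments \<Psi> (\<lambda>x. \<Sum>t\<in>T. f t x)" "Y.P.expectation (\<lambda>x. \<Sum>t\<in>T. f t x) = 0"
    "Y.P.variance (\<lambda>x. \<Sum>t\<in>T. f t x) \<le> 10 ^ 6 * real (meets l T m)"
proof -
  have E: "Y.P.expectation (f t) = 0" if t: "t \<in> T" for t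
  proof -
    obtain v where "v \<in> set (l t)" using assms(2)[OF t] assms(3) by (cases "l t") auto
    then obtain u where "Y.averages_to {uindex u v} (f t) (\<lambda>_. 0)" using ce t unfolding centered_at_def by blast
    then show ?thesis using Y.averages_to_expectation by fastforce
  qed
  show "all_moments \<Psi> (\<lambda>x. \<Sum>t\<in>T. f t x)" using am by (rule Y.P.all_moments_sum)
  show "Y.P.expectation (\<lambda>x. \<Sum>t\<in>T. f t x) = 0"
    using am E by (subst Bochner_Integration.integral_sum) (auto intro: all_moments_integrable)
  have "Y.P.variance (\<lambda>x. \<Sum>t\<in>T. f t x) \<le>
     (\<Sum>t\<in>T. \<Sum>t'\<in>T. (\<lambda>p. if p = m then 10 ^ 6 else 0) (card (set (l t) \<inter> set (l t'))))"
  proof (rule Y.P.variance_sum_le[OF assms(1) am])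
    fix t t' assume t: "t \<in> T" "t' \<in> T"
    have "Y.P.expectation (\<lambda>x. f t x * f t' x) \<le> (\<lambda>p. if p = m then 10 ^ 6 else 0) (card (set (l t) \<inter> set (l t')))"
    proof (cases "card (set (l t) \<inter> set (l t')) = m")
      case True
      then show ?thesis using t am sq by (simp add: Y.P.expectation_mult_le_of_second_moments)
    next
      case False
      have c: "card (set (l t)) = m" using assms(2)[OF t(1)] distinct_card by blast
      have "\<not> set (l t) \<subseteq> set (l t')" using False c by (auto simp: Int_absorb2)
      then obtain v where v: "v \<in> set (l t)" "v \<notin> set (l t')" by blast
      then obtain u where u: "Y.averages_to {uindex u v} (f t) (\<lambda>_. 0)" using ce t unfolding centered_at_def by blast
      have "Y.P.expectation (\<lambda>x. f t x * f t' x) = Y.P.expectation (\<lambda>x. 0 * f t' x)"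
        using u am[OF t(2)] ig[OF t(2) v(2)] unfolding Y.averages_to_def by blast
      then show ?thesis using False by simp
    qed
    then show "Y.P.expectation (\<lambda>x. f t x * f t' x) - Y.P.expectation (f t) * Y.P.expectation (f t')
      \<le> (\<lambda>p. if p = m then 10 ^ 6 else 0) (card (set (l t) \<inter> set (l t')))"
      using E t by simp
  qed
  also have "\<dots> = (\<Sum>p\<le>m. (if p = m then 10 ^ 6 else 0) * real (meets l T p))"
    using assms(1,2) by (intro sum_pairs_by_meets) simp_all
  also have "\<dots> = (\<Sum>p\<in>{m}. (if p = m then 10 ^ 6 else 0) * real (meets l T p))"
    by (rule sum.mono_neutral_right) auto
  also have "\<dots> = 10 ^ 6 * real (meets l T m)" by simp
  finally show "Y.P.variance (\<lambda>x. \<Sum>t\<in>T. f t x) \<le> 10 ^ 6 * real (meets l T m)" .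
qed

definition kappa_Y :: "(nat \<times> nat \<Rightarrow> real) \<Rightarrow> real" where "kappa_Y x = kappa_of (\<lambda>i j. x (uindex i j))"

lemma goe_cycle_sum:
  "all_moments \<Psi> (\<lambda>x. \<Sum>t\<in>C4_set G. goe_cycle t x)" "Y.P.expectation (\<lambda>x. \<Sum>t\<in>C4_set G. goe_cycle t x) = 0"
  "Y.P.variance (\<lambda>x. \<Sum>t\<in>C4_set G. goe_cycle t x) \<le> 10 ^ 6 * real (meets list4 (C4_set G) 4)"
proof -
  have am: "all_moments \<Psi> (goe_cycle t)" if t: "t \<in> C4_set G" for t
  proof (cases t)
    case (fields i j k l)
    show ?thesis using C4_set_V[of i j k l] t unfolding fields goe_cycle_def case_prod_conv by (intro amY) auto
  qed
  have sq: "Y.P.expectation (\<lambda>x. goe_cycle t x ^ 2) \<le> 10 ^ 6" if t: "t \<in> C4_set G" for t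
  proof (cases t)
    case (fields i j k l)
    then have V: "i \<in> V" "j \<in> V" "k \<in> V" "l \<in> V" "i \<noteq> j" "j \<noteq> k" "k \<noteq> l" "l \<noteq> i"
      using C4_set_V[of i j k l] t by auto
    have int: "integrable \<Psi> (\<lambda>x. x (uindex a b) ^ 8)" if "a \<in> V" "b \<in> V" "a \<noteq> b" for a b
      using that by (intro all_moments_integrable[where M = \<Psi>] amY)
    have "Y.P.expectation (\<lambda>x. goe_cycle t x ^ 2) \<le>
      Y.P.expectation (\<lambda>x. x (uindex i j) ^ 8 + x (uindex j k) ^ 8 + x (uindex k l) ^ 8 + x (uindex l i) ^ 8)"
      unfolding fields goe_cycle_def case_prod_conv
      by (intro integral_mono square_mult4_le all_moments_integrable[where M = \<Psi>] amY V)
    also have "\<dots> = 420"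
      using V int expectation_Y[of _ _ "\<lambda>y. y ^ 8"] N01_even by simp
    finally show ?thesis by simp
  qed
  have ig: "ignores (uindex u v) (goe_cycle t)" if "t \<in> C4_set G" "v \<notin> set (list4 t)" for t u v
    using that(2) by (cases t) (auto simp: goe_cycle_def ignores_def uindex_eq_iff)
  have len: "length (list4 t) = 4 \<and> distinct (list4 t)" if "t \<in> C4_set G" for t
    using that by (cases t) (auto dest: C4_set_V)
  have ce: "centered_at v (goe_cycle t)" if "t \<in> C4_set G" "v \<in> set (list4 t)" for t v
    using that goe_cycle_centered by (cases t) auto
  note F = centered_family[where l = list4 and m = 4 and f = goe_cycle, OF finite_C4_set len _ am sq ce ig]
  show "all_moments \<Psi> (\<lambda>x. \<Sum>t\<in>C4_set G. goe_cycle t x)" "Y.P.expectation (\<lambda>x. \<Sum>t\<in>C4_set G. goe_cycle t x) = 0"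
    "Y.P.variance (\<lambda>x. \<Sum>t\<in>C4_set G. goe_cycle t x) \<le> 10 ^ 6 * real (meets list4 (C4_set G) 4)"
    by (rule F; simp)+
qed

lemma goe_path_sum:
  "all_moments \<Psi> (\<lambda>x. \<Sum>t\<in>P2_set G. goe_path t x)" "Y.P.expectation (\<lambda>x. \<Sum>t\<in>P2_set G. goe_path t x) = 0"
  "Y.P.variance (\<lambda>x. \<Sum>t\<in>P2_set G. goe_path t x) \<le> 10 ^ 6 * real (meets list3 (P2_set G) 3)"
proof -
  have am: "all_moments \<Psi> (goe_path t)" if t: "t \<in> P2_set G" for t
  proof (cases t)
    case (fields i j k)
    show ?thesis using P2_set_V[of i j k] t unfolding fields goe_path_def case_prod_conv by (intro amY) auto
  qed
  have sq: "Y.P.expectation (\<lambda>x. goe_path t x ^ 2) \<le> 10 ^ 6" if t: "t \<in> P2_set G" for t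
  proof (cases t)
    case (fields i j k)
    then have V: "i \<in> V" "j \<in> V" "k \<in> V" "i \<noteq> j" "j \<noteq> k"
      using P2_set_V[of i j k] t by auto
    have int: "integrable \<Psi> (\<lambda>x. (x (uindex a b) ^ 2 - 1) ^ 4)" if "a \<in> V" "b \<in> V" "a \<noteq> b" for a b
      using that by (intro all_moments_integrable[where M = \<Psi>] amY)
    have "Y.P.expectation (\<lambda>x. goe_path t x ^ 2) \<le>
      Y.P.expectation (\<lambda>x. (x (uindex i j) ^ 2 - 1) ^ 4 + (x (uindex j k) ^ 2 - 1) ^ 4)"
      unfolding fields goe_path_def case_prod_conv
      by (intro integral_mono square_mult_le all_moments_integrable[where M = \<Psi>] amY V)
    also have "\<dots> = 120"
      using V int expectation_Y[of _ _ "\<lambda>y. (y ^ 2 - 1) ^ 4"] normal_centered_square_moments by simp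
    finally show ?thesis by simp
  qed
  have ig: "ignores (uindex u v) (goe_path t)" if "t \<in> P2_set G" "v \<notin> set (list3 t)" for t u v
    using that(2) by (cases t) (auto simp: goe_path_def ignores_def uindex_eq_iff)
  have len: "length (list3 t) = 3 \<and> distinct (list3 t)" if "t \<in> P2_set G" for t
    using that by (cases t) (auto dest: P2_set_V)
  have ce: "centered_at v (goe_path t)" if "t \<in> P2_set G" "v \<in> set (list3 t)" for t v
    using that goe_path_centered by (cases t) auto
  note F = centered_family[where l = list3 and m = 3 and f = goe_path, OF finite_P2_set len _ am sq ce ig]
  show "all_moments \<Psi> (\<lambda>x. \<Sum>t\<in>P2_set G. goe_path t x)" "Y.P.expectation (\<lambda>x. \<Sum>t\<in>P2_set G. goe_path t x) = 0"
    "Y.P.variance (\<lambda>x. \<Sum>t\<in>P2_set G. goe_path t x) \<le> 10 ^ 6 * real (meets list3 (P2_set G) 3)"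
    by (rule F; simp)+
qed

lemma goe_edge_sum:
  "all_moments \<Psi> (\<lambda>x. \<Sum>t\<in>edge_pairs G. goe_edge t x)" "Y.P.expectation (\<lambda>x. \<Sum>t\<in>edge_pairs G. goe_edge t x) = 0"
  "Y.P.variance (\<lambda>x. \<Sum>t\<in>edge_pairs G. goe_edge t x) \<le> 10 ^ 6 * real (meets list2 (edge_pairs G) 2)"
proof -
  have am: "all_moments \<Psi> (goe_edge t)" if t: "t \<in> edge_pairs G" for t
  proof (cases t)
    case (Pair i j)
    show ?thesis using edge_pairs_V[of i j] t unfolding Pair goe_edge_def case_prod_conv by (intro amY) auto
  qed
  have sq: "Y.P.expectation (\<lambda>x. goe_edge t x ^ 2) \<le> 10 ^ 6" if t: "t \<in> edge_pairs G" for t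
  proof (cases t)
    case (Pair i j)
    then have V: "i \<in> V" "j \<in> V" "i \<noteq> j"
      using edge_pairs_V[of i j] t by auto
    have int: "integrable \<Psi> (\<lambda>x. x (uindex i j) ^ 8)" "integrable \<Psi> (\<lambda>x. x (uindex i j) ^ 4)"
      by (intro all_moments_integrable[where M = \<Psi>] amY V)+
    have "Y.P.expectation (\<lambda>x. goe_edge t x ^ 2) \<le>
      Y.P.expectation (\<lambda>x. 3 * x (uindex i j) ^ 8 + 108 * x (uindex i j) ^ 4 + 27)"
      unfolding Pair goe_edge_def case_prod_conv
      by (intro integral_mono hermite4_square_le all_moments_integrable[where M = \<Psi>] amY V)
    also have "\<dots> = 666"
      using V int expectation_Y[OF V, of "\<lambda>y. y ^ 8"] expectation_Y[OF V, of "\<lambda>y. y ^ 4"] N01_even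
      by (simp add: Y.P.prob_space)
    finally show ?thesis by simp
  qed
  have ig: "ignores (uindex u v) (goe_edge t)" if "t \<in> edge_pairs G" "v \<notin> set (list2 t)" for t u v
    using that(2) by (cases t) (auto simp: goe_edge_def ignores_def uindex_eq_iff)
  have len: "length (list2 t) = 2 \<and> distinct (list2 t)" if "t \<in> edge_pairs G" for t
    using that by (cases t) (auto dest: edge_pairs_V)
  have ce: "centered_at v (goe_edge t)" if "t \<in> edge_pairs G" "v \<in> set (list2 t)" for t v
    using that goe_edge_centered by (cases t) auto
  note F = centered_family[where l = list2 and m = 2 and f = goe_edge, OF finite_edge_pairs len _ am sq ce ig]
  show "all_moments \<Psi> (\<lambda>x. \<Sum>t\<in>edge_pairs G. goe_edge t x)" "Y.P.expectation (\<lambda>x. \<Sum>t\<in>edge_pairs G. goe_edge t x) = 0"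
    "Y.P.variance (\<lambda>x. \<Sum>t\<in>edge_pairs G. goe_edge t x) \<le> 10 ^ 6 * real (meets list2 (edge_pairs G) 2)"
    by (rule F; simp)+
qed

lemma kappa_Y_moments:
  "all_moments \<Psi> kappa_Y" "Y.P.expectation kappa_Y = 0" "Y.P.variance kappa_Y \<le> 10 ^ 25 * real num_terms"
proof -
  note am = goe_cycle_sum(1) goe_path_sum(1) goe_edge_sum(1)
  have eq: "kappa_Y = (\<lambda>x. (\<Sum>t\<in>C4_set G. goe_cycle t x) + (\<Sum>t\<in>P2_set G. goe_path t x) + (\<Sum>t\<in>edge_pairs G. goe_edge t x))"
    by (rule ext) (simp add: kappa_Y_def kappa_of_def goe_cycle_def goe_path_def goe_edge_def case_prod_beta)
  show "all_moments \<Psi> kappa_Y" unfolding eq by (intro Y.P.all_moments_intros(2) am)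
  show "Y.P.expectation kappa_Y = 0"
    unfolding eq using am[THEN all_moments_integrable] goe_cycle_sum(2) goe_path_sum(2) goe_edge_sum(2) by simp
  have "Y.P.variance kappa_Y \<le> 3 * (10 ^ 6 * real (meets list4 (C4_set G) 4) + 10 ^ 6 * real (meets list3 (P2_set G) 3) + 10 ^ 6 * real (meets list2 (edge_pairs G) 2))"
    unfolding eq by (rule order_trans[OF Y.P.variance_add3_le[OF am]])
      (intro mult_left_mono add_mono goe_cycle_sum(3) goe_path_sum(3) goe_edge_sum(3); simp)
  also have "\<dots> \<le> 10 ^ 25 * real num_terms"
    using meets_same_vertices[THEN of_nat_mono, where 'a = real] by simp
  finally show "Y.P.variance kappa_Y \<le> 10 ^ 25 * real num_terms" .
qed

end

section \<open>Total variation distance\<close>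

lemma kappa4_cong:
  assumes "\<And>i j. {i, j} \<in> snd G \<Longrightarrow> M (i, j) = M' (i, j)"
  shows "kappa4 G M = kappa4 G M'"
proof -
  have 1: "(\<Sum>(i, j, k, l)\<in>C4_set G. M (i, j) * M (j, k) * M (k, l) * M (l, i)) =
      (\<Sum>(i, j, k, l)\<in>C4_set G. M' (i, j) * M' (j, k) * M' (k, l) * M' (l, i))"
    by (intro sum.cong refl) (auto simp: C4_set_def assms)
  have 2: "(\<Sum>(i, j, k)\<in>P2_set G. (M (i, j) ^ 2 - 1) * (M (j, k) ^ 2 - 1)) =
      (\<Sum>(i, j, k)\<in>P2_set G. (M' (i, j) ^ 2 - 1) * (M' (j, k) ^ 2 - 1))"
    by (intro sum.cong refl) (auto simp: P2_set_def assms)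
  have 3: "(\<Sum>(i, j)\<in>edge_pairs G. M (i, j) ^ 4 - 6 * M (i, j) ^ 2 + 3) =
      (\<Sum>(i, j)\<in>edge_pairs G. M' (i, j) ^ 4 - 6 * M' (i, j) ^ 2 + 3)"
    by (intro sum.cong refl) (auto simp: edge_pairs_def assms)
  show ?thesis unfolding kappa4_def 1 2 3 ..
qed

lemma tv_dist_le_1:
  assumes "prob_space \<mu>" "prob_space \<nu>"
  shows "tv_dist \<mu> \<nu> \<le> 1" "bdd_above ((\<lambda>A. \<bar>measure \<mu> A - measure \<nu> A\<bar>) ` sets \<mu>)"
proof -
  have le: "\<bar>measure \<mu> A - measure \<nu> A\<bar> \<le> 1" for A
    using prob_space.prob_le_1[OF assms(1), of A] prob_space.prob_le_1[OF assms(2), of A]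
      measure_nonneg[of \<mu> A] measure_nonneg[of \<nu> A] by linarith
  show "tv_dist \<mu> \<nu> \<le> 1" unfolding tv_dist_def using sets.top le by (intro cSUP_least) auto
  show "bdd_above ((\<lambda>A. \<bar>measure \<mu> A - measure \<nu> A\<bar>) ` sets \<mu>)" using le by (intro bdd_aboveI2)
qed

text \<open>Preimages of measurable sets are measurable, so the supremum for the images is over fewer
sets.\<close>

lemma tv_dist_distr_le:
  assumes "prob_space \<mu>" "prob_space \<nu>" "sets \<mu> = sets \<nu>" "f \<in> measurable \<mu> N"
  shows "tv_dist (distr \<mu> N f) (distr \<nu> N f) \<le> tv_dist \<mu> \<nu>"
  unfolding tv_dist_def[of "distr \<mu> N f"]
proof (rule cSUP_least)
  show "sets (distr \<mu> N f) \<noteq> {}" using sets.top by blast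
  fix A assume "A \<in> sets (distr \<mu> N f)"
  then have A: "A \<in> sets N" by simp
  have f': "f \<in> measurable \<nu> N" using assms(4) measurable_cong_sets[OF assms(3) refl] by blast
  have sp: "space \<mu> = space \<nu>" using assms(3) by (rule sets_eq_imp_space_eq)
  have "\<bar>measure (distr \<mu> N f) A - measure (distr \<nu> N f) A\<bar> =
      \<bar>measure \<mu> (f -` A \<inter> space \<mu>) - measure \<nu> (f -` A \<inter> space \<mu>)\<bar>"
    by (simp add: measure_distr[OF assms(4) A] measure_distr[OF f' A] sp)
  also have "\<dots> \<le> tv_dist \<mu> \<nu>"
    unfolding tv_dist_def using measurable_sets[OF assms(4) A] tv_dist_le_1(2)[OF assms(1,2)]
    by (intro cSUP_upper)
  finally show "\<bar>measure (distr \<mu> N f) A - measure (distr \<nu> N f) A\<bar> \<le> tv_dist \<mu> \<nu>" .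
qed

text \<open>The two laws are separated by the half-line above half the mean of \<open>f\<close>. By Chebyshev's
inequality, \<open>f\<close> lies below it and \<open>g\<close> above it with probability at most the variance divided by
\<open>(a / 2)\<^sup>2\<close>.\<close>

lemma tv_dist_ge_of_moments:
  assumes M: "prob_space M" "all_moments M f" and M': "prob_space M'" "all_moments M' g"
    and g: "integral\<^sup>L M' g = 0" and \<mu>: "0 < a" "a \<le> integral\<^sup>L M f"
    and var: "prob_space.variance M f \<le> v" "prob_space.variance M' g \<le> v'"
  shows "tv_dist (distr M borel f) (distr M' borel g) \<ge> 1 - 4 * (v + v') / a ^ 2"
proof -
  interpret M: prob_space M by (rule M(1))
  interpret M': prob_space M' by (rule M'(1))
  \<comment> \<open>The threshold is half of the mean itself; \<open>a\<close> is only a lower bound for the mean.\<close>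
  define \<mu> where "\<mu> = M.expectation f"
  have \<mu>0: "0 < \<mu>" "a \<le> \<mu>" using \<mu> by (simp_all add: \<mu>_def)
  note [measurable] = all_moments_measurable[OF M(2)] all_moments_measurable[OF M'(2)]
  let ?A = "{\<mu> / 2..}"
  let ?B = "{x \<in> space M. \<bar>f x - M.expectation f\<bar> \<ge> \<mu> / 2}"
  have "M.prob ?B \<le> M.variance f / (\<mu> / 2) ^ 2"
    using \<mu>0 all_moments_power_integrable[OF M(2), of 2] by (intro M.Chebyshev_inequality) simp_all
  moreover have "1 - M.prob ?B \<le> M.prob (f -` ?A \<inter> space M)"
  proof -
    have "1 - M.prob ?B = M.prob (space M - ?B)" by (rule M.prob_compl[symmetric]) simp
    also have "\<dots> \<le> M.prob (f -` ?A \<inter> space M)"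
    proof (rule M.finite_measure_mono)
      show "space M - ?B \<subseteq> f -` ?A \<inter> space M"
        by (auto simp: \<mu>_def[symmetric] abs_if not_le split: if_splits)
    qed measurable
    finally show ?thesis .
  qed
  ultimately have 1: "measure (distr M borel f) ?A \<ge> 1 - M.variance f / (\<mu> / 2) ^ 2"
    by (simp add: measure_distr)
  let ?B' = "{x \<in> space M'. \<bar>g x - M'.expectation g\<bar> \<ge> \<mu> / 2}"
  have "M'.prob (g -` ?A \<inter> space M') \<le> M'.prob ?B'"
    by (rule M'.finite_measure_mono) (auto simp: g)
  also have "\<dots> \<le> M'.variance g / (\<mu> / 2) ^ 2"
    using \<mu>0 all_moments_power_integrable[OF M'(2), of 2] by (intro M'.Chebyshev_inequality) simp_all
  finally have 2: "measure (distr M' borel g) ?A \<le> M'.variance g / (\<mu> / 2) ^ 2"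
    by (simp add: measure_distr)
  have "M.variance f \<ge> 0" "M'.variance g \<ge> 0" by (rule Bochner_Integration.integral_nonneg; simp)+
  then have v: "0 \<le> v" "0 \<le> v'" using var by linarith+
  have "(M.variance f + M'.variance g) / (\<mu> / 2) ^ 2 \<le> (v + v') / (a / 2) ^ 2"
    using var v \<mu>0 \<mu> by (intro frac_le add_mono power_mono) auto
  also have "\<dots> = 4 * (v + v') / a ^ 2" by (simp add: power_divide)
  finally have 3: "M.variance f / (\<mu> / 2) ^ 2 + M'.variance g / (\<mu> / 2) ^ 2 \<le> 4 * (v + v') / a ^ 2"
    by (simp add: add_divide_distrib)
  have "\<bar>measure (distr M borel f) ?A - measure (distr M' borel g) ?A\<bar> \<le> tv_dist (distr M borel f) (distr M' borel g)"
    unfolding tv_dist_def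
    by (intro cSUP_upper tv_dist_le_1(2) M.prob_space_distr M'.prob_space_distr) simp_all
  then show ?thesis using 1 2 3 by linarith
qed

section \<open>The laws of the statistic\<close>

context masked
begin

abbreviation "positions \<equiv> {1..d} \<times> {1..n}"

definition matrix_of_columns :: "(nat \<Rightarrow> nat \<Rightarrow> real) \<Rightarrow> rmat" where "matrix_of_columns x = (\<lambda>(k, i)\<in>positions. x i k)"

lemma gaussian_matrix_eq: "gaussian_matrix d n = PiM positions (\<lambda>_. N01)"
  by (simp add: gaussian_matrix_def)

lemma matrix_of_columns_measurable: "matrix_of_columns \<in> measurable X.\<Omega> (gaussian_matrix d n)"
  unfolding gaussian_matrix_eq matrix_of_columns_def[abs_def]
proof (rule measurable_restrict)
  fix p assume "p \<in> positions"
  then obtain k i where p: "p = (k, i)" "k \<in> {1..d}" "i \<in> V" by (auto simp: V_def)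
  show "(\<lambda>x. case p of (k, i) \<Rightarrow> x i k) \<in> measurable X.\<Omega> N01"
    using all_moments_measurable[OF X.all_moments_entry[OF p(3,2)]] by (simp add: p(1))
qed

text \<open>The Gaussian matrix has independent entries, hence independent columns. Both laws agree on
boxes.\<close>

lemma distr_matrix_of_columns: "distr X.\<Omega> (gaussian_matrix d n) matrix_of_columns = gaussian_matrix d n"
proof -
  interpret N: product_prob_space "\<lambda>_::nat \<times> nat. N01" positions by (rule product_prob_spaceI) (rule prob_N01)
  interpret R: product_prob_space "\<lambda>_::nat. N01" "{1..d}" by (rule product_prob_spaceI) (rule prob_N01)
  interpret C: product_prob_space "\<lambda>_::nat. \<gamma>" V by (rule product_prob_spaceI) (rule G.prob_space_axioms)
  have "distr X.\<Omega> (PiM positions (\<lambda>_. N01)) matrix_of_columns = PiM positions (\<lambda>_. N01)"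
  proof (rule N.PiM_eqI)
    fix A :: "nat \<times> nat \<Rightarrow> real set" assume A: "\<And>p. p \<in> positions \<Longrightarrow> A p \<in> sets N01"
    have S: "Pi\<^sub>E positions A \<in> sets (PiM positions (\<lambda>_. N01))"
      using A by (intro sets_PiM_I_finite) auto
    have col: "Pi\<^sub>E {1..d} (\<lambda>k. A (k, i)) \<in> sets \<gamma>" if "i \<in> V" for i
      unfolding \<gamma>_def using A that by (intro sets_PiM_I_finite) (auto simp: V_def)
    have eq: "matrix_of_columns -` (Pi\<^sub>E positions A) \<inter> space X.\<Omega> = Pi\<^sub>E V (\<lambda>i. Pi\<^sub>E {1..d} (\<lambda>k. A (k, i)))"
    proof (intro equalityI subsetI)
      fix x assume x: "x \<in> matrix_of_columns -` (Pi\<^sub>E positions A) \<inter> space X.\<Omega>"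
      then have sp: "x \<in> Pi\<^sub>E V (\<lambda>_. space \<gamma>)" by (simp add: space_PiM)
      have "x i k \<in> A (k, i)" if "k \<in> {1..d}" "i \<in> V" for i k
        using x that PiE_mem[of "matrix_of_columns x" positions A "(k, i)"] by (auto simp: matrix_of_columns_def V_def)
      moreover have "x i \<in> extensional {1..d}" if "i \<in> V" for i
        using PiE_mem[OF sp that] by (simp add: \<gamma>_def space_PiM PiE_def)
      ultimately show "x \<in> Pi\<^sub>E V (\<lambda>i. Pi\<^sub>E {1..d} (\<lambda>k. A (k, i)))"
        using sp by (auto simp: PiE_def)
    next
      fix x assume x: "x \<in> Pi\<^sub>E V (\<lambda>i. Pi\<^sub>E {1..d} (\<lambda>k. A (k, i)))"
      have "x \<in> space X.\<Omega>"
        using x col[THEN sets.sets_into_space] by (auto simp: space_PiM PiE_def Pi_def)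
      moreover have "matrix_of_columns x \<in> Pi\<^sub>E positions A"
        using x by (auto simp: matrix_of_columns_def V_def PiE_def Pi_def)
      ultimately show "x \<in> matrix_of_columns -` (Pi\<^sub>E positions A) \<inter> space X.\<Omega>" by simp
    qed
    have "emeasure (distr X.\<Omega> (PiM positions (\<lambda>_. N01)) matrix_of_columns) (Pi\<^sub>E positions A)
        = emeasure X.\<Omega> (Pi\<^sub>E V (\<lambda>i. Pi\<^sub>E {1..d} (\<lambda>k. A (k, i))))"
      unfolding eq[symmetric] by (rule emeasure_distr[OF matrix_of_columns_measurable[unfolded gaussian_matrix_eq] S])
    also have "\<dots> = (\<Prod>i\<in>V. emeasure \<gamma> (Pi\<^sub>E {1..d} (\<lambda>k. A (k, i))))"
      using col by (intro C.emeasure_PiM) auto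
    also have "\<dots> = (\<Prod>i\<in>V. \<Prod>k\<in>{1..d}. emeasure N01 (A (k, i)))"
      unfolding \<gamma>_def using A by (intro prod.cong refl R.emeasure_PiM) (auto simp: V_def)
    also have "\<dots> = (\<Prod>k\<in>{1..d}. \<Prod>i\<in>V. emeasure N01 (A (k, i)))" by (rule prod.swap)
    also have "\<dots> = (\<Prod>p\<in>positions. emeasure N01 (A p))"
      by (simp add: prod.cartesian_product V_def case_prod_beta)
    finally show "emeasure (distr X.\<Omega> (PiM positions (\<lambda>_. N01)) matrix_of_columns) (Pi\<^sub>E positions A)
        = (\<Prod>p\<in>positions. emeasure N01 (A p))" .
  qed auto
  then show ?thesis by (simp only: gaussian_matrix_eq)
qed

lemma schur_measurable: "schur n A \<in> measurable (mat_space n) (mat_space n)"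
  unfolding mat_space_def schur_def[abs_def]
  by (intro measurable_restrict borel_measurable_times borel_measurable_const measurable_component_singleton) 

lemma wishart_measurable: "(\<lambda>X. schur n A (wishart_transform n d X)) \<in> measurable (gaussian_matrix d n) (mat_space n)"
proof -
  have entry: "(\<lambda>X. X p) \<in> borel_measurable (gaussian_matrix d n)" if "p \<in> positions" for p
    using measurable_component_singleton[OF that, of "\<lambda>_. N01"] unfolding gaussian_matrix_eq by simp
  have "wishart_transform n d \<in> measurable (gaussian_matrix d n) (mat_space n)"
    unfolding mat_space_def wishart_transform_def[abs_def]
  proof (rule measurable_restrict)
    fix p assume p: "p \<in> {1..n} \<times> {1..n}"
    obtain i j where [simp]: "p = (i, j)" by (cases p)
    show "(\<lambda>X. case p of (i, j) \<Rightarrow> ((\<Sum>k=1..d. X (k, i) * X (k, j)) - (if i = j then real d else 0)) / sqrt (real d))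
      \<in> borel_measurable (gaussian_matrix d n)"
      using p unfolding \<open>p = (i, j)\<close> case_prod_conv
      by (intro borel_measurable_divide borel_measurable_diff borel_measurable_sum borel_measurable_times
          borel_measurable_const entry) auto
  qed
  then show ?thesis using schur_measurable by (rule measurable_compose)
qed

lemma kappa4_measurable: "kappa4 G \<in> borel_measurable (mat_space n)"
proof -
  have entry: "(\<lambda>M. M (i, j)) \<in> borel_measurable (mat_space n)" if "i \<in> V" "j \<in> V" for i j
    unfolding mat_space_def using that by (intro measurable_component_singleton) (simp add: V_def)
  have 1: "(\<lambda>M. case t of (i, j, k, l) \<Rightarrow> M (i, j) * M (j, k) * M (k, l) * M (l, i)) \<in> borel_measurable (mat_space n)"
    if "t \<in> C4_set G" for t
  proof (cases t)
    case (fields i j k l)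
    show ?thesis using that C4_set_V[of i j k l] unfolding fields case_prod_conv
      by (intro borel_measurable_times entry) auto
  qed
  have 2: "(\<lambda>M. case t of (i, j, k) \<Rightarrow> (M (i, j) ^ 2 - 1) * (M (j, k) ^ 2 - 1)) \<in> borel_measurable (mat_space n)"
    if "t \<in> P2_set G" for t
  proof (cases t)
    case (fields i j k)
    show ?thesis using that P2_set_V[of i j k] unfolding fields case_prod_conv
      by (intro borel_measurable_times borel_measurable_diff borel_measurable_power borel_measurable_const entry) auto
  qed
  have 3: "(\<lambda>M. case t of (i, j) \<Rightarrow> M (i, j) ^ 4 - 6 * M (i, j) ^ 2 + 3) \<in> borel_measurable (mat_space n)"
    if "t \<in> edge_pairs G" for t
  proof (cases t)
    case (Pair i j)
    show ?thesis using that edge_pairs_V[of i j] unfolding Pair case_prod_conv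
      by (intro borel_measurable_add borel_measurable_times borel_measurable_diff borel_measurable_power borel_measurable_const entry) auto
  qed
  show ?thesis unfolding kappa4_def[abs_def]
    by (intro borel_measurable_add borel_measurable_sum 1 2 3)
qed

lemma kappa4_kappa_of: "kappa4 G M = kappa_of (\<lambda>i j. M (i, j))"
  by (simp add: kappa4_def kappa_of_def)

text \<open>The statistic only looks at entries on edges, where the mask is 1 and the diagonal
correction is absent.\<close>

lemma kappa4_wishart: "kappa4 G (schur n (adj G) (wishart_transform n d (matrix_of_columns x))) = kappa_W x"
proof -
  have "kappa4 G (schur n (adj G) (wishart_transform n d (matrix_of_columns x))) = kappa4 G (\<lambda>(i, j). X.w i j x)"
  proof (rule kappa4_cong)
    fix i j assume e: "{i, j} \<in> snd G"
    have V: "i \<in> {1..n}" "j \<in> {1..n}" "i \<noteq> j" using edge_V[OF e] edge_neq[OF e] by (auto simp: V_def)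
    have "(\<Sum>k=1..d. matrix_of_columns x (k, i) * matrix_of_columns x (k, j)) = ip (x i) (x j)"
      unfolding ip_def using V by (intro sum.cong refl) (simp add: matrix_of_columns_def)
    then show "schur n (adj G) (wishart_transform n d (matrix_of_columns x)) (i, j) = (\<lambda>(i, j). X.w i j x) (i, j)"
      using V e by (simp add: schur_def adj_def wishart_transform_def X.w_def)
  qed
  then show ?thesis by (simp add: kappa4_kappa_of kappa_W_def)
qed

lemma wishart_law: "kappa4_law G (masked_wishart n G d) = distr X.\<Omega> borel kappa_W"
proof -
  let ?F = "\<lambda>X. schur n (adj G) (wishart_transform n d X)"
  have "kappa4_law G (masked_wishart n G d) = distr (gaussian_matrix d n) borel (kappa4 G \<circ> ?F)"
    unfolding kappa4_law_def masked_wishart_def by (rule distr_distr[OF kappa4_measurable wishart_measurable])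
  also have "\<dots> = distr (distr X.\<Omega> (gaussian_matrix d n) matrix_of_columns) borel (kappa4 G \<circ> ?F)"
    unfolding distr_matrix_of_columns ..
  also have "\<dots> = distr X.\<Omega> borel ((kappa4 G \<circ> ?F) \<circ> matrix_of_columns)"
    by (rule distr_distr[OF measurable_comp[OF wishart_measurable kappa4_measurable] matrix_of_columns_measurable])
  also have "(kappa4 G \<circ> ?F) \<circ> matrix_of_columns = kappa_W" by (auto simp: kappa4_wishart)
  finally show ?thesis .
qed

definition symm :: "rmat \<Rightarrow> rmat" where "symm Y = (\<lambda>(i, j)\<in>{1..n} \<times> {1..n}. Y (min i j, max i j))"

lemma goe_eq: "goe n = distr \<Psi> (mat_space n) symm"
  unfolding goe_def upper_def entry_law_def symm_def[abs_def] ..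

lemma symm_measurable: "symm \<in> measurable \<Psi> (mat_space n)"
  unfolding mat_space_def symm_def[abs_def]
proof (rule measurable_restrict)
  fix p assume p: "p \<in> {1..n} \<times> {1..n}"
  obtain i j where ij: "p = (i, j)" by (cases p)
  have "(min i j, max i j) \<in> upper" using p ij uindex_upper[of i j] by (simp add: uindex_def V_def)
  from measurable_component_singleton[OF this, of entry_law]
  show "(\<lambda>Y. case p of (i, j) \<Rightarrow> Y (min i j, max i j)) \<in> borel_measurable \<Psi>"
    by (simp add: ij entry_law_def)
qed

lemma kappa4_goe: "kappa4 G (schur n (adj G) (symm x)) = kappa_Y x"
proof -
  have "kappa4 G (schur n (adj G) (symm x)) = kappa4 G (\<lambda>(i, j). x (uindex i j))"
  proof (rule kappa4_cong)
    fix i j assume e: "{i, j} \<in> snd G"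
    have V: "i \<in> {1..n}" "j \<in> {1..n}" using edge_V[OF e] by (auto simp: V_def)
    then show "schur n (adj G) (symm x) (i, j) = (\<lambda>(i, j). x (uindex i j)) (i, j)"
      using e by (simp add: schur_def adj_def symm_def uindex_def)
  qed
  then show ?thesis by (simp add: kappa4_kappa_of kappa_Y_def)
qed

lemma goe_law: "kappa4_law G (masked_goe n G) = distr \<Psi> borel kappa_Y"
proof -
  have sm: "schur n (adj G) \<in> measurable (goe n) (mat_space n)"
    using schur_measurable by (simp add: goe_eq)
  have "kappa4_law G (masked_goe n G) = distr (goe n) borel (kappa4 G \<circ> schur n (adj G))"
    unfolding kappa4_law_def masked_goe_def by (rule distr_distr[OF kappa4_measurable sm])
  also have "\<dots> = distr \<Psi> borel ((kappa4 G \<circ> schur n (adj G)) \<circ> symm)"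
    unfolding goe_eq by (rule distr_distr[OF measurable_comp[OF schur_measurable kappa4_measurable] symm_measurable])
  also have "(kappa4 G \<circ> schur n (adj G)) \<circ> symm = kappa_Y" by (auto simp: kappa4_goe)
  finally show ?thesis .
qed

lemma prob_masked_wishart: "prob_space (masked_wishart n G d)"
proof -
  have "prob_space (gaussian_matrix d n)"
    unfolding gaussian_matrix_eq by (rule prob_space_PiM) (rule prob_N01)
  then show ?thesis unfolding masked_wishart_def using wishart_measurable by (rule prob_space.prob_space_distr)
qed

lemma prob_masked_goe: "prob_space (masked_goe n G)"
proof -
  have "prob_space (goe n)"
    unfolding goe_eq using Y.P.prob_space_axioms symm_measurable by (rule prob_space.prob_space_distr)
  moreover have "schur n (adj G) \<in> measurable (goe n) (mat_space n)"
    using schur_measurable by (simp add: goe_eq)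
  ultimately show ?thesis unfolding masked_goe_def by (rule prob_space.prob_space_distr)
qed

text \<open>The bound for a single graph, from which the limit is immediate. The factor \<open>10\<^sup>2\<^sup>7\<close> collects
the constants of the two variances.\<close>

lemma tv_bounds:
  assumes "num_terms > 0"
  defines "K \<equiv> tv_dist (kappa4_law G (masked_wishart n G d)) (kappa4_law G (masked_goe n G))"
    and "W \<equiv> tv_dist (masked_wishart n G d) (masked_goe n G)"
  shows "1 - 10 ^ 27 * (real d ^ 2 / num_terms + num_bad / num_terms ^ 2) \<le> K" "K \<le> W" "W \<le> 1"
proof -
  show "W \<le> 1" unfolding W_def by (rule tv_dist_le_1(1)[OF prob_masked_wishart prob_masked_goe])
  show "K \<le> W" unfolding K_def W_def kappa4_law_def
  proof (rule tv_dist_distr_le[OF prob_masked_wishart prob_masked_goe])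
    show "sets (masked_wishart n G d) = sets (masked_goe n G)"
      by (simp add: masked_wishart_def masked_goe_def)
    show "kappa4 G \<in> borel_measurable (masked_wishart n G d)"
      using kappa4_measurable by (simp add: masked_wishart_def)
  qed
  have "1 - 4 * (9 * var_bound + 10 ^ 25 * real num_terms) / (num_terms / d) ^ 2 \<le> K"
    unfolding K_def wishart_law goe_law
  proof (rule tv_dist_ge_of_moments[OF X.W.P.prob_space_axioms kappa_W_moments(1) Y.P.prob_space_axioms kappa_Y_moments(1,2)])
    show "0 < real num_terms / real d" using assms d_pos by simp
  qed (rule kappa_W_moments kappa_Y_moments)+
  moreover have "4 * (9 * var_bound + 10 ^ 25 * real num_terms) / (num_terms / d) ^ 2 \<le> 10 ^ 27 * (real d ^ 2 / num_terms + num_bad / num_terms ^ 2)"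
  proof -
    have "4 * (9 * var_bound + 10 ^ 25 * real num_terms) / (num_terms / d) ^ 2 =
      4 * 10 ^ 25 * (10 * (real d ^ 2 / num_terms) + 9 * (num_bad / num_terms ^ 2))"
      using assms d_pos by (simp add: field_simps power2_eq_square)
    also have "\<dots> \<le> 10 ^ 27 * (real d ^ 2 / num_terms + num_bad / num_terms ^ 2)"
    proof -
      have "4 * 10 ^ 25 * (10 * u + 9 * v) \<le> 10 ^ 27 * (u + v)" if "u \<ge> 0" "v \<ge> 0" for u v :: real
        using that by simp
      from this[of "real d ^ 2 / num_terms" "num_bad / num_terms ^ 2"] show ?thesis by (simp only: divide_nonneg_nonneg of_nat_0_le_iff zero_le_power2 zero_le_power)
    qed
    finally show ?thesis .
  qed
  ultimately show "1 - 10 ^ 27 * (real d ^ 2 / num_terms + num_bad / num_terms ^ 2) \<le> K" by linarith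
qed

end

section \<open>The limit\<close>

text \<open>The quotient in the definition is inverted. Where \<open>f n = 0\<close>, the quotient \<open>f n / g n\<close> is 0
whatever \<open>g n\<close> is.\<close>

lemma much_less_tendsto_0:
  fixes f g :: "nat \<Rightarrow> real"
  assumes "f \<lless> g" "\<And>n. f n \<ge> 0" "\<And>n. g n \<ge> 0"
  shows "(\<lambda>n. f n / g n) \<longlonglongrightarrow> 0"
proof (rule order_tendstoI)
  fix a :: real assume "a < 0"
  then show "\<forall>\<^sub>F n in sequentially. a < f n / g n"
    using assms(2,3) by (intro always_eventually allI) (meson divide_nonneg_nonneg less_le_trans)
next
  fix a :: real assume a: "0 < a"
  have "\<forall>\<^sub>F n in sequentially. ereal (1 / a) < ereal (g n) / ereal (f n)"
    using assms(1) unfolding much_less_def tendsto_PInfty by blast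
  then show "\<forall>\<^sub>F n in sequentially. f n / g n < a"
  proof (rule eventually_mono)
    fix n assume h: "ereal (1 / a) < ereal (g n) / ereal (f n)"
    show "f n / g n < a"
    proof (cases "f n = 0")
      case True then show ?thesis using a by simp
    next
      case False
      then have f: "f n > 0" using assms(2)[of n] by linarith
      then have "1 / a < g n / f n" using h by simp
      moreover from this have "0 < g n / f n" using a by (meson less_trans zero_less_divide_1_iff)
      then have "0 < g n" using f by (simp add: zero_less_divide_iff)
      ultimately show ?thesis using f a by (simp add: field_simps)
    qed
  qed
qed

theorem theorem3p2:
  fixes G :: "nat \<Rightarrow> nat ugraph" and d N :: "nat \<Rightarrow> nat"
  assumes "\<And>n. simple_graph_on n (G n)"
    and "\<And>n. d n > 0"
    and "\<And>n. N n = num_sub (G n) cycle4 + num_sub (G n) path2 + num_sub (G n) single_edge"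
    and "(\<lambda>n. real (d n) ^ 2) \<lless> (\<lambda>n. real (N n))"
    and "(\<lambda>n. real (num_sub (G n) (complete_bipartite 1 4) + num_sub (G n) (complete_bipartite 2 4)
             + num_sub (G n) cycle4_2e + num_sub (G n) cycle4_2v)) \<lless> (\<lambda>n. real (N n) ^ 2)"
  shows "(\<lambda>n. tv_dist (kappa4_law (G n) (masked_wishart n (G n) (d n)))
                      (kappa4_law (G n) (masked_goe n (G n)))) \<longlonglongrightarrow> 1
       \<and> (\<lambda>n. tv_dist (masked_wishart n (G n) (d n)) (masked_goe n (G n))) \<longlonglongrightarrow> 1"
proof -
  let ?K = "\<lambda>n. tv_dist (kappa4_law (G n) (masked_wishart n (G n) (d n))) (kappa4_law (G n) (masked_goe n (G n)))"
  let ?W = "\<lambda>n. tv_dist (masked_wishart n (G n) (d n)) (masked_goe n (G n))"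
  let ?c = "\<lambda>n. real (num_sub (G n) (complete_bipartite 1 4) + num_sub (G n) (complete_bipartite 2 4)
             + num_sub (G n) cycle4_2e + num_sub (G n) cycle4_2v)"
  let ?L = "\<lambda>n. 1 - 10 ^ 27 * (real (d n) ^ 2 / real (N n) + ?c n / real (N n) ^ 2)"
  have model: "masked (d n) n (G n)" for n
    using assms(1,2) by (simp add: masked_def gauss_vec_def vertex_graph_def)
  have bounds: "?L n \<le> ?K n \<and> ?K n \<le> ?W n \<and> ?W n \<le> 1" if "N n > 0" for n
  proof -
    interpret masked "d n" n "G n" by (rule model)
    have "num_terms = N n" by (simp add: num_terms_def assms(3))
    then show ?thesis using tv_bounds that unfolding num_bad_def by simp
  qed
  have "\<forall>\<^sub>F n in sequentially. ereal 0 < ereal (real (N n)) / ereal (real (d n) ^ 2)"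
    using assms(4) unfolding much_less_def tendsto_PInfty by blast
  then have "\<forall>\<^sub>F n in sequentially. N n > 0"
  proof (rule eventually_mono)
    fix n assume "ereal 0 < ereal (real (N n)) / ereal (real (d n) ^ 2)"
    moreover have "real (d n) ^ 2 \<noteq> 0" using assms(2)[of n] by simp
    ultimately have "0 < real (N n) / real (d n) ^ 2" by simp
    then show "N n > 0" by (simp add: zero_less_divide_iff)
  qed
  then have ev: "\<forall>\<^sub>F n in sequentially. ?L n \<le> ?K n \<and> ?K n \<le> ?W n \<and> ?W n \<le> 1"
    by (rule eventually_mono) (rule bounds)
  have "(\<lambda>n. real (d n) ^ 2 / real (N n)) \<longlonglongrightarrow> 0" "(\<lambda>n. ?c n / real (N n) ^ 2) \<longlonglongrightarrow> 0"
    using assms(4,5) by (auto intro!: much_less_tendsto_0)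
  then have "?L \<longlonglongrightarrow> 1 - 10 ^ 27 * (0 + 0)" by (intro tendsto_intros)
  then have L: "?L \<longlonglongrightarrow> 1" by simp
  have "?K \<longlonglongrightarrow> 1"
    by (rule tendsto_sandwich[OF _ _ L tendsto_const]) (use ev in \<open>auto elim!: eventually_mono\<close>)
  moreover have "?W \<longlonglongrightarrow> 1"
    by (rule tendsto_sandwich[OF _ _ L tendsto_const]) (use ev in \<open>auto elim!: eventually_mono\<close>)
  ultimately show ?thesis by blast
qed

end
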